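(* Let $m\ge 2$, $\gamma>0$, $u>0$, and let $\delta(\gamma,u)=\sqrt{\frac{\gamma^2(m-1)^2}{u^2}+\frac14}$. For $0\le k\le \lfloor\frac m2-1\rfloor$ set $\delta_k=k+\lceil\frac m2\rceil-\frac m2$ (so $\delta_k=k$ if $m$ is even and $\delta_k=k+\frac12$ if $m$ is odd), and set $\delta_{\lfloor m/2\rfloor}=\infty$. Then the bulk-difference invariant $\mathrm{BDI}(\gamma,u)$ (defined in the context whenever $\delta(\gamma,u)\notin\{\delta_k\}$) takes exactly $\lfloor\frac m2\rfloor$ distinct values (quantum anomalous Hall phases), namely $$\mathrm{BDI}(\gamma,u)=\mathrm{BDI}_j:=\frac{m^2}{2}-2\delta_j(\delta_j+1)\quad\text{whenever}\quad \delta_j<\delta(\gamma,u)<\delta_{j+1},$$ for $0\le j\le\lfloor\frac m2-1\rfloor$.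
   Context: Let $\sigma_1,\sigma_2$ be the standard Pauli matrices and $A=\begin{pmatrix}0&0\\1&0\end{pmatrix}$. For a real number $v$ and $\kappa=k_x+ik_y\in\mathbb C\cong\mathbb R^2$, let $\hat H(\kappa;v)$ be the $2m\times 2m$ Hermitian matrix written in $m\times m$ blocks of size $2\times2$ whose $j$-th diagonal block is $u_jI_2+\begin{pmatrix}0&\bar\kappa\\ \kappa&0\end{pmatrix}$ with $u_j=\frac{v}{m-1}\big(j-\frac{m+1}{2}\big)$, whose $(j,j+1)$ block is $\gamma A$ and whose $(j+1,j)$ block is $\gamma A^*$ for $1\le j\le m-1$, all other blocks zero (valley index $+1$, AB stacking). Set $\hat H^N(\kappa)=\hat H(\kappa;u)$ and $\hat H^S(\kappa)=\hat H(\kappa;-u)$. When $\delta(\gamma,u)$ differs from all $\delta_k$, $0$ is not an eigenvalue of $\hat H^h(\kappa)$ for any $\kappa\in\mathbb R^2$, $h\in\{N,S\}$, and one defines the projector $\Pi^h(\kappa)$ onto the span of the eigenvectors of $\hat H^h(\kappa)$ with negative eigenvalues. For a smooth family of projectors $\Pi$ on $\mathbb R^2$ put $\mathcal C[\Pi]=\frac{i}{2\pi}\int_{\mathbb R^2}\mathrm{tr}\,\Pi\, d\Pi\wedge d\Pi$, with $d\Pi=\partial_{k_x}\Pi\,dk_x+\partial_{k_y}\Pi\,dk_y$. The bulk-difference invariant is $\mathrm{BDI}(\gamma,u)=\mathcal C[\Pi^S]-\mathcal C[\Pi^N]$. *)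

theory Defs
  imports "HOL-Analysis.Analysis" "Jordan_Normal_Form.Schur_Decomposition"
begin

text \<open>The 2m x 2m Hamiltonian (valley +1, AB stacking), rows/columns indexed 0..2m-1;
  index r belongs to block r div 2 (0-based) and position r mod 2 inside the block.
  The wave vector kappa = kx + i ky is a complex number.\<close>
definition Hmat :: "nat \<Rightarrow> real \<Rightarrow> real \<Rightarrow> complex \<Rightarrow> complex mat" where
  "Hmat m \<gamma> v \<kappa> = mat (2*m) (2*m) (\<lambda>(r,c).
     let b = r div 2; b' = c div 2; a = r mod 2; a' = c mod 2 in
     if b = b' then
       (if a = a' then complex_of_real (v / (real m - 1) * (real (b+1) - (real m + 1) / 2))
        else if a = 0 then cnj \<kappa> else \<kappa>)
     else if b' = b + 1 \<and> a = 1 \<and> a' = 0 then complex_of_real \<gamma>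
     else if b = b' + 1 \<and> a = 0 \<and> a' = 1 then complex_of_real \<gamma>
     else 0)"

definition neg_eig_span :: "complex mat \<Rightarrow> complex vec set" where
  "neg_eig_span H = LinearCombinations.module.span class_ring (module_vec TYPE(complex) (dim_row H))
      {w. \<exists>e. eigenvector H w e \<and> e \<in> \<real> \<and> Re e < 0}"

definition neg_proj :: "complex mat \<Rightarrow> complex mat" where
  "neg_proj H = (THE P. P \<in> carrier_mat (dim_row H) (dim_row H) \<and> P * P = P \<and> mat_adjoint P = P
      \<and> {w \<in> carrier_vec (dim_row H). P *\<^sub>v w = w} = neg_eig_span H)"

text \<open>Entrywise directional derivative of an n x n matrix family at kappa in direction d
  (d = 1 gives the k_x derivative, d = i gives the k_y derivative).\<close>
definition mat_dderiv :: "nat \<Rightarrow> (complex \<Rightarrow> complex mat) \<Rightarrow> complex \<Rightarrow> complex \<Rightarrow> complex mat" where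
  "mat_dderiv n P \<kappa> d = mat n n (\<lambda>(i,j).
      vector_derivative (\<lambda>t::real. P (\<kappa> + complex_of_real t * d) $$ (i,j)) (at 0))"

definition mtrace :: "complex mat \<Rightarrow> complex" where
  "mtrace A = (\<Sum>i<dim_row A. A $$ (i,i))"

text \<open>C[P] = i/(2 pi) integral over R^2 of tr P dP wedge dP
  = i/(2 pi) integral of tr(P (P_x P_y - P_y P_x)) dkx dky.\<close>
definition chern :: "nat \<Rightarrow> (complex \<Rightarrow> complex mat) \<Rightarrow> complex" where
  "chern n P = \<i> / (2 * complex_of_real pi) *
     integral UNIV (\<lambda>\<kappa>. mtrace (P \<kappa> * (mat_dderiv n P \<kappa> 1 * mat_dderiv n P \<kappa> \<i>
                                         - mat_dderiv n P \<kappa> \<i> * mat_dderiv n P \<kappa> 1)))"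

definition BDI :: "nat \<Rightarrow> real \<Rightarrow> real \<Rightarrow> complex" where
  "BDI m \<gamma> u = chern (2*m) (\<lambda>\<kappa>. neg_proj (Hmat m \<gamma> (-u) \<kappa>))
              - chern (2*m) (\<lambda>\<kappa>. neg_proj (Hmat m \<gamma> u \<kappa>))"

definition delta :: "nat \<Rightarrow> real \<Rightarrow> real \<Rightarrow> real" where
  "delta m \<gamma> u = sqrt (\<gamma>^2 * (real m - 1)^2 / u^2 + 1/4)"

definition delta_k :: "nat \<Rightarrow> nat \<Rightarrow> real" where
  "delta_k m k = real k + real_of_int \<lceil>real m / 2\<rceil> - real m / 2"

definition BDI_val :: "nat \<Rightarrow> nat \<Rightarrow> real" where
  "BDI_val m j = (real m)^2 / 2 - 2 * delta_k m j * (delta_k m j + 1)"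

end

theory Submission
  imports Defs
begin

text \<open>
  Let \<open>N\<close> be the diagonal matrix with entries \<open>(a + 1) div 2\<close>. Conjugation with \<open>exp (\<i> * \<theta> * N)\<close> rotates
  \<open>\<kappa>\<close>, so \<open>tr (N * \<Pi>)\<close> is a function \<open>G\<close> of \<open>r = |\<kappa>|\<close>, and the curvature \<open>tr (\<Pi> * [\<Pi>_x, \<Pi>_y])\<close> equals
  \<open>\<i> * G'(r) / r\<close>. Hence the Chern integral is \<open>G(0) - G(\<infinity>)\<close>. At infinity the in-plane part dominates
  and \<open>G(\<infinity>) = m^2 / 2\<close>; at \<open>\<kappa> = 0\<close> the Hamiltonian splits into blocks of size at most two on which \<open>N\<close> is
  constant, so \<open>G(0)\<close> counts the negative block eigenvalues with weights. Changing the sign of \<open>v\<close>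
  replaces \<open>G\<close> by \<open>m^2 - G\<close>.

  The gap closes only at \<open>\<kappa> = 0\<close>. Differentiability of the spectral projector and all bounds come
  from the Davis--Kahan comparison of two eigenbases.
\<close>

text \<open>The curvature formula rests on two facts. The angular derivative of the projector is its
  commutator with \<open>\<i> * N\<close>, and passing from Cartesian to radial and angular
  derivatives costs only the determinant r^2. A derivative of a projector has entries only between
  occupied and empty states, so pairing it with that commutator leaves a plain trace against N. The
  delicate point is decay. The projector derivative is bounded by the size of the direction over the
  gap, and a gap growing like r gives only order 1/r for G', which is not integrable. The missing
  power comes from scaling: a positive multiple of H has the same projector, so r * G' can be
  computed in the fixed direction -H(0) and is itself of order 1/r. Eigenvectors are never followed
  continuously: estimates compare arbitrary eigenbases at two points, and derivatives are read off
  in the basis of one fixed point. The value m^2 / 2 is half of tr N: a diagonal of signs carries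
  the in-plane part to its negative, so every index is half occupied.\<close>

unbundle no vec_syntax

section \<open>Spectral theorem for Hermitian matrices\<close>

lemma mult_square_carrier [simp]:
  "A \<in> carrier_mat n n \<Longrightarrow> B \<in> carrier_mat n n \<Longrightarrow> A * B \<in> carrier_mat n n"
  by simp

lemma mat_adjoint_carrier [simp]:
  "A \<in> carrier_mat n k \<Longrightarrow> mat_adjoint A \<in> carrier_mat k n"
  by (auto simp: mat_adjoint_def mat_of_rows_def)

lemma mat_adjoint_dim [simp]:
  "dim_row (mat_adjoint A) = dim_col A" "dim_col (mat_adjoint A) = dim_row A"
  by (auto simp: mat_adjoint_def)

lemma mat_adjoint_index [simp]:
  assumes "A \<in> carrier_mat n k" "i < k" "j < n"
  shows "mat_adjoint A $$ (i,j) = cnj (A $$ (j,i))"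
  using assms by (auto simp: mat_adjoint_def mat_of_rows_index cols_nth)

lemma mat_adjoint_adjoint [simp]:
  fixes A :: "complex mat"
  assumes "A \<in> carrier_mat n k"
  shows "mat_adjoint (mat_adjoint A) = A"
proof (rule eq_matI)
  have *: "mat_adjoint A \<in> carrier_mat k n" using assms by simp
  fix i j assume "i < dim_row A" "j < dim_col A"
  thus "mat_adjoint (mat_adjoint A) $$ (i,j) = A $$ (i,j)"
    using assms * by (simp add: mat_adjoint_index[OF *])
qed (use assms in \<open>auto simp: mat_adjoint_def\<close>)

lemma mult_mat_index:
  assumes "A \<in> carrier_mat n k" "B \<in> carrier_mat k l" "i < n" "j < l"
  shows "(A * B) $$ (i,j) = (\<Sum>x<k. A $$ (i,x) * B $$ (x,j))"
  using assms by (auto simp: scalar_prod_def atLeast0LessThan intro!: sum.cong)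

lemma mult_mat_vec_sum:
  assumes "A \<in> carrier_mat n k" "w \<in> carrier_vec k" "i < n"
  shows "(A *\<^sub>v w) $ i = (\<Sum>x<k. A $$ (i,x) * w $ x)"
  using assms by (auto simp: scalar_prod_def atLeast0LessThan intro!: sum.cong)

lemma mat_adjoint_mult:
  fixes A :: "complex mat"
  assumes A: "A \<in> carrier_mat n k" and B: "B \<in> carrier_mat k l"
  shows "mat_adjoint (A * B) = mat_adjoint B * mat_adjoint A"
proof (rule eq_matI)
  have AB: "A * B \<in> carrier_mat n l" using A B by simp
  have BA: "mat_adjoint B * mat_adjoint A \<in> carrier_mat l n"
    using A B by (intro mult_carrier_mat[of _ l k]) auto
  have a: "mat_adjoint A \<in> carrier_mat k n" and b: "mat_adjoint B \<in> carrier_mat l k"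
    using A B by auto
  fix i j assume "i < dim_row (mat_adjoint B * mat_adjoint A)"
    "j < dim_col (mat_adjoint B * mat_adjoint A)"
  hence ij: "i < l" "j < n" using BA by auto
  show "mat_adjoint (A * B) $$ (i,j) = (mat_adjoint B * mat_adjoint A) $$ (i,j)"
    unfolding mat_adjoint_index[OF AB ij] mult_mat_index[OF b a ij] mult_mat_index[OF A B ij(2,1)]
    using A B ij by (simp add: mult.commute)
qed (use A B in \<open>auto simp: mat_adjoint_def\<close>)

definition real_diag :: "nat \<Rightarrow> (nat \<Rightarrow> real) \<Rightarrow> complex mat" where
  "real_diag n f = mat n n (\<lambda>(i,j). if i = j then complex_of_real (f i) else 0)"

lemma real_diag_carrier [simp]: "real_diag n f \<in> carrier_mat n n"
  by (simp add: real_diag_def)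

lemma real_diag_index [simp]:
  "i < n \<Longrightarrow> j < n \<Longrightarrow> real_diag n f $$ (i,j) = (if i = j then complex_of_real (f i) else 0)"
  by (simp add: real_diag_def)

lemma mat_adjoint_real_diag [simp]: "mat_adjoint (real_diag n f) = real_diag n f"
proof (rule eq_matI)
  fix i j assume "i < dim_row (real_diag n f)" "j < dim_col (real_diag n f)"
  hence "i < n" "j < n" by (auto simp: real_diag_def)
  thus "mat_adjoint (real_diag n f) $$ (i,j) = real_diag n f $$ (i,j)"
    by (simp add: mat_adjoint_index[OF real_diag_carrier])
qed (auto simp: mat_adjoint_def real_diag_def)

lemma real_diag_mult_left_index:
  assumes "X \<in> carrier_mat n k" "i < n" "j < k"
  shows "(real_diag n f * X) $$ (i,j) = f i * X $$ (i,j)"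
  unfolding mult_mat_index[OF real_diag_carrier assms]
  using assms by (subst sum.remove[of _ i]) auto

lemma real_diag_mult_right_index:
  assumes "X \<in> carrier_mat k n" "i < k" "j < n"
  shows "(X * real_diag n f) $$ (i,j) = X $$ (i,j) * f j"
  unfolding mult_mat_index[OF assms(1) real_diag_carrier assms(2,3)]
  using assms by (subst sum.remove[of _ j]) auto

text \<open>An orthonormal eigenbasis as the columns of \<open>V\<close>. It is a predicate instead
  of a chosen decomposition because eigenbases are neither unique nor continuous in the matrix:
  later estimates hold for any two of them.\<close>

definition spectral_decomp :: "nat \<Rightarrow> complex mat \<Rightarrow> complex mat \<Rightarrow> (nat \<Rightarrow> real) \<Rightarrow> bool" where
  "spectral_decomp n A V lam \<longleftrightarrow> A \<in> carrier_mat n n \<and> V \<in> carrier_mat n n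
     \<and> mat_adjoint V * V = 1\<^sub>m n \<and> A * V = V * real_diag n lam"

lemma spectral_decompD:
  assumes "spectral_decomp n A V lam"
  shows "A \<in> carrier_mat n n" "V \<in> carrier_mat n n"
    "mat_adjoint V * V = 1\<^sub>m n" "V * mat_adjoint V = 1\<^sub>m n"
    "A * V = V * real_diag n lam" "A = V * real_diag n lam * mat_adjoint V"
    "mat_adjoint V * A = real_diag n lam * mat_adjoint V" "mat_adjoint A = A"
proof -
  show A: "A \<in> carrier_mat n n" and V: "V \<in> carrier_mat n n"
    and U: "mat_adjoint V * V = 1\<^sub>m n" and E: "A * V = V * real_diag n lam"
    using assms by (auto simp: spectral_decomp_def)
  have V': "mat_adjoint V \<in> carrier_mat n n" using V by simp
  show U': "V * mat_adjoint V = 1\<^sub>m n"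
    by (rule mat_mult_left_right_inverse[OF V' V U])
  have "A = A * (V * mat_adjoint V)" using A U' by simp
  also have "\<dots> = A * V * mat_adjoint V" using A V V' by (simp add: assoc_mult_mat[of _ n n _ n _ n])
  finally show F: "A = V * real_diag n lam * mat_adjoint V" using E by simp
  have "mat_adjoint V * A = mat_adjoint V * (V * (real_diag n lam * mat_adjoint V))"
    using F V V' by (simp add: assoc_mult_mat[of _ n n _ n _ n])
  also have "\<dots> = (mat_adjoint V * V) * (real_diag n lam * mat_adjoint V)"
    using V V' by (intro assoc_mult_mat[symmetric, of _ n n _ n _ n]) auto
  finally show "mat_adjoint V * A = real_diag n lam * mat_adjoint V"
    using U V' by (simp add: left_mult_one_mat[of _ n n])
  have "mat_adjoint A = mat_adjoint (V * real_diag n lam * mat_adjoint V)" using F by simp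
  also have "\<dots> = V * (real_diag n lam * mat_adjoint V)"
    using V V' by (simp add: mat_adjoint_mult[of _ n n _ n])
  also have "\<dots> = A" using F V V' by (simp add: assoc_mult_mat[of _ n n _ n _ n])
  finally show "mat_adjoint A = A" .
qed

text \<open>Gram-Schmidt started at \<open>v\<close> yields orthogonal vectors that are not
  normalised; dividing by their lengths makes them the columns of a unitary matrix, and
  \<open>c\<close> is the reciprocal length of \<open>v\<close>.\<close>

lemma unitary_completion:
  fixes v :: "complex vec"
  assumes v: "v \<in> carrier_vec n" and v0: "v \<noteq> 0\<^sub>v n"
  obtains W c where "W \<in> carrier_mat n n" "mat_adjoint W * W = 1\<^sub>m n" "col W 0 = c \<cdot>\<^sub>v v" "n > 0"
proof -
  have n: "n > 0" using v v0 by (metis gr0I carrier_vecD eq_vecI index_zero_vec(2) not_less_zero)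
  interpret cof_vec_space n "TYPE(complex)" .
  define b where "b = basis_completion v"
  define ws where "ws = gram_schmidt n b"
  from basis_completion[OF v v0, folded b_def]
  have span_b: "span (set b) = carrier_vec n" and dist_b: "distinct b" 
    and indep: "\<not> lin_dep (set b)" and b: "set b \<subseteq> carrier_vec n" and hdb: "hd b = v" 
    and len_b: "length b = n" by auto
  from hdb len_b n obtain vs where bv: "b = v # vs" by (cases b, auto)
  from gram_schmidt_result[OF b dist_b indep refl, folded ws_def]
  have ws: "set ws \<subseteq> carrier_vec n" "corthogonal ws" "length ws = n" 
    by (auto simp: len_b)
  from gram_schmidt_hd[OF v, of vs, folded bv] have hdws: "hd ws = v" unfolding ws_def .
  have wsc: "ws ! i \<in> carrier_vec n" if "i < n" for i using ws that by auto
  define nu where "nu i = (\<Sum>a<n. (cmod (ws ! i $ a))\<^sup>2)" for i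
  have ip: "ws ! j \<bullet>c ws ! i = (\<Sum>a<n. cnj (ws ! i $ a) * ws ! j $ a)" if "i < n" "j < n" for i j
    using wsc[OF that(1)] wsc[OF that(2)]
    by (auto simp: scalar_prod_def atLeast0LessThan mult.commute intro!: sum.cong)
  have nu: "ws ! i \<bullet>c ws ! i = complex_of_real (nu i)" if "i < n" for i
    unfolding ip[OF that that] nu_def by (simp add: mult.commute flip: complex_norm_square)
  have nupos: "nu i > 0" if "i < n" for i
  proof -
    have "ws ! i \<bullet>c ws ! i \<noteq> 0" using corthogonalD[OF ws(2)] that ws(3) by auto
    hence "nu i \<noteq> 0" using nu[OF that] by auto
    moreover have "nu i \<ge> 0" unfolding nu_def by (simp add: sum_nonneg)
    ultimately show ?thesis by simp
  qed
  define W where "W = mat n n (\<lambda>(a,i). ws ! i $ a / complex_of_real (sqrt (nu i)))"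
  have W: "W \<in> carrier_mat n n" by (simp add: W_def)
  show ?thesis
  proof
    show "W \<in> carrier_mat n n" by fact
    show "mat_adjoint W * W = 1\<^sub>m n"
    proof (rule eq_matI)
      fix i j assume "i < dim_row (1\<^sub>m n)" "j < dim_col (1\<^sub>m n)"
      hence ij: "i < n" "j < n" by auto
      have "(mat_adjoint W * W) $$ (i,j) = (\<Sum>a<n. cnj (W $$ (a,i)) * W $$ (a,j))"
        using W ij by (subst mult_mat_index[of _ n n _ n]) auto
      also have "\<dots> = (\<Sum>a<n. cnj (ws ! i $ a) * ws ! j $ a) / (sqrt (nu i) * sqrt (nu j))"
        using ij by (simp add: W_def sum_divide_distrib)
      also have "\<dots> = (ws ! j \<bullet>c ws ! i) / (sqrt (nu i) * sqrt (nu j))"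
        using ip[OF ij] by simp
      also have "\<dots> = (1\<^sub>m n) $$ (i,j)"
      proof (cases "i = j")
        case True
        have "complex_of_real (sqrt (nu j)) * complex_of_real (sqrt (nu j)) = nu j"
          using nupos[OF ij(2)] by (simp flip: of_real_mult)
        thus ?thesis using True ij nu nupos[OF ij(2)] by simp
      next
        case False
        thus ?thesis using ij corthogonalD[OF ws(2), of j i] ws(3) by auto
      qed
      finally show "(mat_adjoint W * W) $$ (i,j) = (1\<^sub>m n) $$ (i,j)" .
    qed (use W in \<open>auto simp: mat_adjoint_def\<close>)
    show "n > 0" by fact
    have "ws ! 0 = v" using hdws ws(3) n by (cases ws) auto
    thus "col W 0 = (1 / complex_of_real (sqrt (nu 0))) \<cdot>\<^sub>v v"
      using n v by (intro eq_vecI) (auto simp: W_def)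
  qed
qed

text \<open>Deflation: in a unitary basis starting with an eigenvector the first column is zero
  below the diagonal, by hermiticity so is the first row beside it, and the remaining block is
  Hermitian and one size smaller.\<close>

theorem hermitian_spectral_decomp:
  fixes A :: "complex mat"
  assumes "A \<in> carrier_mat n n" "mat_adjoint A = A"
  shows "\<exists>V lam. spectral_decomp n A V lam"
  using assms
proof (induction n arbitrary: A)
  case 0
  show ?case using 0 by (intro exI[of _ A] exI[of _ "\<lambda>_. 0"]) (auto simp: spectral_decomp_def real_diag_def)
next
  case (Suc n)
  note A = Suc.prems(1)
  obtain as where as: "char_poly A = (\<Prod>a\<leftarrow>as. [:- a, 1:])" "length as = Suc n"
    using char_poly_factorized[OF A] by blast
  then obtain e where "poly (char_poly A) e = 0" by (cases as) auto
  hence "eigenvalue A e" using eigenvalue_root_char_poly[OF A] by simp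
  then obtain v where v: "v \<in> carrier_vec (Suc n)" "v \<noteq> 0\<^sub>v (Suc n)" "A *\<^sub>v v = e \<cdot>\<^sub>v v"
    using A by (auto simp: eigenvalue_def eigenvector_def)
  obtain W c where W: "W \<in> carrier_mat (Suc n) (Suc n)" and WW: "mat_adjoint W * W = 1\<^sub>m (Suc n)"
    and col: "col W 0 = c \<cdot>\<^sub>v v"
    using unitary_completion[OF v(1,2)] by metis
  have W': "mat_adjoint W \<in> carrier_mat (Suc n) (Suc n)" using W by simp
  have WW': "W * mat_adjoint W = 1\<^sub>m (Suc n)" by (rule mat_mult_left_right_inverse[OF W' W WW])
  note ass = assoc_mult_mat[of _ "Suc n" "Suc n" _ "Suc n" _ "Suc n"]
  define B where "B = mat_adjoint W * A * W"
  have B: "B \<in> carrier_mat (Suc n) (Suc n)" using W W' A by (simp add: B_def)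
  have AW: "A * W = W * B"
  proof -
    have "W * B = (W * mat_adjoint W) * (A * W)" using W W' A by (simp add: B_def ass)
    thus ?thesis using WW' A W by (simp add: left_mult_one_mat[of _ "Suc n" "Suc n"])
  qed
  have Bh: "mat_adjoint B = B"
    unfolding B_def using W W' A Suc.prems(2)
    by (simp add: mat_adjoint_mult[of _ "Suc n" "Suc n" _ "Suc n"] ass)
  have Bc: "B $$ (i,j) = cnj (B $$ (j,i))" if "i < Suc n" "j < Suc n" for i j
    using Bh mat_adjoint_index[OF B that] by simp
  have B0: "B $$ (i,0) = (if i = 0 then e else 0)" if i: "i < Suc n" for i
  proof -
    have "B $$ (i,0) = (mat_adjoint W * (A * W)) $$ (i,0)"
      using W W' A by (simp add: B_def ass)
    also have "\<dots> = (\<Sum>x<Suc n. mat_adjoint W $$ (i,x) * (A * W) $$ (x,0))"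
      using i W W' A by (intro mult_mat_index) auto
    also have "\<dots> = (\<Sum>x<Suc n. mat_adjoint W $$ (i,x) * (e * W $$ (x,0)))"
    proof (rule sum.cong[OF refl])
      fix x assume x: "x \<in> {..<Suc n}"
      have "(A * W) $$ (x,0) = (A *\<^sub>v col W 0) $ x"
        using x A W by simp
      also have "A *\<^sub>v col W 0 = e \<cdot>\<^sub>v col W 0"
        unfolding col using v A by (simp add: mult_mat_vec[OF A v(1)] smult_smult_assoc mult.commute)
      finally show "mat_adjoint W $$ (i,x) * (A * W) $$ (x,0) = mat_adjoint W $$ (i,x) * (e * W $$ (x,0))"
        using x W by simp
    qed
    also have "\<dots> = e * (mat_adjoint W * W) $$ (i,0)"
      using i W W' by (subst mult_mat_index[of _ "Suc n" "Suc n" _ "Suc n"]) (auto simp: sum_distrib_left mult_ac simp del: sum.lessThan_Suc)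
    finally show ?thesis using WW i by simp
  qed
  have er: "e = complex_of_real (Re e)"
    using Bc[of 0 0] B0[of 0] by (simp add: complex_eq_iff)
  define C where "C = mat n n (\<lambda>(i,j). B $$ (Suc i, Suc j))"
  have C: "C \<in> carrier_mat n n" by (simp add: C_def)
  have "mat_adjoint C = C"
  proof (rule eq_matI)
    fix i j assume "i < dim_row C" "j < dim_col C"
    hence ij: "i < n" "j < n" using C by auto
    show "mat_adjoint C $$ (i,j) = C $$ (i,j)"
      using mat_adjoint_index[OF C ij] Bc[of "Suc i" "Suc j"] ij by (simp add: C_def)
  qed (use C in \<open>auto simp: mat_adjoint_def\<close>)
  from Suc.IH[OF C this] obtain V lam where V: "spectral_decomp n C V lam" by blast
  note VD = spectral_decompD[OF V]
  \<comment> \<open>The block sum of 1 and the eigenbasis of the smaller block; composed with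
    \<open>W\<close> it diagonalises \<open>A\<close>.\<close>
  define Z where "Z = mat (Suc n) (Suc n) (\<lambda>(i,j). case (i,j) of (0,0) \<Rightarrow> 1 | (Suc i, Suc j) \<Rightarrow> V $$ (i,j) | _ \<Rightarrow> 0)"
  have Z: "Z \<in> carrier_mat (Suc n) (Suc n)" by (simp add: Z_def)
  have Z': "mat_adjoint Z \<in> carrier_mat (Suc n) (Suc n)" using Z by simp
  have Zi: "Z $$ (0,0) = 1" "\<And>i. i < n \<Longrightarrow> Z $$ (Suc i,0) = 0" "\<And>i. i < n \<Longrightarrow> Z $$ (0,Suc i) = 0"
    "\<And>i j. i < n \<Longrightarrow> j < n \<Longrightarrow> Z $$ (Suc i,Suc j) = V $$ (i,j)"
    by (auto simp: Z_def)
  define mu where "mu = case_nat (Re e) lam"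
  have ZZ: "mat_adjoint Z * Z = 1\<^sub>m (Suc n)"
  proof (rule eq_matI)
    fix i j assume "i < dim_row (1\<^sub>m (Suc n))" "j < dim_col (1\<^sub>m (Suc n))"
    hence ij: "i < Suc n" "j < Suc n" by auto
    have "(mat_adjoint Z * Z) $$ (i,j) = (\<Sum>x<Suc n. cnj (Z $$ (x,i)) * Z $$ (x,j))"
      using Z ij by (subst mult_mat_index[of _ "Suc n" "Suc n" _ "Suc n"]) auto
    also have "\<dots> = cnj (Z $$ (0,i)) * Z $$ (0,j) + (\<Sum>x<n. cnj (Z $$ (Suc x,i)) * Z $$ (Suc x,j))"
      by (rule sum.lessThan_Suc_shift)
    also have "\<dots> = (1\<^sub>m (Suc n)) $$ (i,j)"
    proof (cases i; cases j)
      fix i' j' assume s: "i = Suc i'" "j = Suc j'"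
      hence "(\<Sum>x<n. cnj (Z $$ (Suc x,i)) * Z $$ (Suc x,j)) = (mat_adjoint V * V) $$ (i',j')"
        using ij VD(2) Zi by (subst mult_mat_index[of _ n n _ n]) auto
      thus ?thesis using s ij Zi VD(3) by simp
    qed (use ij Zi in auto)
    finally show "(mat_adjoint Z * Z) $$ (i,j) = (1\<^sub>m (Suc n)) $$ (i,j)" .
  qed (use Z in \<open>auto simp: mat_adjoint_def\<close>)
  have BZ: "B * Z = Z * real_diag (Suc n) mu"
  proof (rule eq_matI)
    fix i j assume "i < dim_row (Z * real_diag (Suc n) mu)" "j < dim_col (Z * real_diag (Suc n) mu)"
    hence ij: "i < Suc n" "j < Suc n" using Z by (auto simp: real_diag_def)
    have "(B * Z) $$ (i,j) = B $$ (i,0) * Z $$ (0,j) + (\<Sum>x<n. B $$ (i,Suc x) * Z $$ (Suc x,j))"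
      unfolding mult_mat_index[OF B Z ij] by (rule sum.lessThan_Suc_shift)
    also have "\<dots> = Z $$ (i,j) * mu j"
    proof (cases j)
      case 0
      thus ?thesis using ij Zi B0 er by (cases i) (auto simp: mu_def)
    next
      case j: (Suc j')
      show ?thesis
      proof (cases i)
        case 0
        have "B $$ (0, Suc x) = 0" if "x < n" for x
          using Bc[of 0 "Suc x"] B0[of "Suc x"] that by simp
        thus ?thesis using 0 j ij Zi by simp
      next
        case i: (Suc i')
        have "(\<Sum>x<n. B $$ (i,Suc x) * Z $$ (Suc x,j)) = (C * V) $$ (i',j')"
          using i j ij VD(2) Zi C by (subst mult_mat_index[of _ n n _ n]) (auto simp: C_def)
        also have "\<dots> = V $$ (i',j') * lam j'"
          using VD(5) real_diag_mult_right_index[OF VD(2)] i j ij by simp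
        finally show ?thesis using i j ij Zi B0 by (simp add: mu_def)
      qed
    qed
    also have "\<dots> = (Z * real_diag (Suc n) mu) $$ (i,j)"
      using real_diag_mult_right_index[OF Z ij] by simp
    finally show "(B * Z) $$ (i,j) = (Z * real_diag (Suc n) mu) $$ (i,j)" .
  qed (use B Z in \<open>auto simp: real_diag_def\<close>)
  have "spectral_decomp (Suc n) A (W * Z) mu"
    unfolding spectral_decomp_def
  proof (intro conjI)
    have "mat_adjoint (W * Z) * (W * Z) = mat_adjoint Z * ((mat_adjoint W * W) * Z)"
      using W Z W' Z' by (simp add: mat_adjoint_mult[OF W Z] ass)
    thus "mat_adjoint (W * Z) * (W * Z) = 1\<^sub>m (Suc n)"
      using WW ZZ Z by (simp add: left_mult_one_mat[of _ "Suc n" "Suc n"])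
    have "A * (W * Z) = (A * W) * Z" using A W Z by (simp add: ass)
    also have "\<dots> = W * (B * Z)" using AW W B Z by (simp add: ass)
    finally show "A * (W * Z) = W * Z * real_diag (Suc n) mu"
      using BZ W Z by (simp add: ass)
  qed (use A W Z in auto)
  thus ?case by blast
qed

section \<open>The spectral projector\<close>

definition neg_ind :: "(nat \<Rightarrow> real) \<Rightarrow> nat \<Rightarrow> real" where
  "neg_ind lam i = (if lam i < 0 then 1 else 0)"

text \<open>Each projector fixes the columns of the other, whence \<open>P * Q = Q\<close> and
  \<open>Q * P = P\<close>; the adjoint of the second identity gives \<open>P = P * Q\<close>. This
  makes the description in \<open>neg_proj\<close> determine a single matrix.\<close>

lemma orth_proj_unique:
  fixes P Q :: "complex mat"
  assumes P: "P \<in> carrier_mat n n" "P * P = P" "mat_adjoint P = P"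
    and Q: "Q \<in> carrier_mat n n" "Q * Q = Q" "mat_adjoint Q = Q"
    and eq: "{w \<in> carrier_vec n. P *\<^sub>v w = w} = {w \<in> carrier_vec n. Q *\<^sub>v w = w}"
  shows "P = Q"
proof -
  have *: "A * B = B" if "A \<in> carrier_mat n n" "B \<in> carrier_mat n n" "B * B = B"
    "{w \<in> carrier_vec n. A *\<^sub>v w = w} = {w \<in> carrier_vec n. B *\<^sub>v w = w}" for A B :: "complex mat"
  proof (rule mat_col_eqI)
    fix j assume j: "j < dim_col B"
    have "B *\<^sub>v col B j = col B j"
      using that j by (metis carrier_matD(2) col_mult2)
    moreover have "col B j \<in> carrier_vec n" using that(2) j by auto
    ultimately have "A *\<^sub>v col B j = col B j" using that(4) by blast
    thus "col (A * B) j = col B j" using that j by (metis carrier_matD(2) col_mult2)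
  qed (use that in auto)
  have PQ: "P * Q = Q" and QP: "Q * P = P" using * P Q eq by auto
  have "P = mat_adjoint (Q * P)" using P QP by simp
  also have "\<dots> = P * Q" using P Q by (simp add: mat_adjoint_mult[of _ n n _ n])
  finally show ?thesis using PQ by simp
qed

lemma spectral_decomp_eigenvector:
  assumes "spectral_decomp n A V lam" "i < n"
  shows "eigenvector A (col V i) (complex_of_real (lam i))"
proof -
  note D = spectral_decompD[OF assms(1)]
  have "A *\<^sub>v col V i = col (A * V) i" using D(1,2) assms(2) by (metis col_mult2)
  also have "\<dots> = complex_of_real (lam i) \<cdot>\<^sub>v col V i"
  proof (rule eq_vecI)
    fix a assume "a < dim_vec (complex_of_real (lam i) \<cdot>\<^sub>v col V i)"
    hence a: "a < n" using D(2) by simp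
    show "col (A * V) i $ a = (complex_of_real (lam i) \<cdot>\<^sub>v col V i) $ a"
      unfolding D(5) using a assms(2) D(2) real_diag_mult_right_index[OF D(2) a assms(2), of lam]
      by (simp add: real_diag_def)
  qed (use D in auto)
  finally have 1: "A *\<^sub>v col V i = complex_of_real (lam i) \<cdot>\<^sub>v col V i" .
  have "col V i \<noteq> 0\<^sub>v n"
  proof
    assume z: "col V i = 0\<^sub>v n"
    have z: "V $$ (a,i) = 0" if "a < n" for a
      using arg_cong[OF z, of "\<lambda>v. v $ a"] that assms(2) D(2) by simp
    have "(mat_adjoint V * V) $$ (i,i) = (\<Sum>x<n. mat_adjoint V $$ (i,x) * V $$ (x,i))"
      using D(2) assms(2) by (intro mult_mat_index) auto
    also have "\<dots> = 0" using z by simp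
    finally show False using D(3) assms(2) by simp
  qed
  thus ?thesis using 1 D(1,2) by (auto simp: eigenvector_def)
qed

text \<open>In the eigenbasis an eigenvector for \<open>e\<close> can only have coordinates at
  indices with \<open>lam i = e\<close>, so for negative \<open>e\<close> it is fixed by the
  right-hand side. Conversely a fixed vector is a combination of the columns with negative
  \<open>lam\<close>.\<close>

lemma neg_proj_spectral:
  assumes S: "spectral_decomp n A V lam"
  shows "neg_proj A = V * real_diag n (neg_ind lam) * mat_adjoint V"
proof -
  note D = spectral_decompD[OF S]
  note ass = assoc_mult_mat[of _ n n _ n _ n]
  note assv = assoc_mult_mat_vec[of _ n n _ n]
  define I where "I = real_diag n (neg_ind lam)"
  define P where "P = V * I * mat_adjoint V"
  have I: "I \<in> carrier_mat n n" by (simp add: I_def)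
  have V: "V \<in> carrier_mat n n" and V': "mat_adjoint V \<in> carrier_mat n n" and A: "A \<in> carrier_mat n n"
    using D by auto
  have P: "P \<in> carrier_mat n n" using V V' I by (simp add: P_def)
  have II: "I * I = I"
  proof (rule eq_matI)
    fix i j assume "i < dim_row I" "j < dim_col I"
    hence "i < n" "j < n" using I by auto
    thus "(I * I) $$ (i,j) = I $$ (i,j)"
      using real_diag_mult_left_index[OF I, of i j "neg_ind lam"] by (simp add: I_def neg_ind_def)
  qed (use I in auto)
  have "P * P = V * (I * ((mat_adjoint V * V) * (I * mat_adjoint V)))"
    using V V' I by (simp add: P_def ass)
  also have "\<dots> = V * ((I * I) * mat_adjoint V)"
    using V V' I D(3) by (simp add: ass left_mult_one_mat[of _ n n])
  also have "\<dots> = P" using II V V' I by (simp add: P_def ass)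
  finally have PP: "P * P = P" .
  have Ph: "mat_adjoint P = P"
    using V V' I by (simp add: P_def mat_adjoint_mult[of _ n n _ n] ass) (simp add: I_def)
  have dimA: "dim_row A = n" using A by simp
  define E where "E = {w. \<exists>e. eigenvector A w e \<and> e \<in> \<real> \<and> Re e < 0}"
  interpret vec_space "TYPE(complex)" n .
  have spanE: "neg_eig_span A = span E"
    unfolding neg_eig_span_def dimA E_def ..
  have E: "E \<subseteq> carrier_vec n" using A by (auto simp: E_def eigenvector_def)
  have VV': "V *\<^sub>v (mat_adjoint V *\<^sub>v w) = w" if "w \<in> carrier_vec n" for w
  proof -
    have "V *\<^sub>v (mat_adjoint V *\<^sub>v w) = (V * mat_adjoint V) *\<^sub>v w"
      using V V' that by (simp add: assv)
    thus ?thesis using D(4) that by simp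
  qed
  have Pw: "P *\<^sub>v w = V *\<^sub>v (I *\<^sub>v (mat_adjoint V *\<^sub>v w))" if "w \<in> carrier_vec n" for w
    using V V' I that mult_mat_vec_carrier[OF V' that] by (simp add: P_def assv)
  have Iw: "(I *\<^sub>v c) $ i = neg_ind lam i * c $ i" if "c \<in> carrier_vec n" "i < n" for c i
    unfolding mult_mat_vec_sum[OF I that] using that
    by (subst sum.remove[of _ i]) (auto simp: I_def)
  have Lw: "(real_diag n lam *\<^sub>v c) $ i = lam i * c $ i" if "c \<in> carrier_vec n" "i < n" for c i
    unfolding mult_mat_vec_sum[OF real_diag_carrier that] using that
    by (subst sum.remove[of _ i]) auto
  let ?F = "{w \<in> carrier_vec n. P *\<^sub>v w = w}"
  have "span E \<subseteq> ?F"
  proof (rule span_is_subset)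
    show "E \<subseteq> ?F"
    proof
      fix w assume "w \<in> E"
      then obtain e where e: "eigenvector A w e" "e \<in> \<real>" "Re e < 0" by (auto simp: E_def)
      have w: "w \<in> carrier_vec n" and ew: "A *\<^sub>v w = e \<cdot>\<^sub>v w" using e A by (auto simp: eigenvector_def)
      define c where "c = mat_adjoint V *\<^sub>v w"
      have c: "c \<in> carrier_vec n" using V' w by (simp add: c_def)
      have "real_diag n lam *\<^sub>v c = (real_diag n lam * mat_adjoint V) *\<^sub>v w"
        using V' w by (simp add: c_def assv)
      also have "\<dots> = mat_adjoint V *\<^sub>v (A *\<^sub>v w)"
        using D(7) V' A w by (simp add: assv flip: D(7))
      also have "\<dots> = e \<cdot>\<^sub>v c" using V' w by (simp add: ew c_def mult_mat_vec[of _ n n])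
      finally have ec: "real_diag n lam *\<^sub>v c = e \<cdot>\<^sub>v c" .
      have "I *\<^sub>v c = c"
      proof (rule eq_vecI)
        fix i assume "i < dim_vec c"
        hence i: "i < n" using c by simp
        have "lam i * c $ i = e * c $ i" using arg_cong[OF ec, of "\<lambda>v. v $ i"] Lw[OF c i] i c by simp
        hence "c $ i = 0 \<or> complex_of_real (lam i) = e" by simp
        hence "c $ i = 0 \<or> lam i < 0" using e by auto
        thus "(I *\<^sub>v c) $ i = c $ i" using Iw[OF c i] by (auto simp: neg_ind_def)
      qed (use I c in auto)
      hence "P *\<^sub>v w = w" using Pw[OF w] VV'[OF w] by (simp add: c_def)
      thus "w \<in> ?F" using w by simp
    qed
    show "submodule class_ring ?F (module_vec TYPE(complex) n)"
    proof (unfold_locales)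
      fix v w assume "v \<in> ?F" "w \<in> ?F"
      thus "v \<oplus>\<^bsub>module_vec TYPE(complex) n\<^esub> w \<in> ?F"
        using P by (auto simp: mult_add_distrib_mat_vec[of _ n n])
    next
      fix c :: complex and v assume "c \<in> carrier class_ring" "v \<in> ?F"
      thus "c \<odot>\<^bsub>module_vec TYPE(complex) n\<^esub> v \<in> ?F"
        using P by (auto simp: mult_mat_vec[of _ n n])
    qed (use P in auto)
  qed
  moreover have "?F \<subseteq> span E"
  proof
    fix w assume "w \<in> ?F"
    hence w: "w \<in> carrier_vec n" and fw: "P *\<^sub>v w = w" by auto
    define c where "c = mat_adjoint V *\<^sub>v w"
    have c: "c \<in> carrier_vec n" using V' w by (simp add: c_def)
    interpret sm: submodule class_ring "span E" "module_vec TYPE(complex) n"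
      using span_is_submodule[of E] E by simp
    \<comment> \<open>Membership is shown for partial sums; a term with nonnegative
      \<open>lam k\<close> has coefficient zero, so no eigenvector outside \<open>E\<close>
      enters.\<close>
    have "vec n (\<lambda>a. \<Sum>i<k. neg_ind lam i * c $ i * V $$ (a,i)) \<in> span E" if "k \<le> n" for k
      using that
    proof (induction k)
      case 0
      have "vec n (\<lambda>a. \<Sum>i<0. neg_ind lam i * c $ i * V $$ (a,i)) = 0\<^sub>v n" by (auto simp: zero_vec_def)
      thus ?case using sm.zero_closed by (simp add: module_vec_simps)
    next
      case (Suc k)
      let ?t = "(neg_ind lam k * c $ k) \<cdot>\<^sub>v col V k"
      have k: "k < n" using Suc.prems by simp
      have t: "?t \<in> span E"
      proof (cases "lam k < 0")
        case True
        have "col V k \<in> E" using spectral_decomp_eigenvector[OF S k] True by (auto simp: E_def)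
        hence "col V k \<in> span E" using in_own_span[of E] E by auto
        thus ?thesis using sm.smult_closed[of "neg_ind lam k * c $ k" "col V k"]
          by (simp add: module_vec_simps class_ring_simps)
      next
        case False
        have "?t = 0\<^sub>v n" using False V k by (auto simp: neg_ind_def)
        thus ?thesis using sm.zero_closed by (simp add: module_vec_simps)
      qed
      have "vec n (\<lambda>a. \<Sum>i<Suc k. neg_ind lam i * c $ i * V $$ (a,i))
        = vec n (\<lambda>a. \<Sum>i<k. neg_ind lam i * c $ i * V $$ (a,i)) + ?t"
        using V k by (intro eq_vecI) auto
      thus ?case using sm.m_closed[OF Suc.IH t] Suc.prems by (simp add: module_vec_simps)
    qed
    from this[OF order_refl]
    have "vec n (\<lambda>a. \<Sum>i<n. neg_ind lam i * c $ i * V $$ (a,i)) \<in> span E" .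
    also have "vec n (\<lambda>a. \<Sum>i<n. neg_ind lam i * c $ i * V $$ (a,i)) = V *\<^sub>v (I *\<^sub>v c)"
    proof (rule eq_vecI)
      fix a assume "a < dim_vec (V *\<^sub>v (I *\<^sub>v c))"
      hence a: "a < n" using V by simp
      have Ic: "I *\<^sub>v c \<in> carrier_vec n" using I c by simp
      show "vec n (\<lambda>a. \<Sum>i<n. neg_ind lam i * c $ i * V $$ (a,i)) $ a = (V *\<^sub>v (I *\<^sub>v c)) $ a"
        unfolding mult_mat_vec_sum[OF V Ic a] using a by (auto simp: Iw[OF c] mult_ac intro!: sum.cong)
    qed (use V in auto)
    also have "\<dots> = w" using Pw[OF w] fw by (simp add: c_def)
    finally show "w \<in> span E" .
  qed
  ultimately have F: "?F = neg_eig_span A" unfolding spanE by blast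
  have "neg_proj A = P"
    unfolding neg_proj_def dimA
  proof (rule the_equality)
    show "P \<in> carrier_mat n n \<and> P * P = P \<and> mat_adjoint P = P \<and> ?F = neg_eig_span A"
      using P PP Ph F by blast
    fix Q assume "Q \<in> carrier_mat n n \<and> Q * Q = Q \<and> mat_adjoint Q = Q \<and>
        {w \<in> carrier_vec n. Q *\<^sub>v w = w} = neg_eig_span A"
    thus "Q = P" using orth_proj_unique[of Q n P] P PP Ph F by simp
  qed
  thus ?thesis by (simp add: P_def I_def)
qed

section \<open>Perturbation of the spectral projector\<close>

text \<open>A crude norm, not unitarily invariant, but it bounds every single entry of a matrix
  after multiplication by unitaries on both sides. Powers of \<open>n\<close> in later constants
  come from this choice.\<close>

definition entry_norm :: "nat \<Rightarrow> complex mat \<Rightarrow> real" where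
  "entry_norm n X = (\<Sum>a<n. \<Sum>b<n. cmod (X $$ (a,b)))"

lemma entry_norm_nonneg [simp]: "entry_norm n X \<ge> 0"
  by (simp add: entry_norm_def sum_nonneg)

lemma unitary_row_orthonormal:
  assumes "V \<in> carrier_mat n n" "V * mat_adjoint V = 1\<^sub>m n" "a < n" "b < n"
  shows "(\<Sum>i<n. V $$ (a,i) * cnj (V $$ (b,i))) = (if a = b then 1 else 0)"
proof -
  have "(V * mat_adjoint V) $$ (a,b) = (\<Sum>i<n. V $$ (a,i) * mat_adjoint V $$ (i,b))"
    using assms by (intro mult_mat_index) auto
  also have "\<dots> = (\<Sum>i<n. V $$ (a,i) * cnj (V $$ (b,i)))"
    using assms by (intro sum.cong) auto
  finally show ?thesis using assms by simp
qed

lemma unitary_entry_le_1: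
  assumes "V \<in> carrier_mat n n" "V * mat_adjoint V = 1\<^sub>m n" "a < n" "i < n"
  shows "cmod (V $$ (a,i)) \<le> 1"
proof -
  have "complex_of_real (\<Sum>i<n. (cmod (V $$ (a,i)))\<^sup>2) = (\<Sum>i<n. V $$ (a,i) * cnj (V $$ (a,i)))"
    by (simp flip: complex_norm_square)
  also have "\<dots> = complex_of_real 1" using unitary_row_orthonormal[OF assms(1,2,3,3)] by simp
  finally have "(\<Sum>i<n. (cmod (V $$ (a,i)))\<^sup>2) = 1" unfolding of_real_eq_iff .
  moreover have "(cmod (V $$ (a,i)))\<^sup>2 \<le> (\<Sum>i<n. (cmod (V $$ (a,i)))\<^sup>2)"
    using assms by (intro member_le_sum) auto
  ultimately have "(cmod (V $$ (a,i)))\<^sup>2 \<le> 1\<^sup>2" by simp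
  thus ?thesis by (rule power2_le_imp_le) simp
qed

lemma triple_mult_index:
  assumes X: "X \<in> carrier_mat n n" and Y: "Y \<in> carrier_mat n n" and Z: "Z \<in> carrier_mat n n"
    and ij: "i < n" "j < n"
  shows "(X * Y * Z) $$ (i,j) = (\<Sum>a<n. \<Sum>b<n. X $$ (i,a) * Y $$ (a,b) * Z $$ (b,j))"
proof -
  have "(X * Y * Z) $$ (i,j) = (\<Sum>b<n. (X * Y) $$ (i,b) * Z $$ (b,j))"
    using assms by (intro mult_mat_index) auto
  also have "\<dots> = (\<Sum>b<n. \<Sum>a<n. X $$ (i,a) * Y $$ (a,b) * Z $$ (b,j))"
    using assms by (intro sum.cong refl) (auto simp: mult_mat_index[OF X Y] sum_distrib_right simp del: index_mult_mat)
  also have "\<dots> = (\<Sum>a<n. \<Sum>b<n. X $$ (i,a) * Y $$ (a,b) * Z $$ (b,j))"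
    by (rule sum.swap)
  finally show ?thesis .
qed

lemma triple_mult_bound:
  assumes "X \<in> carrier_mat n n" "Y \<in> carrier_mat n n" "Z \<in> carrier_mat n n" "i < n" "j < n"
    and "\<And>a. a < n \<Longrightarrow> cmod (X $$ (i,a)) \<le> 1" "\<And>b. b < n \<Longrightarrow> cmod (Z $$ (b,j)) \<le> 1"
  shows "cmod ((X * Y * Z) $$ (i,j)) \<le> entry_norm n Y"
  unfolding triple_mult_index[OF assms(1-5)] entry_norm_def
proof (intro sum_norm_le)
  fix a b assume "a \<in> {..<n}" "b \<in> {..<n}"
  hence "cmod (X $$ (i,a)) * cmod (Y $$ (a,b)) * cmod (Z $$ (b,j)) \<le> 1 * cmod (Y $$ (a,b)) * 1"
    using assms by (intro mult_mono) auto
  thus "norm (X $$ (i,a) * Y $$ (a,b) * Z $$ (b,j)) \<le> cmod (Y $$ (a,b))"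
    by (simp add: norm_mult)
qed

lemma conj_unitary_bound:
  assumes V: "V \<in> carrier_mat n n" "V * mat_adjoint V = 1\<^sub>m n"
    and W: "W \<in> carrier_mat n n" "W * mat_adjoint W = 1\<^sub>m n"
    and X: "X \<in> carrier_mat n n" and ij: "i < n" "j < n"
  shows "cmod ((mat_adjoint V * X * W) $$ (i,j)) \<le> entry_norm n X"
    "cmod ((V * X * mat_adjoint W) $$ (i,j)) \<le> entry_norm n X"
  using assms unitary_entry_le_1[OF V] unitary_entry_le_1[OF W]
  by (intro triple_mult_bound; simp)+

text \<open>The overlap matrix of the two eigenbases solves a Sylvester equation; comparing entries is the
  Davis--Kahan argument.\<close>

lemma overlap_sylvester:
  assumes A: "spectral_decomp n A V lam" and B: "spectral_decomp n B W mu"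
    and ij: "i < n" "j < n"
  shows "(lam i - mu j) * (mat_adjoint V * W) $$ (i,j) = (mat_adjoint V * (A - B) * W) $$ (i,j)"
proof -
  note DA = spectral_decompD[OF A] and DB = spectral_decompD[OF B]
  note ass = assoc_mult_mat[of _ n n _ n _ n]
  have c: "A \<in> carrier_mat n n" "B \<in> carrier_mat n n" "V \<in> carrier_mat n n" "W \<in> carrier_mat n n"
    "mat_adjoint V \<in> carrier_mat n n" using DA(1,2) DB(1,2) by auto
  have K: "mat_adjoint V * W \<in> carrier_mat n n" using c by simp
  have "mat_adjoint V * (A - B) * W = (mat_adjoint V * A) * W - mat_adjoint V * (B * W)"
    using c by (simp add: mult_minus_distrib_mat[of _ n n] minus_mult_distrib_mat[of _ n n] ass)
  also have "\<dots> = real_diag n lam * (mat_adjoint V * W) - (mat_adjoint V * W) * real_diag n mu"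
    using c DA(7) DB(5) by (simp add: ass)
  finally have "(mat_adjoint V * (A - B) * W) $$ (i,j)
    = (real_diag n lam * (mat_adjoint V * W) - (mat_adjoint V * W) * real_diag n mu) $$ (i,j)" by simp
  also have "\<dots> = (real_diag n lam * (mat_adjoint V * W)) $$ (i,j) - ((mat_adjoint V * W) * real_diag n mu) $$ (i,j)"
    using ij c K by (intro index_minus_mat) (auto simp: real_diag_def)
  also have "\<dots> = (lam i - mu j) * (mat_adjoint V * W) $$ (i,j)"
    unfolding real_diag_mult_left_index[OF K ij] real_diag_mult_right_index[OF K ij]
    by (simp add: algebra_simps)
  finally show ?thesis by simp
qed

lemma overlap_unitary:
  fixes V W :: "complex mat"
  assumes "V \<in> carrier_mat n n" "V * mat_adjoint V = 1\<^sub>m n" "mat_adjoint V * V = 1\<^sub>m n"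
    and "W \<in> carrier_mat n n" "W * mat_adjoint W = 1\<^sub>m n" "mat_adjoint W * W = 1\<^sub>m n"
  defines "K \<equiv> mat_adjoint V * W"
  shows "K \<in> carrier_mat n n" "K * mat_adjoint K = 1\<^sub>m n" "mat_adjoint K * K = 1\<^sub>m n"
proof -
  note ass = assoc_mult_mat[of _ n n _ n _ n]
  show K: "K \<in> carrier_mat n n" using assms by (simp add: K_def)
  have "K * mat_adjoint K = mat_adjoint V * ((W * mat_adjoint W) * V)"
    unfolding K_def using assms(1,4) by (simp add: mat_adjoint_mult[of _ n n _ n] ass)
  also have "\<dots> = 1\<^sub>m n" unfolding assms(5) left_mult_one_mat[OF assms(1)] by (rule assms(3))
  finally show "K * mat_adjoint K = 1\<^sub>m n" .
  thus "mat_adjoint K * K = 1\<^sub>m n" by (rule mat_mult_left_right_inverse[OF K mat_adjoint_carrier[OF K]])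
qed

text \<open>Column \<open>j\<close> of the unitary overlap matrix is a unit vector, so one of its
  \<open>n\<close> entries has modulus at least 1/n; at that entry the Sylvester identity bounds the
  difference of the eigenvalues.\<close>

lemma eigenvalue_perturbation:
  assumes A: "spectral_decomp n A V lam" and B: "spectral_decomp n B W mu" and j: "j < n"
  shows "\<exists>i<n. \<bar>lam i - mu j\<bar> \<le> n * entry_norm n (A - B)"
proof -
  note DA = spectral_decompD[OF A] and DB = spectral_decompD[OF B]
  define K where "K = mat_adjoint V * W"
  have K: "K \<in> carrier_mat n n" "mat_adjoint K * K = 1\<^sub>m n"
    using overlap_unitary[OF DA(2,4,3) DB(2,4,3)] by (auto simp: K_def)
  have K': "mat_adjoint K \<in> carrier_mat n n" using K by simp
  have "(mat_adjoint K * K) $$ (j,j) = (\<Sum>i<n. cnj (K $$ (i,j)) * K $$ (i,j))"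
    unfolding mult_mat_index[OF K' K(1) j j] using K j by (intro sum.cong) auto
  also have "\<dots> = complex_of_real (\<Sum>i<n. (cmod (K $$ (i,j)))\<^sup>2)"
    by (simp add: mult.commute flip: complex_norm_square)
  finally have "complex_of_real (\<Sum>i<n. (cmod (K $$ (i,j)))\<^sup>2) = complex_of_real 1"
    using K j by simp
  hence s: "(\<Sum>i<n. (cmod (K $$ (i,j)))\<^sup>2) = 1" unfolding of_real_eq_iff .
  have "\<exists>i<n. cmod (K $$ (i,j)) \<ge> 1 / n"
  proof (rule ccontr)
    assume "\<not> ?thesis"
    hence *: "cmod (K $$ (i,j)) < 1 / n" if "i < n" for i using that by force
    have "(\<Sum>i<n. (cmod (K $$ (i,j)))\<^sup>2) < (\<Sum>i<n. 1 / n)"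
    proof (rule sum_strict_mono)
      fix i assume i: "i \<in> {..<n}"
      have "(cmod (K $$ (i,j)))\<^sup>2 < (1 / n)\<^sup>2" using *[of i] i by (intro power_strict_mono) auto
      also have "(1 / real n)\<^sup>2 \<le> 1 / n" using j by (simp add: power2_eq_square field_simps)
      finally show "(cmod (K $$ (i,j)))\<^sup>2 < 1 / n" .
    qed (use j in auto)
    thus False using s j by simp
  qed
  then obtain i where i: "i < n" "cmod (K $$ (i,j)) \<ge> 1 / n" by blast
  have "\<bar>lam i - mu j\<bar> * (1 / n) \<le> \<bar>lam i - mu j\<bar> * cmod (K $$ (i,j))"
    using i by (intro mult_left_mono) auto
  also have "\<dots> = cmod ((lam i - mu j) * K $$ (i,j))" by (simp only: norm_mult norm_of_real)
  also have "\<dots> = cmod ((mat_adjoint V * (A - B) * W) $$ (i,j))"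
    unfolding K_def using overlap_sylvester[OF A B i(1) j] by simp
  also have "\<dots> \<le> entry_norm n (A - B)"
    by (rule conj_unitary_bound[OF DA(2,4) DB(2,4) minus_carrier_mat[OF DB(1)] i(1) j])
  finally show ?thesis using i j by (auto simp: field_simps)
qed

text \<open>Since \<open>lam i\<close> and \<open>mu k\<close> lie on different sides of zero (zero
  counting as positive), their distance is at least the modulus of \<open>lam i\<close>; the gap of
  \<open>A\<close> alone controls the overlap.\<close>

lemma overlap_opposite_sign:
  assumes A: "spectral_decomp n A V lam" and B: "spectral_decomp n B W mu"
    and gap: "\<bar>lam i\<bar> \<ge> g" "g > 0" and ik: "i < n" "k < n" and ne: "neg_ind lam i \<noteq> neg_ind mu k"
  shows "cmod ((mat_adjoint V * W) $$ (i,k)) \<le> entry_norm n (A - B) / g"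
proof -
  note DA = spectral_decompD[OF A] and DB = spectral_decompD[OF B]
  have "g \<le> \<bar>lam i - mu k\<bar>" using gap ne by (auto simp: neg_ind_def split: if_splits)
  hence "g * cmod ((mat_adjoint V * W) $$ (i,k)) \<le> \<bar>lam i - mu k\<bar> * cmod ((mat_adjoint V * W) $$ (i,k))"
    by (intro mult_right_mono) auto
  also have "\<dots> = cmod ((lam i - mu k) * (mat_adjoint V * W) $$ (i,k))" by (simp only: norm_mult norm_of_real)
  also have "\<dots> = cmod ((mat_adjoint V * (A - B) * W) $$ (i,k))"
    using overlap_sylvester[OF A B ik] by simp
  also have "\<dots> \<le> entry_norm n (A - B)"
    by (rule conj_unitary_bound[OF DA(2,4) DB(2,4) minus_carrier_mat[OF DB(1)] ik])
  finally show ?thesis using gap by (simp add: field_simps)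
qed

lemma neg_proj_carrier:
  assumes "spectral_decomp n A V lam"
  shows "neg_proj A \<in> carrier_mat n n"
  unfolding neg_proj_spectral[OF assms] using spectral_decompD[OF assms] by simp

lemma neg_proj_commute:
  assumes S: "spectral_decomp n A V lam"
  shows "A * neg_proj A = neg_proj A * A"
proof -
  note D = spectral_decompD[OF S]
  note ass = assoc_mult_mat[of _ n n _ n _ n]
  have V': "mat_adjoint V \<in> carrier_mat n n" using D by simp
  have c: "real_diag n lam * real_diag n (neg_ind lam) = real_diag n (neg_ind lam) * real_diag n lam"
  proof (rule eq_matI)
    fix i j assume "i < dim_row (real_diag n (neg_ind lam) * real_diag n lam)"
      "j < dim_col (real_diag n (neg_ind lam) * real_diag n lam)"
    hence "i < n" "j < n" by (auto simp: real_diag_def)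
    thus "(real_diag n lam * real_diag n (neg_ind lam)) $$ (i,j)
        = (real_diag n (neg_ind lam) * real_diag n lam) $$ (i,j)"
      by (simp add: real_diag_mult_left_index[of _ n n] del: index_mult_mat)
  qed (auto simp: real_diag_def)
  have "A * neg_proj A = (A * V) * (real_diag n (neg_ind lam) * mat_adjoint V)"
    unfolding neg_proj_spectral[OF S] using D(1,2) V' by (simp add: ass)
  also have "\<dots> = V * ((real_diag n lam * real_diag n (neg_ind lam)) * mat_adjoint V)"
    unfolding D(5) using D(1,2) V' by (simp add: ass)
  also have "\<dots> = V * (real_diag n (neg_ind lam) * (mat_adjoint V * A))"
    unfolding c D(7) using D(1,2) V' by (simp add: ass)
  also have "\<dots> = neg_proj A * A"
    unfolding neg_proj_spectral[OF S] using D(1,2) V' by (simp add: ass)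
  finally show ?thesis .
qed

lemma neg_proj_in_eigenbasis:
  assumes A: "spectral_decomp n A V lam" and B: "spectral_decomp n B W mu" and ij: "i < n" "j < n"
  defines "K \<equiv> mat_adjoint V * W"
  shows "(mat_adjoint V * neg_proj B * V) $$ (i,j) = (\<Sum>k<n. neg_ind mu k * K $$ (i,k) * cnj (K $$ (j,k)))"
proof -
  note DA = spectral_decompD[OF A] and DB = spectral_decompD[OF B]
  note ass = assoc_mult_mat[of _ n n _ n _ n]
  have c: "V \<in> carrier_mat n n" "W \<in> carrier_mat n n" "mat_adjoint V \<in> carrier_mat n n"
    "mat_adjoint W \<in> carrier_mat n n" using DA(1,2) DB(1,2) by auto
  have K: "K \<in> carrier_mat n n" "mat_adjoint K \<in> carrier_mat n n" using c by (auto simp: K_def)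
  have "mat_adjoint V * neg_proj B * V = K * real_diag n (neg_ind mu) * mat_adjoint K"
    unfolding neg_proj_spectral[OF B] K_def using c by (simp add: ass mat_adjoint_mult[of _ n n _ n])
  hence "(mat_adjoint V * neg_proj B * V) $$ (i,j)
    = (\<Sum>k<n. (K * real_diag n (neg_ind mu)) $$ (i,k) * mat_adjoint K $$ (k,j))"
    using K ij by (simp add: mult_mat_index[of _ n n _ n] del: index_mult_mat)
  also have "\<dots> = (\<Sum>k<n. neg_ind mu k * K $$ (i,k) * cnj (K $$ (j,k)))"
    using K ij by (intro sum.cong) (auto simp: real_diag_mult_right_index[OF K(1)] simp del: index_mult_mat)
  finally show ?thesis .
qed

text \<open>By orthonormality of the rows of the overlap matrix, \<open>q\<close> is a sum over
  those \<open>k\<close> only whose sign class differs from that of \<open>i\<close>. Each such term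
  has one small factor, and two if \<open>j\<close> is in the class of \<open>i\<close>. The
  quadratic bound is what makes the derivative vanish within a class.\<close>

lemma neg_proj_perturbation:
  assumes A: "spectral_decomp n A V lam" and B: "spectral_decomp n B W mu"
    and gap: "\<And>i. i < n \<Longrightarrow> \<bar>lam i\<bar> \<ge> g" "g > 0" and ij: "i < n" "j < n"
  defines "q \<equiv> (mat_adjoint V * neg_proj B * V) $$ (i,j) - (if i = j then neg_ind lam i else 0)"
  shows "cmod q \<le> n * (entry_norm n (A - B) / g)"
    "neg_ind lam i = neg_ind lam j \<Longrightarrow> cmod q \<le> n * (entry_norm n (A - B) / g)\<^sup>2"
proof -
  note DA = spectral_decompD[OF A] and DB = spectral_decompD[OF B]
  define K where "K = mat_adjoint V * W"
  define e where "e = entry_norm n (A - B) / g"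
  have e: "e \<ge> 0" using gap by (simp add: e_def)
  have K: "K \<in> carrier_mat n n" "K * mat_adjoint K = 1\<^sub>m n"
    using overlap_unitary[OF DA(2,4,3) DB(2,4,3)] by (auto simp: K_def)
  have "q = (\<Sum>k<n. neg_ind mu k * K $$ (i,k) * cnj (K $$ (j,k)))
      - neg_ind lam i * (\<Sum>k<n. K $$ (i,k) * cnj (K $$ (j,k)))"
    unfolding q_def K_def neg_proj_in_eigenbasis[OF A B ij]
    using unitary_row_orthonormal[OF K ij] by (simp add: K_def)
  also have "\<dots> = (\<Sum>k<n. (neg_ind mu k - neg_ind lam i) * (K $$ (i,k) * cnj (K $$ (j,k))))"
    by (simp add: sum_distrib_left sum_subtractf algebra_simps)
  finally have q: "q = (\<Sum>k<n. (neg_ind mu k - neg_ind lam i) * (K $$ (i,k) * cnj (K $$ (j,k))))" .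
  have small: "cmod (K $$ (l,k)) \<le> e" if "l < n" "k < n" "neg_ind lam l \<noteq> neg_ind mu k" for l k
    unfolding K_def e_def using gap that by (intro overlap_opposite_sign[OF A B]) auto
  have bound: "cmod q \<le> n * x" if x: "x \<ge> 0"
    "\<And>k. k < n \<Longrightarrow> neg_ind lam i \<noteq> neg_ind mu k \<Longrightarrow> cmod (K $$ (i,k)) * cmod (K $$ (j,k)) \<le> x" for x :: real
  proof -
    have "cmod q \<le> (\<Sum>k<n. x)"
      unfolding q
    proof (rule sum_norm_le)
      fix k assume k: "k \<in> {..<n}"
      show "cmod ((neg_ind mu k - neg_ind lam i) * (K $$ (i,k) * cnj (K $$ (j,k)))) \<le> x"
      proof (cases "neg_ind lam i = neg_ind mu k")
        case False
        hence "\<bar>neg_ind mu k - neg_ind lam i\<bar> = 1" by (auto simp: neg_ind_def split: if_splits)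
        hence "cmod (complex_of_real (neg_ind mu k) - complex_of_real (neg_ind lam i)) = 1"
          by (metis norm_of_real of_real_diff)
        thus ?thesis using x(2)[of k] False k by (simp add: norm_mult)
      qed (use x in simp)
    qed
    thus ?thesis by simp
  qed
  show "cmod q \<le> n * (entry_norm n (A - B) / g)"
    unfolding e_def[symmetric]
  proof (rule bound[OF e])
    fix k assume k: "k < n" "neg_ind lam i \<noteq> neg_ind mu k"
    have "cmod (K $$ (i,k)) * cmod (K $$ (j,k)) \<le> e * 1"
      using small[OF ij(1) k] unitary_entry_le_1[OF K ij(2) k(1)] e by (intro mult_mono) auto
    thus "cmod (K $$ (i,k)) * cmod (K $$ (j,k)) \<le> e" by simp
  qed
  assume same: "neg_ind lam i = neg_ind lam j"
  show "cmod q \<le> n * (entry_norm n (A - B) / g)\<^sup>2"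
    unfolding e_def[symmetric]
  proof (rule bound)
    fix k assume k: "k < n" "neg_ind lam i \<noteq> neg_ind mu k"
    show "cmod (K $$ (i,k)) * cmod (K $$ (j,k)) \<le> e\<^sup>2"
      unfolding power2_eq_square
      using small[OF ij(1) k] small[OF ij(2) k(1)] k(2) same e by (intro mult_mono) auto
  qed simp
qed

lemma conj_back:
  fixes V :: "complex mat"
  assumes V: "V \<in> carrier_mat n n" "V * mat_adjoint V = 1\<^sub>m n" and X: "X \<in> carrier_mat n n"
  shows "V * (mat_adjoint V * X * V) * mat_adjoint V = X"
proof -
  note ass = assoc_mult_mat[of _ n n _ n _ n]
  have V': "mat_adjoint V \<in> carrier_mat n n" using V by simp
  have "V * (mat_adjoint V * X * V) * mat_adjoint V = (V * mat_adjoint V) * X * (V * mat_adjoint V)"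
    using V(1) V' X by (simp add: ass)
  thus ?thesis using V X by simp
qed

text \<open>The cube is one \<open>n\<close> from the sum over overlaps times the \<open>n^2\<close>
  entries of \<open>Q\<close> collected when returning from the eigenbasis.\<close>

lemma neg_proj_lipschitz:
  assumes A: "spectral_decomp n A V lam" and B: "spectral_decomp n B W mu"
    and gap: "\<And>i. i < n \<Longrightarrow> \<bar>lam i\<bar> \<ge> g" "g > 0" and ab: "a < n" "b < n"
  shows "cmod (neg_proj B $$ (a,b) - neg_proj A $$ (a,b)) \<le> real n ^ 3 * (entry_norm n (A - B) / g)"
proof -
  note DA = spectral_decompD[OF A] and DB = spectral_decompD[OF B]
  have c: "V \<in> carrier_mat n n" "mat_adjoint V \<in> carrier_mat n n" "neg_proj B \<in> carrier_mat n n"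
    using DA(2) neg_proj_carrier[OF B] by auto
  define Q where "Q = mat_adjoint V * neg_proj B * V - real_diag n (neg_ind lam)"
  have Q: "Q \<in> carrier_mat n n" by (simp add: Q_def minus_carrier_mat)
  have "neg_proj B - neg_proj A = V * Q * mat_adjoint V"
    unfolding Q_def neg_proj_spectral[OF A] using c conj_back[OF c(1) DA(4) c(3)]
    by (simp add: mult_minus_distrib_mat[of _ n n _ n] minus_mult_distrib_mat[of _ n n _ _ n])
  hence "neg_proj B $$ (a,b) - neg_proj A $$ (a,b) = (V * Q * mat_adjoint V) $$ (a,b)"
    using ab c(3) neg_proj_carrier[OF A] by (metis carrier_matD index_minus_mat(1))
  also have "cmod \<dots> \<le> entry_norm n Q"
    by (rule conj_unitary_bound(2)[OF DA(2,4) DA(2,4) Q ab])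
  also have "\<dots> \<le> (\<Sum>i<n. \<Sum>j<n. n * (entry_norm n (A - B) / g))"
    unfolding entry_norm_def[of n Q]
  proof (intro sum_mono)
    fix i j assume ij: "i \<in> {..<n}" "j \<in> {..<n}"
    hence "Q $$ (i,j) = (mat_adjoint V * neg_proj B * V) $$ (i,j) - (if i = j then neg_ind lam i else 0)"
      using c by (simp add: Q_def real_diag_def)
    thus "cmod (Q $$ (i,j)) \<le> n * (entry_norm n (A - B) / g)"
      using neg_proj_perturbation(1)[OF A B gap, of i j] ij by simp
  qed
  finally show ?thesis by (simp add: power3_eq_cube mult_ac)
qed

section \<open>Differentiability of the spectral projector along a line of matrices\<close>

lemma has_vector_derivative_difference_quotient:
  fixes f e :: "real \<Rightarrow> 'a::real_normed_vector"
  assumes eq: "\<And>t. f t = f 0 + t *\<^sub>R e t" and lim: "(e \<longlongrightarrow> d) (at 0)"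
  shows "(f has_vector_derivative d) (at 0)"
  unfolding has_vector_derivative_def has_derivative_at
proof
  show "bounded_linear (\<lambda>x. x *\<^sub>R d)" by (rule bounded_linear_scaleR_left)
  have "((\<lambda>h. norm (e h - d)) \<longlongrightarrow> 0) (at 0)" using lim by (simp add: LIM_zero_iff tendsto_norm_zero)
  thus "((\<lambda>h. norm (f (0 + h) - f 0 - h *\<^sub>R d) / norm h) \<longlongrightarrow> 0) (at 0)"
  proof (rule Lim_transform_eventually)
    show "\<forall>\<^sub>F h in at 0. norm (e h - d) = norm (f (0 + h) - f 0 - h *\<^sub>R d) / norm h"
      unfolding eventually_at_filter
    proof (rule always_eventually, intro allI impI)
      fix h :: real assume "h \<noteq> 0"
      have "f (0 + h) - f 0 - h *\<^sub>R d = h *\<^sub>R (e h - d)"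
        using eq[of h] by (simp add: algebra_simps)
      thus "norm (e h - d) = norm (f (0 + h) - f 0 - h *\<^sub>R d) / norm h" using \<open>h \<noteq> 0\<close> by simp
    qed
  qed
qed

lemma finite_gap:
  fixes n :: nat
  assumes "\<And>i. i < n \<Longrightarrow> lam i \<noteq> (0::real)"
  shows "\<exists>g>0. \<forall>i<n. g \<le> \<bar>lam i\<bar>"
proof (cases "n = 0")
  case False
  define g where "g = Min ((\<lambda>i. \<bar>lam i\<bar>) ` {..<n})"
  have "g \<in> (\<lambda>i. \<bar>lam i\<bar>) ` {..<n}" unfolding g_def using False by (intro Min_in) auto
  hence "g > 0" using assms by auto
  moreover have "g \<le> \<bar>lam i\<bar>" if "i < n" for i unfolding g_def using that by (intro Min_le) auto
  ultimately show ?thesis by blast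
qed (auto intro: exI[of _ 1])

lemma hermitian_add_smult:
  assumes "A \<in> carrier_mat n n" "mat_adjoint A = A" "B \<in> carrier_mat n n" "mat_adjoint B = B"
  shows "mat_adjoint (A + complex_of_real t \<cdot>\<^sub>m B) = A + complex_of_real t \<cdot>\<^sub>m B"
proof (rule eq_matI)
  have C: "A + complex_of_real t \<cdot>\<^sub>m B \<in> carrier_mat n n" using assms by simp
  fix i j assume "i < dim_row (A + complex_of_real t \<cdot>\<^sub>m B)" "j < dim_col (A + complex_of_real t \<cdot>\<^sub>m B)"
  hence ij: "i < n" "j < n" using C by auto
  have "cnj (A $$ (j,i)) = A $$ (i,j)" "cnj (B $$ (j,i)) = B $$ (i,j)"
    using mat_adjoint_index[OF assms(1) ij] mat_adjoint_index[OF assms(3) ij] assms by auto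
  thus "mat_adjoint (A + complex_of_real t \<cdot>\<^sub>m B) $$ (i,j) = (A + complex_of_real t \<cdot>\<^sub>m B) $$ (i,j)"
    using mat_adjoint_index[OF C ij] ij assms(1,3) by simp
qed (use assms in auto)

text \<open>The Daletskii-Krein formula for the function that is 1 below zero and 0 elsewhere: in
  the eigenbasis the derivative multiplies the direction \<open>B\<close> entrywise by divided
  differences. On equal eigenvalues the quotient 0/0 is 0, the right value because the function is
  locally constant off zero.\<close>

definition proj_deriv :: "nat \<Rightarrow> complex mat \<Rightarrow> (nat \<Rightarrow> real) \<Rightarrow> complex mat \<Rightarrow> complex mat" where
  "proj_deriv n V lam B = mat n n (\<lambda>(i,j). (mat_adjoint V * B * V) $$ (i,j)
     * complex_of_real ((neg_ind lam j - neg_ind lam i) / (lam j - lam i)))"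

lemma proj_deriv_carrier [simp]: "proj_deriv n V lam B \<in> carrier_mat n n"
  by (simp add: proj_deriv_def)

text \<open>The perturbed projector is written as \<open>Y t\<close> in the fixed eigenbasis of
  \<open>A\<close>. Between opposite signs, commutation with the perturbed matrix gives the
  difference quotient exactly; within one sign class the quadratic perturbation bound forces
  derivative zero.\<close>

theorem neg_proj_has_derivative:
  assumes A: "spectral_decomp n A V lam" and nz: "\<And>i. i < n \<Longrightarrow> lam i \<noteq> 0"
    and B: "B \<in> carrier_mat n n" "mat_adjoint B = B" and ab: "a < n" "b < n"
  shows "((\<lambda>t. neg_proj (A + complex_of_real t \<cdot>\<^sub>m B) $$ (a,b)) has_vector_derivative
     (V * proj_deriv n V lam B * mat_adjoint V) $$ (a,b)) (at 0)"
proof -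
  note DA = spectral_decompD[OF A]
  note ass = assoc_mult_mat[of _ n n _ n _ n]
  obtain g where g: "g > 0" "\<And>i. i < n \<Longrightarrow> g \<le> \<bar>lam i\<bar>" using finite_gap[of n lam] nz by blast
  define At where "At t = A + complex_of_real t \<cdot>\<^sub>m B" for t
  define P where "P t = neg_proj (At t)" for t
  have At: "At t \<in> carrier_mat n n" for t using DA(1) B by (simp add: At_def)
  have "\<exists>W mu. spectral_decomp n (At t) W mu" for t
    using hermitian_add_smult[OF DA(1,8) B] At by (intro hermitian_spectral_decomp) (auto simp: At_def)
  then obtain W mu where S: "spectral_decomp n (At t) (W t) (mu t)" for t by metis
  have P: "P t \<in> carrier_mat n n" for t unfolding P_def by (rule neg_proj_carrier[OF S])
  have c: "V \<in> carrier_mat n n" "mat_adjoint V \<in> carrier_mat n n" "A \<in> carrier_mat n n"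
    using DA(1,2) by auto
  define Y where "Y t = mat_adjoint V * P t * V" for t
  have Y: "Y t \<in> carrier_mat n n" for t using c P by (simp add: Y_def)
  have PY: "P t = V * Y t * mat_adjoint V" for t
    using conj_back[OF DA(2,4) P] by (simp add: Y_def)
  have nrm: "entry_norm n (A - At t) = \<bar>t\<bar> * entry_norm n B" for t
    unfolding entry_norm_def sum_distrib_left
  proof (intro sum.cong refl)
    fix a b assume "a \<in> {..<n}" "b \<in> {..<n}"
    thus "cmod ((A - At t) $$ (a,b)) = \<bar>t\<bar> * cmod (B $$ (a,b))"
      using c B by (simp add: At_def norm_mult)
  qed
  define C where "C = entry_norm n B / g"
  have C: "entry_norm n (A - At t) / g = C * \<bar>t\<bar>" for t by (simp add: nrm C_def)
  have q1: "cmod (Y t $$ (i,j) - (if i = j then neg_ind lam i else 0)) \<le> n * (C * \<bar>t\<bar>)"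
    if "i < n" "j < n" for i j t
    using neg_proj_perturbation(1)[OF A S g(2) g(1) that, of t] unfolding C Y_def P_def .
  have q2: "cmod (Y t $$ (i,j) - (if i = j then neg_ind lam i else 0)) \<le> n * (C * \<bar>t\<bar>)\<^sup>2"
    if "i < n" "j < n" "neg_ind lam i = neg_ind lam j" for i j t
    using neg_proj_perturbation(2)[OF A S g(2) g(1) that, of t] unfolding C Y_def P_def .
  have Y0: "Y 0 $$ (i,j) = (if i = j then neg_ind lam i else 0)" if "i < n" "j < n" for i j
    using q1[OF that, of 0] by simp
  have Ylim: "((\<lambda>t. Y t $$ (i,j)) \<longlongrightarrow> (if i = j then neg_ind lam i else 0)) (at 0)"
    if "i < n" "j < n" for i j
  proof -
    have "((\<lambda>t. Y t $$ (i,j) - (if i = j then neg_ind lam i else 0)) \<longlongrightarrow> 0) (at 0)"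
    proof (rule Lim_null_comparison)
      show "\<forall>\<^sub>F t in at 0. cmod (Y t $$ (i,j) - (if i = j then neg_ind lam i else 0)) \<le> n * (C * \<bar>t\<bar>)"
        using q1[OF that] by simp
      show "((\<lambda>t. n * (C * \<bar>t\<bar>)) \<longlongrightarrow> 0) (at 0)" by (auto intro!: tendsto_eq_intros)
    qed
    thus ?thesis by (simp add: LIM_zero_iff)
  qed
  define Bv where "Bv = mat_adjoint V * B * V"
  have Bv: "Bv \<in> carrier_mat n n" using c B by (simp add: Bv_def)
  \<comment> \<open>The vanishing commutator of \<open>At t\<close> and \<open>P t\<close>,
    expressed in the basis \<open>V\<close>, where \<open>A\<close> is diagonal.\<close>
  have comm: "(lam i - lam j) * Y t $$ (i,j)
      = - complex_of_real t * ((Bv * Y t) $$ (i,j) - (Y t * Bv) $$ (i,j))" if ij: "i < n" "j < n" for i j t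
  proof -
    have tB: "complex_of_real t \<cdot>\<^sub>m B \<in> carrier_mat n n" using B by simp
    have e: "A * P t + complex_of_real t \<cdot>\<^sub>m B * P t = P t * A + P t * (complex_of_real t \<cdot>\<^sub>m B)"
      using neg_proj_commute[OF S, of t] unfolding P_def[symmetric] unfolding At_def
      using add_mult_distrib_mat[OF c(3) tB P] mult_add_distrib_mat[OF P c(3) tB] by simp
    have l: "mat_adjoint V * (A * P t + complex_of_real t \<cdot>\<^sub>m B * P t) * V
      = real_diag n lam * Y t + complex_of_real t \<cdot>\<^sub>m (Bv * Y t)"
    proof -
      have 1: "mat_adjoint V * (A * P t) * V = real_diag n lam * Y t"
      proof -
        have "mat_adjoint V * (A * P t) * V = (mat_adjoint V * A) * (P t * V)"
          using c P by (simp add: ass)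
        also have "\<dots> = real_diag n lam * Y t" unfolding DA(7) Y_def using c P by (simp add: ass)
        finally show ?thesis .
      qed
      have 2: "mat_adjoint V * (complex_of_real t \<cdot>\<^sub>m B * P t) * V = complex_of_real t \<cdot>\<^sub>m (Bv * Y t)"
      proof -
        have "Bv * Y t = mat_adjoint V * B * ((V * mat_adjoint V) * (P t * V))"
          unfolding Bv_def Y_def using c P B(1) by (simp add: ass)
        also have "\<dots> = mat_adjoint V * (B * P t) * V"
          unfolding DA(4) using c P B(1) by (simp add: ass left_mult_one_mat[of _ n n])
        finally have "Bv * Y t = mat_adjoint V * (B * P t) * V" .
        thus ?thesis using c P B(1)
          by (simp add: mult_smult_assoc_mat[of _ n n _ n] mult_smult_distrib[of _ n n _ n])
      qed
      show ?thesis unfolding 1[symmetric] 2[symmetric] using c P B(1)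
        by (simp add: mult_add_distrib_mat[of _ n n _ n] add_mult_distrib_mat[of _ n n _ _ n])
    qed
    have r: "mat_adjoint V * (P t * A + P t * (complex_of_real t \<cdot>\<^sub>m B)) * V
      = Y t * real_diag n lam + complex_of_real t \<cdot>\<^sub>m (Y t * Bv)"
    proof -
      have 1: "mat_adjoint V * (P t * A) * V = Y t * real_diag n lam"
      proof -
        have "mat_adjoint V * (P t * A) * V = mat_adjoint V * (P t * (A * V))"
          using c P by (simp add: ass)
        also have "\<dots> = Y t * real_diag n lam" unfolding DA(5) Y_def using c P by (simp add: ass)
        finally show ?thesis .
      qed
      have 2: "mat_adjoint V * (P t * (complex_of_real t \<cdot>\<^sub>m B)) * V = complex_of_real t \<cdot>\<^sub>m (Y t * Bv)"
      proof -
        have "Y t * Bv = mat_adjoint V * P t * ((V * mat_adjoint V) * (B * V))"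
          unfolding Bv_def Y_def using c P B(1) by (simp add: ass)
        also have "\<dots> = mat_adjoint V * (P t * B) * V"
          unfolding DA(4) using c P B(1) by (simp add: ass left_mult_one_mat[of _ n n])
        finally have "Y t * Bv = mat_adjoint V * (P t * B) * V" .
        thus ?thesis using c P B(1)
          by (simp add: mult_smult_assoc_mat[of _ n n _ n] mult_smult_distrib[of _ n n _ n])
      qed
      show ?thesis unfolding 1[symmetric] 2[symmetric] using c P B(1)
        by (simp add: mult_add_distrib_mat[of _ n n _ n] add_mult_distrib_mat[of _ n n _ _ n])
    qed
    have "(real_diag n lam * Y t + complex_of_real t \<cdot>\<^sub>m (Bv * Y t)) $$ (i,j)
        = (Y t * real_diag n lam + complex_of_real t \<cdot>\<^sub>m (Y t * Bv)) $$ (i,j)"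
      using e l r by simp
    hence "(real_diag n lam * Y t) $$ (i,j) + complex_of_real t * (Bv * Y t) $$ (i,j)
        = (Y t * real_diag n lam) $$ (i,j) + complex_of_real t * (Y t * Bv) $$ (i,j)"
      using ij Bv Y[of t] by (simp add: real_diag_def del: index_mult_mat(1))
    thus ?thesis
      unfolding real_diag_mult_left_index[OF Y ij] real_diag_mult_right_index[OF Y ij]
      by (simp add: algebra_simps)
  qed
  have BYlim: "((\<lambda>t. (Bv * Y t) $$ (i,j) - (Y t * Bv) $$ (i,j)) \<longlongrightarrow>
      Bv $$ (i,j) * (neg_ind lam j - neg_ind lam i)) (at 0)" if ij: "i < n" "j < n" for i j
  proof -
    have "((\<lambda>t. (\<Sum>k<n. Bv $$ (i,k) * Y t $$ (k,j)) - (\<Sum>k<n. Y t $$ (i,k) * Bv $$ (k,j))) \<longlongrightarrow>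
        (\<Sum>k<n. Bv $$ (i,k) * (if k = j then neg_ind lam k else 0))
         - (\<Sum>k<n. (if i = k then neg_ind lam i else 0) * Bv $$ (k,j))) (at 0)"
      using ij by (intro tendsto_intros Ylim) auto
    also have "(\<Sum>k<n. Bv $$ (i,k) * (if k = j then neg_ind lam k else 0)) = Bv $$ (i,j) * neg_ind lam j"
      using ij by (subst sum.remove[of _ j]) auto
    also have "(\<Sum>k<n. (if i = k then neg_ind lam i else 0) * Bv $$ (k,j)) = neg_ind lam i * Bv $$ (i,j)"
      using ij by (subst sum.remove[of _ i]) auto
    finally show ?thesis
      unfolding mult_mat_index[OF Bv Y ij] mult_mat_index[OF Y Bv ij] by (simp add: algebra_simps)
  qed
  have Yd: "((\<lambda>t. Y t $$ (i,j)) has_vector_derivative proj_deriv n V lam B $$ (i,j)) (at 0)"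
    if ij: "i < n" "j < n" for i j
  proof (cases "neg_ind lam i = neg_ind lam j")
    case True
    define e where "e t = (Y t $$ (i,j) - Y 0 $$ (i,j)) / complex_of_real t" for t
    have "(e \<longlongrightarrow> 0) (at 0)"
    proof (rule Lim_null_comparison)
      show "\<forall>\<^sub>F t in at 0. cmod (e t) \<le> n * C\<^sup>2 * \<bar>t\<bar>"
      proof (rule always_eventually, rule allI)
        fix t :: real
        show "cmod (e t) \<le> n * C\<^sup>2 * \<bar>t\<bar>"
        proof (cases "t = 0")
          case False
          have "cmod (e t) \<le> n * (C * \<bar>t\<bar>)\<^sup>2 / \<bar>t\<bar>"
            unfolding e_def norm_divide norm_of_real Y0[OF ij]
            using q2[OF ij True, of t] by (intro divide_right_mono) auto
          also have "n * (C * \<bar>t\<bar>)\<^sup>2 / \<bar>t\<bar> = n * C\<^sup>2 * \<bar>t\<bar>"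
            using False by (simp add: power_mult_distrib power2_eq_square[of "\<bar>t\<bar>"] del: power2_abs abs_mult_self_eq)
          finally show ?thesis .
        qed (simp add: e_def)
      qed
      show "((\<lambda>t. n * C\<^sup>2 * \<bar>t\<bar>) \<longlongrightarrow> 0) (at 0)" by (auto intro!: tendsto_eq_intros)
    qed
    moreover have "Y t $$ (i,j) = Y 0 $$ (i,j) + t *\<^sub>R e t" for t
      by (cases "t = 0") (auto simp: e_def scaleR_conv_of_real)
    ultimately have "((\<lambda>t. Y t $$ (i,j)) has_vector_derivative 0) (at 0)"
      by (intro has_vector_derivative_difference_quotient)
    thus ?thesis using ij True by (simp add: proj_deriv_def)
  next
    case False
    hence ne: "lam i \<noteq> lam j" "i \<noteq> j" by (auto simp: neg_ind_def)
    \<comment> \<open>\<open>Y 0\<close> is zero at this entry, so solving \<open>comm\<close> for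
      it and dividing by \<open>t\<close> gives this quotient; its limit exists because
      \<open>Y t\<close> tends to a diagonal matrix.\<close>
    define e where "e t = - ((Bv * Y t) $$ (i,j) - (Y t * Bv) $$ (i,j)) / complex_of_real (lam i - lam j)" for t
    have "(e \<longlongrightarrow> - (Bv $$ (i,j) * (neg_ind lam j - neg_ind lam i)) / complex_of_real (lam i - lam j)) (at 0)"
      unfolding e_def using ne by (intro tendsto_intros BYlim ij) auto
    moreover have "Y t $$ (i,j) = Y 0 $$ (i,j) + t *\<^sub>R e t" for t
    proof -
      have ne': "complex_of_real (lam i - lam j) \<noteq> 0" using ne by simp
      have "Y t $$ (i,j) * complex_of_real (lam i - lam j) = complex_of_real t * e t * complex_of_real (lam i - lam j)"
        using comm[OF ij, of t] ne' unfolding e_def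
        by (simp add: mult.commute mult.left_commute del: of_real_diff) (simp add: right_diff_distrib)
      hence "Y t $$ (i,j) = complex_of_real t * e t" using ne' by simp
      thus ?thesis using Y0[OF ij] ne by (simp add: scaleR_conv_of_real)
    qed
    ultimately have "((\<lambda>t. Y t $$ (i,j)) has_vector_derivative
        - (Bv $$ (i,j) * (neg_ind lam j - neg_ind lam i)) / complex_of_real (lam i - lam j)) (at 0)"
      by (intro has_vector_derivative_difference_quotient)
    also have "- (Bv $$ (i,j) * (neg_ind lam j - neg_ind lam i)) / complex_of_real (lam i - lam j)
       = proj_deriv n V lam B $$ (i,j)"
      using ij ne by (simp add: proj_deriv_def Bv_def[symmetric] field_simps)
    finally show ?thesis .
  qed
  have "((\<lambda>t. \<Sum>i<n. \<Sum>j<n. V $$ (a,i) * Y t $$ (i,j) * mat_adjoint V $$ (j,b)) has_vector_derivative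
     (\<Sum>i<n. \<Sum>j<n. V $$ (a,i) * proj_deriv n V lam B $$ (i,j) * mat_adjoint V $$ (j,b))) (at 0)"
    by (intro has_vector_derivative_sum has_vector_derivative_mult_left has_vector_derivative_mult_right Yd) auto
  thus ?thesis
    unfolding triple_mult_index[OF c(1) Y c(2) ab, symmetric]
      triple_mult_index[OF c(1) proj_deriv_carrier c(2) ab, symmetric] PY[symmetric]
    unfolding P_def At_def .
qed

section \<open>Estimates for the projector derivative and the curvature identity\<close>

lemma trace_mult_comm:
  assumes X: "X \<in> carrier_mat n n" and Y: "Y \<in> carrier_mat n n"
  shows "mtrace (X * Y) = mtrace (Y * X)"
proof -
  have "mtrace (X * Y) = (\<Sum>i<n. \<Sum>j<n. X $$ (i,j) * Y $$ (j,i))"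
    using assms by (simp add: mtrace_def mult_mat_index[OF X Y] del: index_mult_mat(1))
  also have "\<dots> = (\<Sum>j<n. \<Sum>i<n. Y $$ (j,i) * X $$ (i,j))"
    by (subst sum.swap) (simp add: mult.commute)
  also have "\<dots> = mtrace (Y * X)"
    using assms by (simp add: mtrace_def mult_mat_index[OF Y X] del: index_mult_mat(1))
  finally show ?thesis .
qed

text \<open>Values of opposite sign are at least \<open>g\<close> apart, and for equal signs the
  numerator is zero.\<close>

lemma proj_deriv_gap:
  assumes "\<bar>lam i\<bar> \<ge> g" "\<bar>lam j\<bar> \<ge> g" "g > 0"
  shows "\<bar>(neg_ind lam j - neg_ind lam i) / (lam j - lam i)\<bar> \<le> 1 / g"
proof (cases "neg_ind lam j = neg_ind lam i")
  case False
  hence "\<bar>neg_ind lam j - neg_ind lam i\<bar> = 1" "\<bar>lam j - lam i\<bar> \<ge> g"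
    using assms by (auto simp: neg_ind_def split: if_splits)
  thus ?thesis using assms by (simp add: abs_divide frac_le)
qed (use assms in simp)

lemma proj_deriv_bound:
  assumes A: "spectral_decomp n A V lam" and gap: "\<And>i. i < n \<Longrightarrow> \<bar>lam i\<bar> \<ge> g" "g > 0"
    and B: "B \<in> carrier_mat n n" and ab: "a < n" "b < n"
  shows "cmod ((V * proj_deriv n V lam B * mat_adjoint V) $$ (a,b)) \<le> real n ^ 2 * (entry_norm n B / g)"
proof -
  note DA = spectral_decompD[OF A]
  have "cmod ((V * proj_deriv n V lam B * mat_adjoint V) $$ (a,b)) \<le> entry_norm n (proj_deriv n V lam B)"
    by (rule conj_unitary_bound(2)[OF DA(2,4) DA(2,4) proj_deriv_carrier ab])
  also have "\<dots> \<le> (\<Sum>i<n. \<Sum>j<n. entry_norm n B / g)"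
    unfolding entry_norm_def[of n "proj_deriv n V lam B"]
  proof (intro sum_mono)
    fix i j assume ij: "i \<in> {..<n}" "j \<in> {..<n}"
    have "cmod (proj_deriv n V lam B $$ (i,j)) = cmod ((mat_adjoint V * B * V) $$ (i,j))
        * \<bar>(neg_ind lam j - neg_ind lam i) / (lam j - lam i)\<bar>"
      using ij by (simp add: proj_deriv_def norm_mult norm_divide flip: of_real_diff)
    also have "\<dots> \<le> entry_norm n B * (1 / g)"
      using ij by (intro mult_mono conj_unitary_bound[OF DA(2,4) DA(2,4) B] proj_deriv_gap gap) auto
    finally show "cmod (proj_deriv n V lam B $$ (i,j)) \<le> entry_norm n B / g" by simp
  qed
  finally show ?thesis by (simp add: power2_eq_square mult_ac)
qed

text \<open>\<open>A\<close> is diagonal in its own eigenbasis, so the direction \<open>A\<close>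
  contributes nothing. This lets a direction that grows with the wave vector be replaced by a fixed
  one.\<close>

lemma proj_deriv_self_diff:
  assumes A: "spectral_decomp n A V lam" and B: "B \<in> carrier_mat n n"
  shows "proj_deriv n V lam (A - B) = - proj_deriv n V lam B"
proof (rule eq_matI)
  note DA = spectral_decompD[OF A]
  note ass = assoc_mult_mat[of _ n n _ n _ n]
  have c: "V \<in> carrier_mat n n" "mat_adjoint V \<in> carrier_mat n n" "A \<in> carrier_mat n n"
    using DA(1,2) by auto
  fix i j assume "i < dim_row (- proj_deriv n V lam B)" "j < dim_col (- proj_deriv n V lam B)"
  hence ij: "i < n" "j < n" by (auto simp: proj_deriv_def)
  have "mat_adjoint V * (A - B) * V = mat_adjoint V * (A * V) - mat_adjoint V * B * V"
    using c B by (simp add: mult_minus_distrib_mat[of _ n n] minus_mult_distrib_mat[of _ n n] ass)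
  also have "mat_adjoint V * (A * V) = (mat_adjoint V * V) * real_diag n lam"
    unfolding DA(5) using c by (simp add: ass)
  also have "\<dots> = real_diag n lam" unfolding DA(3) by (rule left_mult_one_mat[OF real_diag_carrier])
  finally have "(mat_adjoint V * (A - B) * V) $$ (i,j)
     = (real_diag n lam - mat_adjoint V * B * V) $$ (i,j)" by simp
  also have "\<dots> = real_diag n lam $$ (i,j) - (mat_adjoint V * B * V) $$ (i,j)"
    using ij c B by (simp del: index_mult_mat(1))
  finally show "proj_deriv n V lam (A - B) $$ (i,j) = (- proj_deriv n V lam B) $$ (i,j)"
    using ij by (auto simp: proj_deriv_def simp del: index_mult_mat(1))
qed (auto simp: proj_deriv_def)

text \<open>Hypothesis \<open>rot\<close> says that the angular derivative \<open>-y X + x Y\<close>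
  of the family is the commutator of \<open>\<i> * N\<close> with \<open>A\<close>, N being diagonal
  with entries \<open>nu\<close>. Then the angular derivative of the projector is the commutator of
  \<open>\<i> * N\<close> with the projector, and pairing it with the radial derivative
  \<open>x DX + y DY\<close> in the curvature form leaves the trace of the latter against N.\<close>

theorem curvature_trace:
  assumes A: "spectral_decomp n A V lam"
    and X: "X \<in> carrier_mat n n" and Y: "Y \<in> carrier_mat n n"
    and rot: "\<And>a b. a < n \<Longrightarrow> b < n \<Longrightarrow>
      complex_of_real (-y) * X $$ (a,b) + complex_of_real x * Y $$ (a,b) = \<i> * complex_of_real (nu a - nu b) * A $$ (a,b)"
  defines "DX \<equiv> V * proj_deriv n V lam X * mat_adjoint V"
    and "DY \<equiv> V * proj_deriv n V lam Y * mat_adjoint V"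
  shows "complex_of_real (x\<^sup>2 + y\<^sup>2) * mtrace (neg_proj A * (DX * DY - DY * DX))
     = \<i> * (\<Sum>a<n. complex_of_real (nu a) * (complex_of_real x * DX $$ (a,a) + complex_of_real y * DY $$ (a,a)))"
proof -
  note DA = spectral_decompD[OF A]
  note ass = assoc_mult_mat[of _ n n _ n _ n]
  have c: "V \<in> carrier_mat n n" "mat_adjoint V \<in> carrier_mat n n" "A \<in> carrier_mat n n"
    using DA(1,2) by auto
  define p where "p i = complex_of_real (neg_ind lam i)" for i
  define I where "I = real_diag n (neg_ind lam)"
  define U where "U = proj_deriv n V lam X"
  define W where "W = proj_deriv n V lam Y"
  have I: "I \<in> carrier_mat n n" and U: "U \<in> carrier_mat n n" and W: "W \<in> carrier_mat n n"
    by (auto simp: I_def U_def W_def)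
  have canc: "mat_adjoint V * (V * Z) = Z" if "Z \<in> carrier_mat n n" for Z
  proof -
    have "mat_adjoint V * (V * Z) = (mat_adjoint V * V) * Z" using c that by (simp add: ass)
    thus ?thesis using that by (simp add: DA(3))
  qed
  have conjm: "(V * S * mat_adjoint V) * (V * T * mat_adjoint V) = V * (S * T) * mat_adjoint V"
    if "S \<in> carrier_mat n n" "T \<in> carrier_mat n n" for S T
    using c that by (simp add: ass canc)
  have conjd: "V * S * mat_adjoint V - V * T * mat_adjoint V = V * (S - T) * mat_adjoint V"
    if "S \<in> carrier_mat n n" "T \<in> carrier_mat n n" for S T
    using c that by (simp add: mult_minus_distrib_mat[of _ n n _ n] minus_mult_distrib_mat[of _ n n _ _ n])
  have UW: "U * W - W * U \<in> carrier_mat n n" using U W by (simp add: minus_carrier_mat)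
  have "neg_proj A * (DX * DY - DY * DX) = V * (I * (U * W - W * U)) * mat_adjoint V"
    unfolding neg_proj_spectral[OF A] DX_def DY_def
    unfolding I_def[symmetric] U_def[symmetric] W_def[symmetric]
    using U W I UW by (simp add: conjm conjd)
  also have "mtrace \<dots> = mtrace (mat_adjoint V * (V * (I * (U * W - W * U))))"
    using c I UW by (intro trace_mult_comm) auto
  also have "\<dots> = mtrace (I * (U * W - W * U))" using I UW by (simp add: canc)
  also have "\<dots> = (\<Sum>i<n. p i * ((\<Sum>j<n. U $$ (i,j) * W $$ (j,i)) - (\<Sum>j<n. W $$ (i,j) * U $$ (j,i))))"
    unfolding mtrace_def
  proof (rule sum.cong)
    fix i assume "i \<in> {..<n}"
    hence i: "i < n" by simp
    show "(I * (U * W - W * U)) $$ (i,i)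
      = p i * ((\<Sum>j<n. U $$ (i,j) * W $$ (j,i)) - (\<Sum>j<n. W $$ (i,j) * U $$ (j,i)))"
      unfolding I_def real_diag_mult_left_index[OF UW i i] p_def
      using i U W by (simp add: mult_mat_index[OF U W] mult_mat_index[OF W U] del: index_mult_mat(1))
  qed (use I in auto)
  also have "\<dots> = (\<Sum>i<n. \<Sum>j<n. p i * U $$ (i,j) * W $$ (j,i)) - (\<Sum>i<n. \<Sum>j<n. p i * W $$ (i,j) * U $$ (j,i))"
    by (simp add: algebra_simps sum_subtractf sum_distrib_left)
  also have "(\<Sum>i<n. \<Sum>j<n. p i * W $$ (i,j) * U $$ (j,i)) = (\<Sum>i<n. \<Sum>j<n. p j * W $$ (j,i) * U $$ (i,j))"
    by (rule sum.swap)
  finally have tr: "mtrace (neg_proj A * (DX * DY - DY * DX)) = (\<Sum>i<n. \<Sum>j<n. (p i - p j) * U $$ (i,j) * W $$ (j,i))"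
    by (simp add: algebra_simps sum_subtractf)
  \<comment> \<open>The curvature in the eigenbasis as an alternating bilinear form in the two
    derivatives.\<close>
  define om where "om S T = (\<Sum>i<n. \<Sum>j<n. (p i - p j) * S i j * T j i)" for S T :: "nat \<Rightarrow> nat \<Rightarrow> complex"
  have anti: "om S T = - om T S" for S T
  proof -
    have "om S T = (\<Sum>i<n. \<Sum>j<n. (p j - p i) * S j i * T i j)" unfolding om_def by (rule sum.swap)
    also have "\<dots> = - om T S" unfolding om_def by (simp add: algebra_simps flip: sum_negf)
    finally show ?thesis .
  qed
  have self0: "om S S = 0" for S using anti[of S S] by simp
  define u where "u i j = U $$ (i,j)" for i j
  define w where "w i j = W $$ (i,j)" for i j
  define z where "z i j = complex_of_real x * u i j + complex_of_real y * w i j" for i j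
  define t where "t i j = complex_of_real (-y) * u i j + complex_of_real x * w i j" for i j
  \<comment> \<open>The radial and angular combinations arise from \<open>u\<close> and
    \<open>w\<close> by a matrix of determinant \<open>x^2 + y^2\<close>.\<close>
  have "om z t = complex_of_real (x * x) * om u w - complex_of_real (y * y) * om w u
      - complex_of_real (x * y) * om u u + complex_of_real (x * y) * om w w"
    unfolding om_def z_def t_def
    by (simp add: algebra_simps sum.distrib sum_subtractf sum_distrib_left)
  also have "\<dots> = complex_of_real (x\<^sup>2 + y\<^sup>2) * om u w"
    unfolding self0 using anti[of w u] by (simp add: power2_eq_square algebra_simps)
  finally have om1: "complex_of_real (x\<^sup>2 + y\<^sup>2) * om u w = om z t" by simp
  define N where "N = real_diag n nu"
  have N: "N \<in> carrier_mat n n" by (simp add: N_def)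
  define Nv where "Nv = mat_adjoint V * N * V"
  have Nv: "Nv \<in> carrier_mat n n" using c N by (simp add: Nv_def)
  have t: "t i j = \<i> * Nv $$ (i,j) * (p j - p i)" if ij: "i < n" "j < n" for i j
  proof -
    let ?M = "complex_of_real ((neg_ind lam j - neg_ind lam i) / (lam j - lam i))"
    have "complex_of_real (-y) * (mat_adjoint V * X * V) $$ (i,j) + complex_of_real x * (mat_adjoint V * Y * V) $$ (i,j)
      = (\<Sum>a<n. \<Sum>b<n. mat_adjoint V $$ (i,a) * (complex_of_real (-y) * X $$ (a,b) + complex_of_real x * Y $$ (a,b)) * V $$ (b,j))"
      unfolding triple_mult_index[OF c(2) X c(1) ij] triple_mult_index[OF c(2) Y c(1) ij]
      by (simp add: sum_distrib_left sum.distrib[symmetric] algebra_simps)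
    also have "\<dots> = (\<Sum>a<n. \<Sum>b<n. mat_adjoint V $$ (i,a) * (\<i> * complex_of_real (nu a - nu b) * A $$ (a,b)) * V $$ (b,j))"
      using rot by (intro sum.cong refl) simp
    also have "\<dots> = \<i> * (\<Sum>a<n. \<Sum>b<n. mat_adjoint V $$ (i,a) * (N * A - A * N) $$ (a,b) * V $$ (b,j))"
      unfolding sum_distrib_left
    proof (intro sum.cong refl)
      fix a b assume "a \<in> {..<n}" "b \<in> {..<n}"
      hence ab: "a < n" "b < n" by auto
      have "(N * A - A * N) $$ (a,b) = (N * A) $$ (a,b) - (A * N) $$ (a,b)"
        using ab N c by (simp del: index_mult_mat(1))
      also have "\<dots> = complex_of_real (nu a - nu b) * A $$ (a,b)"
        unfolding N_def real_diag_mult_left_index[OF c(3) ab] real_diag_mult_right_index[OF c(3) ab]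
        by (simp add: algebra_simps)
      finally show "mat_adjoint V $$ (i,a) * (\<i> * complex_of_real (nu a - nu b) * A $$ (a,b)) * V $$ (b,j)
        = \<i> * (mat_adjoint V $$ (i,a) * (N * A - A * N) $$ (a,b) * V $$ (b,j))" by simp
    qed
    also have "\<dots> = \<i> * (mat_adjoint V * (N * A - A * N) * V) $$ (i,j)"
      using c N by (subst triple_mult_index[OF c(2) _ c(1) ij]) (auto simp: minus_carrier_mat)
    also have "mat_adjoint V * (N * A - A * N) * V = Nv * real_diag n lam - real_diag n lam * Nv"
    proof -
      have "mat_adjoint V * (N * A - A * N) * V = mat_adjoint V * N * (A * V) - (mat_adjoint V * A) * (N * V)"
        using c N by (simp add: ass mult_minus_distrib_mat[of _ n n _ n] minus_mult_distrib_mat[of _ n n _ _ n])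
      thus ?thesis unfolding DA(5,7) Nv_def using c N by (simp add: ass)
    qed
    also have "(Nv * real_diag n lam - real_diag n lam * Nv) $$ (i,j) = complex_of_real (lam j - lam i) * Nv $$ (i,j)"
    proof -
      have "(Nv * real_diag n lam - real_diag n lam * Nv) $$ (i,j)
        = (Nv * real_diag n lam) $$ (i,j) - (real_diag n lam * Nv) $$ (i,j)"
        using ij Nv by (simp add: real_diag_def del: index_mult_mat(1))
      thus ?thesis unfolding real_diag_mult_left_index[OF Nv ij] real_diag_mult_right_index[OF Nv ij]
        by (simp add: algebra_simps)
    qed
    finally have e: "complex_of_real (-y) * (mat_adjoint V * X * V) $$ (i,j) + complex_of_real x * (mat_adjoint V * Y * V) $$ (i,j)
      = \<i> * (complex_of_real (lam j - lam i) * Nv $$ (i,j))" .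
    have "t i j = (complex_of_real (-y) * (mat_adjoint V * X * V) $$ (i,j) + complex_of_real x * (mat_adjoint V * Y * V) $$ (i,j)) * ?M"
      unfolding t_def u_def w_def U_def W_def using ij
      by (simp add: proj_deriv_def left_diff_distrib mult.assoc del: index_mult_mat(1) of_real_divide of_real_diff)
    also have "\<dots> = \<i> * Nv $$ (i,j) * complex_of_real ((lam j - lam i) * ((neg_ind lam j - neg_ind lam i) / (lam j - lam i)))"
      unfolding e by simp
    \<comment> \<open>The divided difference undoes the commutator with the diagonal of
      \<open>lam\<close>; for equal eigenvalues both sides are zero.\<close>
    also have "(lam j - lam i) * ((neg_ind lam j - neg_ind lam i) / (lam j - lam i)) = neg_ind lam j - neg_ind lam i"
      by (cases "lam j = lam i") (auto simp: neg_ind_def)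
    finally show ?thesis by (simp add: p_def)
  qed
  have trN: "mtrace (S * Nv) = (\<Sum>a<n. complex_of_real (nu a) * (V * S * mat_adjoint V) $$ (a,a))"
    if S: "S \<in> carrier_mat n n" for S
  proof -
    have VS: "V * S * mat_adjoint V \<in> carrier_mat n n" using c S by simp
    have "mtrace (S * Nv) = mtrace ((S * mat_adjoint V * N) * V)" using c S N by (simp add: Nv_def ass)
    also have "\<dots> = mtrace (V * (S * mat_adjoint V * N))" using c S N by (intro trace_mult_comm) auto
    also have "V * (S * mat_adjoint V * N) = (V * S * mat_adjoint V) * N" using c S N by (simp add: ass)
    also have "mtrace \<dots> = (\<Sum>a<n. complex_of_real (nu a) * (V * S * mat_adjoint V) $$ (a,a))"
      unfolding mtrace_def using VS c
      by (auto simp: N_def real_diag_mult_right_index[OF VS] simp del: index_mult_mat(1) intro!: sum.cong)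
    finally show ?thesis .
  qed
  have "om z t = (\<Sum>i<n. \<Sum>j<n. \<i> * (z i j * Nv $$ (j,i)))"
    unfolding om_def
  proof (intro sum.cong refl)
    fix i j assume "i \<in> {..<n}" "j \<in> {..<n}"
    hence ij: "i < n" "j < n" by auto
    show "(p i - p j) * z i j * t j i = \<i> * (z i j * Nv $$ (j,i))"
    proof (cases "neg_ind lam i = neg_ind lam j")
      case True
      hence "z i j = 0" using ij by (simp add: z_def u_def w_def U_def W_def proj_deriv_def)
      thus ?thesis by simp
    next
      case False
      \<comment> \<open>One factor comes from the form and one from \<open>t\<close>; their product
        is 1 exactly where \<open>z\<close> can be non-zero.\<close>
      hence "(p i - p j) * (p i - p j) = 1" by (auto simp: p_def neg_ind_def split: if_splits)
      thus ?thesis unfolding t[OF ij(2,1)] by (simp add: mult_ac)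
    qed
  qed
  also have "\<dots> = \<i> * (complex_of_real x * mtrace (U * Nv) + complex_of_real y * mtrace (W * Nv))"
  proof -
    have m: "mtrace (U * Nv) = (\<Sum>i<n. \<Sum>j<n. u i j * Nv $$ (j,i))"
      "mtrace (W * Nv) = (\<Sum>i<n. \<Sum>j<n. w i j * Nv $$ (j,i))"
      using U W Nv by (auto simp: mtrace_def mult_mat_index[OF U Nv] mult_mat_index[OF W Nv] u_def w_def
        simp del: index_mult_mat(1))
    show ?thesis unfolding m z_def
      by (simp add: distrib_left distrib_right sum.distrib sum_distrib_left mult.assoc)
  qed
  finally have om2: "om z t = \<i> * (complex_of_real x * (\<Sum>a<n. complex_of_real (nu a) * (V * U * mat_adjoint V) $$ (a,a))
     + complex_of_real y * (\<Sum>a<n. complex_of_real (nu a) * (V * W * mat_adjoint V) $$ (a,a)))" unfolding trN[OF U] trN[OF W] .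
  have "mtrace (neg_proj A * (DX * DY - DY * DX)) = om u w" unfolding tr om_def u_def w_def ..
  thus ?thesis
    unfolding DX_def DY_def U_def[symmetric] W_def[symmetric]
    using om1 om2 by (simp add: algebra_simps sum_distrib_left sum.distrib)
qed

section \<open>Integrals of radial functions\<close>

text \<open>Polar coordinates as the law of the modulus: the half-line up to \<open>a\<close> has as
  preimage a disc of area pi a^2, and 2 pi r is the derivative of that area. Half-lines generate the
  Borel sets, so equality on them suffices.\<close>

lemma distr_norm_complex:
  "distr lborel borel (norm :: complex \<Rightarrow> real)
     = density lborel (\<lambda>r. ennreal (2 * pi * r * indicator {0..} r))"
proof -
  have l: "emeasure (distr lborel borel (norm :: complex \<Rightarrow> real)) {..a} = emeasure lborel (cball (0::complex) a)" for a
    by (subst emeasure_distr) (auto simp: cball_def vimage_def)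
  show ?thesis
  proof (rule measure_eqI_generator_eq[where \<Omega> = UNIV and E = "range (\<lambda>a. {..a})" and A = "\<lambda>i. {..real i}"])
    show "Int_stable (range (\<lambda>a::real. {..a}))"
      by (auto simp: Int_stable_def)
    fix X assume "X \<in> range (\<lambda>a::real. {..a})"
    then obtain a where X: "X = {..a}" by auto
    have r: "emeasure (density lborel (\<lambda>r. ennreal (2 * pi * r * indicator {0..} r))) X
       = (\<integral>\<^sup>+r. ennreal (2 * pi * r) * indicator {0..a} r \<partial>lborel)"
      unfolding X by (subst emeasure_density) (auto intro!: nn_integral_cong split: split_indicator)
    show "emeasure (distr lborel borel (norm :: complex \<Rightarrow> real)) X
        = emeasure (density lborel (\<lambda>r. ennreal (2 * pi * r * indicator {0..} r))) X"
    proof (cases "a \<ge> 0")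
      case True
      have "(\<integral>\<^sup>+r. ennreal (2 * pi * r) * indicator {0..a} r \<partial>lborel) = ennreal (pi * a\<^sup>2 - pi * 0\<^sup>2)"
        using True by (intro nn_integral_FTC_Icc) (auto intro!: derivative_eq_intros)
      moreover have "emeasure lborel (cball (0::complex) a) = ennreal (pi * a\<^sup>2)"
        using emeasure_cball[OF True, of "0::complex"] by (simp add: unit_ball_vol_2)
      ultimately show ?thesis using l[of a] r X by simp
    next
      case False
      thus ?thesis using l[of a] r X by simp
    qed
  next
    show "(\<Union>i. {..real i}) = UNIV" by (auto intro: real_arch_simple)
    fix i
    show "emeasure (distr lborel borel (norm :: complex \<Rightarrow> real)) {..real i} \<noteq> \<infinity>"
      unfolding l using emeasure_lborel_cball_finite[of "0::complex" "real i"] by simp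
  qed (auto simp: borel_eq_atMost sets_measure_of)
qed

text \<open>The density 2 pi r of the modulus cancels the division by the norm, leaving the integral
  of \<open>g\<close> over the half-line, which the fundamental theorem evaluates. The weight
  \<open>1 + r^2\<close> gives an integrable majorant, whose integral is an arctangent.\<close>

theorem radial_derivative_has_integral:
  fixes G g :: "real \<Rightarrow> real"
  assumes deriv: "\<And>r. (G has_real_derivative g r) (at r)"
    and bound: "\<And>r. r \<ge> 0 \<Longrightarrow> \<bar>g r\<bar> * (1 + r\<^sup>2) \<le> C"
    and lim: "(G \<longlongrightarrow> L) at_top"
  shows "((\<lambda>\<kappa>::complex. g (norm \<kappa>) / norm \<kappa>) has_integral 2 * pi * (L - G 0)) UNIV"
proof -
  have contG: "continuous_on UNIV G"
    using deriv by (auto intro!: DERIV_continuous_on)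
  have [measurable]: "G \<in> borel_measurable borel"
    using contG by (rule borel_measurable_continuous_onI)
  \<comment> \<open>\<open>g\<close> need not be continuous; it is a pointwise limit of difference
    quotients of the continuous \<open>G\<close>.\<close>
  have [measurable]: "g \<in> borel_measurable borel"
  proof (rule borel_measurable_LIMSEQ_real)
    fix r :: real
    have "((\<lambda>h. (G (r + h) - G r) / h) \<longlongrightarrow> g r) (at 0)" using deriv[of r] by (simp add: DERIV_def)
    moreover have "filterlim (\<lambda>n. 1 / real (Suc n)) (at 0) sequentially"
      unfolding filterlim_at using LIMSEQ_inverse_real_of_nat by (auto simp: inverse_eq_divide)
    ultimately show "(\<lambda>n. (G (r + 1 / real (Suc n)) - G r) / (1 / real (Suc n))) \<longlonglongrightarrow> g r"
      by (rule filterlim_compose)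
  qed simp
  have "integrable lborel (\<lambda>r::real. indicator {0..} r * (1 / (1 + r\<^sup>2)))"
  proof (rule integrableI_bounded)
    have "(\<integral>\<^sup>+r. ennreal (1 / (1 + r\<^sup>2)) * indicator {0..} r \<partial>lborel) = ennreal (pi / 2 - arctan 0)"
      by (intro nn_integral_FTC_atLeast tendsto_arctan_at_top)
        (auto intro!: derivative_eq_intros simp: inverse_eq_divide)
    moreover have "(\<integral>\<^sup>+r. ennreal (norm (indicator {0..} (r::real) * (1 / (1 + r\<^sup>2)))) \<partial>lborel)
        = (\<integral>\<^sup>+r. ennreal (1 / (1 + r\<^sup>2)) * indicator {0..} r \<partial>lborel)"
      by (intro nn_integral_cong) (auto split: split_indicator)
    ultimately show "(\<integral>\<^sup>+r. ennreal (norm (indicator {0..} (r::real) * (1 / (1 + r\<^sup>2)))) \<partial>lborel) < \<infinity>"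
      by simp
  qed simp
  hence dom: "integrable lborel (\<lambda>r::real. C * (indicator {0..} r * (1 / (1 + r\<^sup>2))))"
    by (rule integrable_mult_right)
  have si: "set_integrable lborel {0..} g"
    unfolding set_integrable_def
  proof (rule Bochner_Integration.integrable_bound[OF dom])
    show "AE r in lborel. norm (indicator {0..} r *\<^sub>R g r) \<le> norm (C * (indicator {0..} r * (1 / (1 + r\<^sup>2))))"
    proof (rule AE_I2)
      fix r :: real
      show "norm (indicator {0..} r *\<^sub>R g r) \<le> norm (C * (indicator {0..} r * (1 / (1 + r\<^sup>2))))"
      proof (cases "r \<ge> 0")
        case True
        have p: "1 + r\<^sup>2 > 0" by (simp add: add_pos_nonneg)
        hence "\<bar>g r\<bar> \<le> C / (1 + r\<^sup>2)" using bound[OF True] by (simp add: pos_le_divide_eq)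
        also have "\<dots> \<le> \<bar>C / (1 + r\<^sup>2)\<bar>" by (rule abs_ge_self)
        finally show ?thesis using True by simp
      qed simp
    qed
  qed simp
  have int0: "(LINT r:{0..b}|lborel. g r) = G b - G 0" if "b \<ge> 0" for b
  proof -
    have "set_integrable lborel {0..b} g" using si by (rule set_integrable_subset) auto
    hence "(LINT r:{0..b}|lborel. g r) = integral {0..b} g" by (rule set_borel_integral_eq_integral(2))
    also have "(g has_integral G b - G 0) {0..b}"
      using that deriv by (intro fundamental_theorem_of_calculus)
        (auto simp: has_real_derivative_iff_has_vector_derivative[symmetric] intro: DERIV_subset)
    hence "integral {0..b} g = G b - G 0" by (rule integral_unique)
    finally show ?thesis .
  qed
  have "((\<lambda>b. LINT r:{0..b}|lborel. g r) \<longlongrightarrow> (LINT r:{0..}|lborel. g r)) at_top"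
    using si by (intro tendsto_set_lebesgue_integral_at_top) auto
  moreover have "((\<lambda>b. LINT r:{0..b}|lborel. g r) \<longlongrightarrow> L - G 0) at_top"
  proof (rule Lim_transform_eventually)
    show "((\<lambda>b. G b - G 0) \<longlongrightarrow> L - G 0) at_top" by (intro tendsto_intros lim)
    show "\<forall>\<^sub>F b in at_top. G b - G 0 = (LINT r:{0..b}|lborel. g r)"
      using eventually_ge_at_top[of 0] by eventually_elim (simp add: int0)
  qed
  ultimately have I: "(LINT r:{0..}|lborel. g r) = L - G 0"
    by (rule tendsto_unique[OF trivial_limit_at_top_linorder])
  define w where "w r = 2 * pi * r * indicator {0..} r" for r :: real
  have [measurable]: "w \<in> borel_measurable borel" unfolding w_def[abs_def] by simp
  have w0: "AE r in lborel. 0 \<le> w r" by (intro AE_I2) (auto simp: w_def indicator_def)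
  \<comment> \<open>At zero the left side vanishes while the right side need not, so that point is
    excluded as a null set.\<close>
  have ae: "AE r in lborel. w r *\<^sub>R (g r / r) = 2 * pi * (indicator {0..} r *\<^sub>R g r)"
    using AE_lborel_singleton[of "0::real"] by eventually_elim (auto simp: w_def)
  have int: "integrable lborel (\<lambda>r. w r *\<^sub>R (g r / r))"
    using si unfolding set_integrable_def
    by (subst integrable_cong_AE[OF _ _ ae]) auto
  have dn: "distr lborel borel (norm :: complex \<Rightarrow> real) = density lborel (\<lambda>r. ennreal (w r))"
    unfolding w_def by (rule distr_norm_complex)
  have "integrable (density lborel (\<lambda>r. ennreal (w r))) (\<lambda>r. g r / r)"
    by (subst integrable_density) (use int w0 in auto)
  hence i2: "integrable lborel (\<lambda>\<kappa>::complex. g (norm \<kappa>) / norm \<kappa>)"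
    unfolding dn[symmetric] by (subst (asm) integrable_distr_eq) auto
  have "(LINT \<kappa>::complex|lborel. g (norm \<kappa>) / norm \<kappa>)
      = integral\<^sup>L (distr lborel borel (norm :: complex \<Rightarrow> real)) (\<lambda>r. g r / r)"
    by (subst integral_distr) auto
  also have "\<dots> = (LINT r|lborel. w r *\<^sub>R (g r / r))"
    unfolding dn by (subst integral_density) (use w0 in auto)
  also have "\<dots> = (LINT r|lborel. 2 * pi * (indicator {0..} r *\<^sub>R g r))"
    by (rule integral_cong_AE[OF _ _ ae]) auto
  also have "\<dots> = 2 * pi * (L - G 0)"
    using I by (simp add: set_lebesgue_integral_def)
  finally have "(LINT \<kappa>::complex|lborel. g (norm \<kappa>) / norm \<kappa>) = 2 * pi * (L - G 0)" .
  thus ?thesis using has_integral_integral_lborel[OF i2] by simp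
qed

section \<open>The Hamiltonian\<close>

text \<open>Conjugation by a diagonal unitary together with a real scaling. Instances are the
  rotation of \<open>\<kappa>\<close> (\<open>s = 1\<close>), rescaling (trivial phases) and sign
  reversal (\<open>s = -1\<close>).\<close>

lemma spectral_decomp_diag_conj:
  assumes S: "spectral_decomp n A V lam" and B: "B \<in> carrier_mat n n"
    and ph: "\<And>a. a < n \<Longrightarrow> cmod (ph a) = 1"
    and BA: "\<And>a b. a < n \<Longrightarrow> b < n \<Longrightarrow> B $$ (a,b) = complex_of_real s * ph a * cnj (ph b) * A $$ (a,b)"
  shows "spectral_decomp n B (mat n n (\<lambda>(a,k). ph a * V $$ (a,k))) (\<lambda>k. s * lam k)"
  unfolding spectral_decomp_def
proof (intro conjI)
  note D = spectral_decompD[OF S]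
  let ?W = "mat n n (\<lambda>(a,k). ph a * V $$ (a,k))"
  have W: "?W \<in> carrier_mat n n" and W': "mat_adjoint ?W \<in> carrier_mat n n" by simp_all
  have V': "mat_adjoint V \<in> carrier_mat n n" using D(2) by simp
  have pp: "cnj (ph a) * ph a = 1" if "a < n" for a
    using ph[OF that] by (metis complex_norm_square mult.commute of_real_1 power_one)
  show "B \<in> carrier_mat n n" "?W \<in> carrier_mat n n" by fact+
  show "mat_adjoint ?W * ?W = 1\<^sub>m n"
  proof (rule eq_matI)
    fix i j assume "i < dim_row (1\<^sub>m n)" "j < dim_col (1\<^sub>m n)"
    hence ij: "i < n" "j < n" by auto
    have "(mat_adjoint ?W * ?W) $$ (i,j) = (\<Sum>a<n. (cnj (ph a) * ph a) * (cnj (V $$ (a,i)) * V $$ (a,j)))"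
      unfolding mult_mat_index[OF W' W ij] using ij by (intro sum.cong) (auto simp: mat_adjoint_index[OF W])
    also have "\<dots> = (\<Sum>a<n. mat_adjoint V $$ (i,a) * V $$ (a,j))"
      using ij D(2) pp by (intro sum.cong) auto
    also have "\<dots> = (mat_adjoint V * V) $$ (i,j)" unfolding mult_mat_index[OF V' D(2) ij] ..
    finally show "(mat_adjoint ?W * ?W) $$ (i,j) = (1\<^sub>m n) $$ (i,j)" using D(3) by simp
  qed auto
  show "B * ?W = ?W * real_diag n (\<lambda>k. s * lam k)"
  proof (rule eq_matI)
    fix a k assume "a < dim_row (?W * real_diag n (\<lambda>k. s * lam k))" "k < dim_col (?W * real_diag n (\<lambda>k. s * lam k))"
    hence ak: "a < n" "k < n" by (auto simp: real_diag_def)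
    have "(B * ?W) $$ (a,k) = (\<Sum>b<n. (complex_of_real s * ph a) * (A $$ (a,b) * V $$ (b,k)))"
      unfolding mult_mat_index[OF B W ak]
    proof (rule sum.cong[OF refl])
      fix b assume "b \<in> {..<n}"
      hence b: "b < n" by simp
      have "B $$ (a,b) * ?W $$ (b,k) = (complex_of_real s * ph a) * (A $$ (a,b) * V $$ (b,k)) * (cnj (ph b) * ph b)"
        using ak b BA[OF ak(1) b] by simp
      thus "B $$ (a,b) * ?W $$ (b,k) = (complex_of_real s * ph a) * (A $$ (a,b) * V $$ (b,k))"
        by (simp add: pp[OF b])
    qed
    also have "\<dots> = complex_of_real s * ph a * (A * V) $$ (a,k)"
      unfolding mult_mat_index[OF D(1,2) ak] sum_distrib_left ..
    also have "\<dots> = complex_of_real s * ph a * (V $$ (a,k) * lam k)"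
      unfolding D(5) real_diag_mult_right_index[OF D(2) ak] ..
    also have "\<dots> = (?W * real_diag n (\<lambda>k. s * lam k)) $$ (a,k)"
      unfolding real_diag_mult_right_index[OF W ak] using ak by simp
    finally show "(B * ?W) $$ (a,k) = (?W * real_diag n (\<lambda>k. s * lam k)) $$ (a,k)" .
  qed (use B in \<open>auto simp: real_diag_def\<close>)
qed

lemma neg_proj_diag:
  assumes S: "spectral_decomp n A V lam" and a: "a < n"
  shows "neg_proj A $$ (a,a) = complex_of_real (\<Sum>k<n. neg_ind lam k * (cmod (V $$ (a,k)))\<^sup>2)"
proof -
  note D = spectral_decompD[OF S]
  have VI: "V * real_diag n (neg_ind lam) \<in> carrier_mat n n" and V': "mat_adjoint V \<in> carrier_mat n n"
    using D(2) by auto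
  show ?thesis
    unfolding neg_proj_spectral[OF S] mult_mat_index[OF VI V' a a]
    using a D(2) by (auto simp: real_diag_mult_right_index[OF D(2)] mult_ac simp del: index_mult_mat(1)
        simp flip: complex_norm_square intro!: sum.cong)
qed

lemma neg_proj_diag_conj:
  assumes S: "spectral_decomp n A V lam" and B: "B \<in> carrier_mat n n"
    and ph: "\<And>a. a < n \<Longrightarrow> cmod (ph a) = 1"
    and BA: "\<And>a b. a < n \<Longrightarrow> b < n \<Longrightarrow> B $$ (a,b) = complex_of_real s * ph a * cnj (ph b) * A $$ (a,b)"
    and s: "s > 0" and a: "a < n"
  shows "neg_proj B $$ (a,a) = neg_proj A $$ (a,a)"
  using spectral_decomp_diag_conj[OF S B ph BA] s a
  by (simp add: neg_proj_diag[OF _ a] neg_proj_diag[OF S a] norm_mult ph neg_ind_def mult_less_0_iff)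

lemma neg_proj_diag_flip:
  assumes S: "spectral_decomp n A V lam" and B: "B \<in> carrier_mat n n"
    and sg: "\<And>a. a < n \<Longrightarrow> cmod (sg a) = 1"
    and BA: "\<And>a b. a < n \<Longrightarrow> b < n \<Longrightarrow> B $$ (a,b) = - sg a * cnj (sg b) * A $$ (a,b)"
    and nz: "\<And>i. i < n \<Longrightarrow> lam i \<noteq> 0" and a: "a < n"
  shows "neg_proj B $$ (a,a) = 1 - neg_proj A $$ (a,a)"
proof -
  note D = spectral_decompD[OF S]
  have "spectral_decomp n B (mat n n (\<lambda>(a,k). sg a * V $$ (a,k))) (\<lambda>k. (-1) * lam k)"
    using BA by (intro spectral_decomp_diag_conj[OF S B sg]) auto
  from neg_proj_diag[OF this a]
  have "neg_proj B $$ (a,a) = complex_of_real (\<Sum>k<n. neg_ind (\<lambda>k. - lam k) k * (cmod (V $$ (a,k)))\<^sup>2)"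
    using a by (simp add: norm_mult sg)
  also have "(\<Sum>k<n. neg_ind (\<lambda>k. - lam k) k * (cmod (V $$ (a,k)))\<^sup>2)
      = (\<Sum>k<n. (cmod (V $$ (a,k)))\<^sup>2) - (\<Sum>k<n. neg_ind lam k * (cmod (V $$ (a,k)))\<^sup>2)"
    unfolding sum_subtractf[symmetric] using nz by (intro sum.cong refl) (force simp: neg_ind_def)
  also have "complex_of_real \<dots> = complex_of_real (\<Sum>k<n. (cmod (V $$ (a,k)))\<^sup>2)
      - complex_of_real (\<Sum>k<n. neg_ind lam k * (cmod (V $$ (a,k)))\<^sup>2)" by (rule of_real_diff)
  also have "complex_of_real (\<Sum>k<n. (cmod (V $$ (a,k)))\<^sup>2) = 1"
    using unitary_row_orthonormal[OF D(2,4) a a] by (simp flip: complex_norm_square)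
  finally show ?thesis by (simp add: neg_proj_diag[OF S a])
qed

text \<open>The perturbation bound with difference zero makes every \<open>mu j\<close> equal to
  some \<open>lam i\<close>.\<close>

lemma spectral_decomp_nonzero_unique:
  assumes S: "spectral_decomp n A V lam" and S': "spectral_decomp n A W mu"
    and nz: "\<And>i. i < n \<Longrightarrow> lam i \<noteq> 0" and j: "j < n"
  shows "mu j \<noteq> 0"
proof -
  have "entry_norm n (A - A) = 0" using spectral_decompD(1)[OF S] by (simp add: entry_norm_def)
  thus ?thesis using eigenvalue_perturbation[OF S S' j] nz by auto
qed

definition layer_energy :: "nat \<Rightarrow> real \<Rightarrow> nat \<Rightarrow> real" where
  "layer_energy m v b = v / (real m - 1) * (real (b+1) - (real m + 1) / 2)"

text \<open>\<open>Hmat\<close> is affine in \<open>\<kappa>\<close> over the reals, and this is its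
  linear part: the derivative of the Hamiltonian in direction \<open>d\<close> and, for
  \<open>d = \<kappa>\<close>, its in-plane part.\<close>

definition Hdir :: "nat \<Rightarrow> complex \<Rightarrow> complex mat" where
  "Hdir m d = mat (2*m) (2*m) (\<lambda>(i,j).
     if j = i + 1 \<and> even i then cnj d else if i = j + 1 \<and> even j then d else 0)"

section \<open>Entries of the Hamiltonian and its symmetries\<close>

lemma Hmat_carrier [simp]: "Hmat m \<gamma> v \<kappa> \<in> carrier_mat (2*m) (2*m)"
  by (simp add: Hmat_def)

lemma Hdir_carrier [simp]: "Hdir m d \<in> carrier_mat (2*m) (2*m)"
  by (simp add: Hdir_def)

lemma Hdir_index:
  "i < 2*m \<Longrightarrow> j < 2*m \<Longrightarrow> Hdir m d $$ (i,j) =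
     (if j = i + 1 \<and> even i then cnj d else if i = j + 1 \<and> even j then d else 0)"
  by (simp add: Hdir_def)

text \<open>In the flattened index the matrix is tridiagonal: the coupling \<open>\<gamma>\<close>
  links position 1 of a layer with position 0 of the next, that is \<open>2*b+1\<close> with
  \<open>2*b+2\<close>, so wave vector and coupling alternate next to the diagonal.\<close>

lemma Hmat_index:
  assumes "i < 2*m" "j < 2*m"
  shows "Hmat m \<gamma> v \<kappa> $$ (i,j) =
    (if i = j then complex_of_real (layer_energy m v (i div 2))
     else if j = i + 1 then (if even i then cnj \<kappa> else \<gamma>)
     else if i = j + 1 then (if even j then \<kappa> else \<gamma>) else 0)"
proof -
  obtain b a where i: "i = 2 * b + a" "a < 2" by (metis mult_div_mod_eq mod_less_divisor pos2)
  obtain b' a' where j: "j = 2 * b' + a'" "a' < 2" by (metis mult_div_mod_eq mod_less_divisor pos2)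
  have a: "a = 0 \<or> a = 1" and a': "a' = 0 \<or> a' = 1" using i j by auto
  have e: "Hmat m \<gamma> v \<kappa> $$ (i,j) = (if b = b' then (if a = a' then complex_of_real (layer_energy m v b)
        else if a = 0 then cnj \<kappa> else \<kappa>)
     else if b' = b + 1 \<and> a = 1 \<and> a' = 0 then complex_of_real \<gamma>
     else if b = b' + 1 \<and> a = 0 \<and> a' = 1 then complex_of_real \<gamma> else 0)"
    using assms i j by (simp add: Hmat_def Let_def layer_energy_def)
  have d: "i div 2 = b" using i by simp
  show ?thesis
    unfolding e d using a a' unfolding i(1) j(1) by (elim disjE; auto; presburger)
qed

lemma Hmat_add_direction:
  "Hmat m \<gamma> v (\<kappa> + complex_of_real t * d) = Hmat m \<gamma> v \<kappa> + complex_of_real t \<cdot>\<^sub>m Hdir m d"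
proof (rule eq_matI)
  fix i j assume "i < dim_row (Hmat m \<gamma> v \<kappa> + complex_of_real t \<cdot>\<^sub>m Hdir m d)"
    "j < dim_col (Hmat m \<gamma> v \<kappa> + complex_of_real t \<cdot>\<^sub>m Hdir m d)"
  hence ij: "i < 2*m" "j < 2*m" by (auto simp: Hdir_def)
  thus "Hmat m \<gamma> v (\<kappa> + complex_of_real t * d) $$ (i,j) = (Hmat m \<gamma> v \<kappa> + complex_of_real t \<cdot>\<^sub>m Hdir m d) $$ (i,j)"
    using carrier_matD[OF Hdir_carrier, of m d] by (simp add: Hmat_index Hdir_index)
qed (auto simp: Hdir_def Hmat_def)

lemma Hmat_hermitian: "mat_adjoint (Hmat m \<gamma> v \<kappa>) = Hmat m \<gamma> v \<kappa>"
proof (rule eq_matI)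
  fix i j assume "i < dim_row (Hmat m \<gamma> v \<kappa>)" "j < dim_col (Hmat m \<gamma> v \<kappa>)"
  hence "i < 2*m" "j < 2*m" by (auto simp: Hmat_def)
  thus "mat_adjoint (Hmat m \<gamma> v \<kappa>) $$ (i,j) = Hmat m \<gamma> v \<kappa> $$ (i,j)"
    by (simp add: mat_adjoint_index[OF Hmat_carrier] Hmat_index)
qed (auto simp: Hmat_def)

lemma Hdir_hermitian: "mat_adjoint (Hdir m d) = Hdir m d"
proof (rule eq_matI)
  fix i j assume "i < dim_row (Hdir m d)" "j < dim_col (Hdir m d)"
  hence "i < 2*m" "j < 2*m" by (auto simp: Hdir_def)
  thus "mat_adjoint (Hdir m d) $$ (i,j) = Hdir m d $$ (i,j)"
    by (simp add: mat_adjoint_index[OF Hdir_carrier] Hdir_index)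
qed (auto simp: Hdir_def)

lemma Hmat_spectral_decomp: "\<exists>V lam. spectral_decomp (2*m) (Hmat m \<gamma> v \<kappa>) V lam"
  by (rule hermitian_spectral_decomp[OF Hmat_carrier Hmat_hermitian])

text \<open>The weight rises by one across each wave vector entry and is constant across each
  coupling entry; hence phases with these exponents rotate \<open>\<kappa>\<close> and leave
  \<open>\<gamma>\<close> alone.\<close>

definition winding :: "nat \<Rightarrow> nat" where
  "winding a = (a + 1) div 2"

text \<open>Both sides are the derivative of the Hamiltonian in the direction
  \<open>\<i> * \<kappa>\<close>; this is the hypothesis \<open>rot\<close> of
  \<open>curvature_trace\<close>.\<close>

lemma Hmat_rotation_generator:
  assumes "a < 2*m" "b < 2*m"
  shows "complex_of_real (- Im \<kappa>) * Hdir m 1 $$ (a,b) + complex_of_real (Re \<kappa>) * Hdir m \<i> $$ (a,b)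
    = \<i> * complex_of_real (real (winding a) - real (winding b)) * Hmat m \<gamma> v \<kappa> $$ (a,b)"
proof -
  have w: "winding (Suc a) = (if even a then winding a + 1 else winding a)" for a
    unfolding winding_def by (auto elim!: evenE oddE)
  show ?thesis
    using assms by (auto simp: Hmat_index Hdir_index w complex_eq_iff)
qed

lemma Hmat_radial_neg_proj_diag:
  assumes a: "a < 2*m"
  shows "neg_proj (Hmat m \<gamma> v \<kappa>) $$ (a,a) = neg_proj (Hmat m \<gamma> v (complex_of_real (norm \<kappa>))) $$ (a,a)"
proof (cases "\<kappa> = 0")
  case False
  obtain V lam where S: "spectral_decomp (2*m) (Hmat m \<gamma> v (complex_of_real (norm \<kappa>))) V lam"
    using Hmat_spectral_decomp by blast
  have w: "winding (Suc a) = (if even a then winding a + 1 else winding a)" for a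
    unfolding winding_def by (auto elim!: evenE oddE)
  have n1: "cmod (sgn \<kappa>) = 1" using False by (simp add: norm_sgn)
  have c1: "sgn \<kappa> * cnj (sgn \<kappa>) = 1"
    using n1 by (metis complex_norm_square of_real_1 power_one)
  have c2: "sgn \<kappa> ^ k * cnj (sgn \<kappa>) ^ k = 1" for k
    by (simp add: c1 flip: power_mult_distrib)
  have k: "complex_of_real (cmod \<kappa>) * sgn \<kappa> = \<kappa>" using False by (simp add: sgn_eq)
  have k': "complex_of_real (cmod \<kappa>) * cnj (sgn \<kappa>) = cnj \<kappa>"
    using arg_cong[OF k, of cnj] by simp
  show ?thesis
  proof (rule neg_proj_diag_conj[OF S Hmat_carrier, where ph = "\<lambda>a. sgn \<kappa> ^ winding a" and s = 1])
    fix i j assume ij: "i < 2*m" "j < 2*m"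
    have 1: "cnj (sgn \<kappa>) ^ k * sgn \<kappa> ^ k = 1" for k using c2[of k] by (simp add: mult.commute)
    have 2: "sgn \<kappa> * (sgn \<kappa> ^ k * (cnj (sgn \<kappa>) ^ k * complex_of_real (cmod \<kappa>))) = \<kappa>" for k
      using c2[of k] k by (metis (no_types, lifting) mult.assoc mult.commute mult.left_neutral)
    have 3: "cnj (sgn \<kappa>) * (sgn \<kappa> ^ k * (cnj (sgn \<kappa>) ^ k * complex_of_real (cmod \<kappa>))) = cnj \<kappa>" for k
      using c2[of k] k' by (metis (no_types, lifting) mult.assoc mult.commute mult.left_neutral)
    show "Hmat m \<gamma> v \<kappa> $$ (i,j) = complex_of_real 1 * sgn \<kappa> ^ winding i * cnj (sgn \<kappa> ^ winding j)
        * Hmat m \<gamma> v (complex_of_real (norm \<kappa>)) $$ (i,j)"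
      using ij c2 1 2 3 by (auto simp: Hmat_index w mult_ac)
  qed (use n1 a in \<open>auto simp: norm_power\<close>)
qed simp

text \<open>Row \<open>k\<close> has a non-zero entry at \<open>k + 1\<close>, so it determines
  \<open>f (k + 1)\<close> from the preceding values; a kernel vector is fixed by its first
  entry.\<close>

lemma tridiagonal_kernel:
  fixes f :: "nat \<Rightarrow> complex"
  assumes "\<gamma> \<noteq> 0" "\<kappa> \<noteq> 0"
    and ker: "\<And>i. i < 2*m \<Longrightarrow> (\<Sum>j<2*m. Hmat m \<gamma> v \<kappa> $$ (i,j) * f j) = 0" and f0: "f 0 = 0"
    and i: "i < 2*m"
  shows "f i = 0"
  using i
proof (induction i rule: less_induct)
  case (less i)
  show ?case
  proof (cases i)
    case 0
    thus ?thesis using f0 by simp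
  next
    case (Suc k)
    have k: "k < 2*m" using less.prems Suc by simp
    have "0 = (\<Sum>j<2*m. Hmat m \<gamma> v \<kappa> $$ (k,j) * f j)" using ker[OF k] by simp
    also have "\<dots> = (\<Sum>j<2*m. if j = i then Hmat m \<gamma> v \<kappa> $$ (k,i) * f i else 0)"
    proof (intro sum.cong refl)
      fix j assume j: "j \<in> {..<2*m}"
      consider "j < i" | "j = i" | "j > i" by linarith
      thus "Hmat m \<gamma> v \<kappa> $$ (k,j) * f j = (if j = i then Hmat m \<gamma> v \<kappa> $$ (k,i) * f i else 0)"
        using j k Suc less.IH[of j] less.prems by cases (auto simp: Hmat_index)
    qed
    also have "\<dots> = Hmat m \<gamma> v \<kappa> $$ (k,i) * f i" using less.prems by simp
    finally show ?thesis using k less.prems Suc assms(1,2) by (auto simp: Hmat_index split: if_splits)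
  qed
qed

text \<open>The antiunitary map sending \<open>w\<close> to \<open>\<lambda>a. (-1)^a * cnj (w (2*m - 1 - a))\<close> anticommutes with the
  Hamiltonian and squares to \<open>-1\<close>, so the kernel has even dimension; being tridiagonal with
  non-zero off-diagonal entries, the Hamiltonian has a kernel of dimension at most one.\<close>

lemma Hmat_reflect:
  assumes "a < 2*m" "j < 2*m"
  shows "Hmat m \<gamma> v \<kappa> $$ (2*m - 1 - a, 2*m - 1 - j) * (-1) ^ (a + j) = - cnj (Hmat m \<gamma> v \<kappa> $$ (a,j))"
proof -
  have lt: "2*m - 1 - a < 2*m" "2*m - 1 - j < 2*m" using assms by auto
  have ev: "even (2*m - 1 - k) \<longleftrightarrow> odd k" if "k < 2*m" for k
    using that by (auto simp: even_diff_nat)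
  have en: "layer_energy m v ((2*m - 1 - a) div 2) = - layer_energy m v (a div 2)"
  proof -
    have "(2*m - 1 - a) div 2 + a div 2 + 1 = m"
    proof (cases "even a")
      case True
      then obtain k where k: "a = 2 * k" by blast
      hence "2*m - 1 - a = 2 * (m - 1 - k) + 1" using assms(1) by simp
      thus ?thesis using k assms(1) by simp
    next
      case False
      then obtain k where k: "a = 2 * k + 1" by (blast elim: oddE)
      hence "2*m - 1 - a = 2 * (m - 1 - k)" using assms(1) by simp
      thus ?thesis using k assms(1) by simp
    qed
    hence "real ((2*m - 1 - a) div 2) + real (a div 2) + 1 = real m" by linarith
    hence "real ((2*m - 1 - a) div 2 + 1) - (real m + 1) / 2 = - (real (a div 2 + 1) - (real m + 1) / 2)"
      by (simp add: field_simps)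
    thus ?thesis unfolding layer_energy_def by (simp only: mult_minus_right)
  qed
  have c1: "2*m - 1 - a = 2*m - 1 - j \<longleftrightarrow> a = j" "2*m - 1 - j = 2*m - 1 - a + 1 \<longleftrightarrow> a = j + 1"
    "2*m - 1 - a = 2*m - 1 - j + 1 \<longleftrightarrow> j = a + 1" using assms by auto
  show ?thesis
    unfolding Hmat_index[OF lt] Hmat_index[OF assms] c1 en ev[OF assms(1)] ev[OF assms(2)]
    by (auto simp flip: power_add mult_2)
qed

lemma Hmat_nonzero_eigenvalues:
  assumes "\<gamma> \<noteq> 0" "\<kappa> \<noteq> 0" and S: "spectral_decomp (2*m) (Hmat m \<gamma> v \<kappa>) V lam" and i: "i < 2*m"
  shows "lam i \<noteq> 0"
proof
  assume z: "lam i = 0"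
  define n where "n = 2 * m"
  let ?H = "\<lambda>i j. Hmat m \<gamma> v \<kappa> $$ (i,j)"
  note D = spectral_decompD[OF S]
  define w where "w a = V $$ (a,i)" for a
  have ker: "(\<Sum>j<n. ?H a j * w j) = 0" if a: "a < n" for a
  proof -
    have "(\<Sum>j<n. ?H a j * w j) = (Hmat m \<gamma> v \<kappa> * V) $$ (a,i)"
      unfolding n_def w_def using a i by (subst mult_mat_index[OF D(1,2)]) (auto simp: n_def)
    also have "\<dots> = V $$ (a,i) * lam i"
      unfolding D(5) using a i by (intro real_diag_mult_right_index[OF D(2)]) (auto simp: n_def)
    finally show ?thesis using z by simp
  qed
  define y where "y a = (-1) ^ a * cnj (w (n - 1 - a))" for a
  have kery: "(\<Sum>j<n. ?H a j * y j) = 0" if a: "a < n" for a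
  proof -
    define a' where "a' = n - 1 - a"
    have a': "a' < n" "a = n - 1 - a'" using a by (auto simp: a'_def)
    have "(\<Sum>j<n. ?H a j * y j) = (\<Sum>j<n. ?H a (n - 1 - j) * y (n - 1 - j))"
      by (subst sum.nat_diff_reindex[symmetric]) simp
    also have "\<dots> = (\<Sum>j<n. - ((-1) ^ (n - 1 + a')) * cnj (?H a' j * w j))"
    proof (rule sum.cong[OF refl])
      fix j assume "j \<in> {..<n}"
      hence j: "j < n" by simp
      have "(-1::complex) ^ (n - 1 - j) = (-1) ^ (a' + j) * (-1) ^ (n - 1 + a')"
      proof -
        have "even (n - 1 - j) \<longleftrightarrow> even ((a' + j) + (n - 1 + a'))" using j by (auto simp: even_diff_nat)
        thus ?thesis by (simp add: minus_one_power_iff flip: power_add)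
      qed
      moreover have "n - 1 - (n - 1 - j) = j" using j by simp
      ultimately have "?H a (n - 1 - j) * y (n - 1 - j)
          = (?H (n - 1 - a') (n - 1 - j) * (-1) ^ (a' + j)) * ((-1) ^ (n - 1 + a') * cnj (w j))"
        using a' by (simp add: y_def mult_ac)
      also have "?H (n - 1 - a') (n - 1 - j) * (-1) ^ (a' + j) = - cnj (?H a' j)"
        using Hmat_reflect[of a' m j \<gamma> v \<kappa>] a' j by (simp add: n_def)
      finally show "?H a (n - 1 - j) * y (n - 1 - j) = - ((-1) ^ (n - 1 + a')) * cnj (?H a' j * w j)"
        by simp
    qed
    also have "\<dots> = - ((-1) ^ (n - 1 + a')) * cnj (\<Sum>j<n. ?H a' j * w j)"
      by (simp add: sum_distrib_left)
    finally show ?thesis using ker[OF a'(1)] by simp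
  qed
  have n0: "n > 0" using i by (simp add: n_def)
  \<comment> \<open>This combination of two kernel vectors vanishes at index 0, hence everywhere.
    Its entry at the odd index \<open>n - 1\<close> is the sum of the squared moduli of the two end
    entries of \<open>w\<close>, which therefore vanish.\<close>
  have "y 0 * w (n - 1) - w 0 * y (n - 1) = 0"
  proof (rule tridiagonal_kernel[OF assms(1,2), where f = "\<lambda>j. y 0 * w j - w 0 * y j" and m = m and v = v])
    fix a assume a: "a < 2*m"
    have "(\<Sum>j<2*m. ?H a j * (y 0 * w j - w 0 * y j))
      = y 0 * (\<Sum>j<n. ?H a j * w j) - w 0 * (\<Sum>j<n. ?H a j * y j)"
      by (simp add: n_def sum_distrib_left algebra_simps sum_subtractf)
    thus "(\<Sum>j<2*m. ?H a j * (y 0 * w j - w 0 * y j)) = 0" using ker kery a by (simp add: n_def)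
  qed (use n0 in \<open>auto simp: n_def\<close>)
  moreover have "odd (n - 1)" using n0 by (simp add: n_def)
  ultimately have "cnj (w (n - 1)) * w (n - 1) + w 0 * cnj (w 0) = 0"
    by (simp add: y_def)
  hence "complex_of_real ((cmod (w (n - 1)))\<^sup>2 + (cmod (w 0))\<^sup>2) = 0"
    by (simp add: complex_norm_square mult.commute del: of_real_power)
  hence "(cmod (w (n - 1)))\<^sup>2 + (cmod (w 0))\<^sup>2 = 0" unfolding of_real_eq_0_iff .
  hence "w 0 = 0" by (simp add: add_nonneg_eq_0_iff)
  have "w a = 0" if "a < 2*m" for a
    by (rule tridiagonal_kernel[where f = w, OF assms(1,2) _ \<open>w 0 = 0\<close> that]) (rule ker[unfolded n_def])
  hence "(\<Sum>a<2*m. mat_adjoint V $$ (i,a) * V $$ (a,i)) = 0" by (simp add: w_def)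
  hence "(mat_adjoint V * V) $$ (i,i) = 0"
    using i D(2) by (subst mult_mat_index[of _ "2*m" "2*m" _ "2*m"]) auto
  thus False using D(3) i by simp
qed

section \<open>The Chern integral as a boundary term\<close>

lemma Hdir_row_sum:
  assumes a: "a < 2*m"
  shows "(\<Sum>k<2*m. Hdir m 1 $$ (a,k) * f k) = f (if even a then a + 1 else a - 1)"
proof -
  let ?p = "if even a then a + 1 else a - 1"
  have p: "?p < 2*m" using a by auto
  have "(\<Sum>k<2*m. Hdir m 1 $$ (a,k) * f k) = (\<Sum>k<2*m. if k = ?p then f k else 0)"
    using a by (intro sum.cong refl) (auto simp: Hdir_index elim: oddE)
  thus ?thesis using p by simp
qed

text \<open>\<open>Hdir m 1\<close> exchanges the two positions of every layer, so it is an
  involution.\<close>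

lemma Hdir_eigenvalues:
  assumes S: "spectral_decomp (2*m) (Hdir m 1) V lam" and i: "i < 2*m"
  shows "\<bar>lam i\<bar> = 1"
proof -
  note D = spectral_decompD[OF S]
  define p where "p a = (if even a then a + 1 else a - 1)" for a :: nat
  have p: "p a < 2*m" "p (p a) = a" if "a < 2*m" for a
    using that by (auto simp: p_def)
  have ev: "lam i * V $$ (a,i) = V $$ (p a,i)" if a: "a < 2*m" for a
  proof -
    have "(Hdir m 1 * V) $$ (a,i) = V $$ (p a,i)"
      unfolding mult_mat_index[OF D(1,2) a i] p_def using Hdir_row_sum[OF a] .
    thus ?thesis unfolding D(5) real_diag_mult_right_index[OF D(2) a i] by (simp add: mult.commute)
  qed
  have "\<exists>a<2*m. V $$ (a,i) \<noteq> 0"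
  proof (rule ccontr)
    assume "\<not> ?thesis"
    hence "(\<Sum>a<2*m. mat_adjoint V $$ (i,a) * V $$ (a,i)) = 0" by simp
    hence "(mat_adjoint V * V) $$ (i,i) = 0"
      using i D(2) by (subst mult_mat_index[of _ "2*m" "2*m" _ "2*m"]) auto
    thus False using D(3) i by simp
  qed
  then obtain a where a: "a < 2*m" "V $$ (a,i) \<noteq> 0" by blast
  have "complex_of_real (lam i * lam i) * V $$ (a,i) = V $$ (a,i)"
    using ev[OF a(1)] ev[OF p(1)[OF a(1)]] p(2)[OF a(1)] by (simp add: mult.assoc)
  hence "complex_of_real (lam i * lam i) = 1" using a by simp
  hence "lam i * lam i = 1" by (metis of_real_eq_1_iff)
  thus ?thesis by (simp add: square_eq_1_iff) (auto simp: square_eq_1_iff abs_if)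
qed

text \<open>Alternating signs carry the matrix to its negative, so every diagonal entry equals one
  minus itself.\<close>

lemma neg_proj_Hdir_diag:
  assumes a: "a < 2*m"
  shows "neg_proj (Hdir m 1) $$ (a,a) = 1/2"
proof -
  obtain V lam where S: "spectral_decomp (2*m) (Hdir m 1) V lam"
    using hermitian_spectral_decomp[OF Hdir_carrier Hdir_hermitian] by blast
  have "neg_proj (Hdir m 1) $$ (a,a) = 1 - neg_proj (Hdir m 1) $$ (a,a)"
  proof (rule neg_proj_diag_flip[OF S Hdir_carrier, where sg = "\<lambda>a. (-1) ^ a"])
    fix i j assume "i < 2*m" "j < 2*m"
    thus "Hdir m 1 $$ (i,j) = - ((-1) ^ i) * cnj ((-1) ^ j) * Hdir m 1 $$ (i,j)"
      by (auto simp: Hdir_index)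
  next
    fix i assume "i < 2*m"
    thus "lam i \<noteq> 0" using Hdir_eigenvalues[OF S] by force
  qed (use a in \<open>auto simp: norm_power\<close>)
  thus ?thesis by (simp add: field_simps eq_diff_eq)
qed

lemma sum_winding: "(\<Sum>a<2*m. real (winding a)) = (real m)\<^sup>2"
proof (induction m)
  case (Suc m)
  have "{..<2 * Suc m} = insert (2*m+1) (insert (2*m) {..<2*m})" by auto
  thus ?case using Suc by (simp add: winding_def power2_eq_square algebra_simps)
qed simp

text \<open>This is the function G of the overview, taken along the real axis. It is defined for
  negative \<open>r\<close> too, so that its derivative at 0 is two-sided.\<close>

definition occupied_moment :: "nat \<Rightarrow> real \<Rightarrow> real \<Rightarrow> real \<Rightarrow> real" where
  "occupied_moment m \<gamma> v r =
     (\<Sum>a<2*m. real (winding a) * Re (neg_proj (Hmat m \<gamma> v (complex_of_real r)) $$ (a,a)))"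

lemma occupied_moment_complex:
  "complex_of_real (occupied_moment m \<gamma> v (norm \<kappa>))
     = (\<Sum>a<2*m. complex_of_real (real (winding a)) * neg_proj (Hmat m \<gamma> v \<kappa>) $$ (a,a))"
proof -
  obtain V lam where S: "spectral_decomp (2*m) (Hmat m \<gamma> v \<kappa>) V lam" using Hmat_spectral_decomp by blast
  have "complex_of_real (Re (neg_proj (Hmat m \<gamma> v (complex_of_real (norm \<kappa>))) $$ (a,a)))
      = neg_proj (Hmat m \<gamma> v \<kappa>) $$ (a,a)" if "a < 2*m" for a
    unfolding Hmat_radial_neg_proj_diag[OF that, symmetric] neg_proj_diag[OF S that] by simp
  thus ?thesis by (simp add: occupied_moment_def)
qed

lemma Hmat_split: "Hmat m \<gamma> v \<kappa> - Hmat m \<gamma> v 0 = Hdir m \<kappa>"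
proof (rule eq_matI)
  fix i j assume "i < dim_row (Hdir m \<kappa>)" "j < dim_col (Hdir m \<kappa>)"
  hence "i < 2*m" "j < 2*m" by (auto simp: Hdir_def)
  thus "(Hmat m \<gamma> v \<kappa> - Hmat m \<gamma> v 0) $$ (i,j) = Hdir m \<kappa> $$ (i,j)"
    using carrier_matD[OF Hmat_carrier] by (auto simp: Hmat_index Hdir_index)
qed (auto simp: Hmat_def Hdir_def)

lemma proj_deriv_linear:
  assumes V: "V \<in> carrier_mat n n" and X: "X \<in> carrier_mat n n" and Y: "Y \<in> carrier_mat n n"
    and Z: "Z \<in> carrier_mat n n" "\<And>i j. i < n \<Longrightarrow> j < n \<Longrightarrow> Z $$ (i,j) = x * X $$ (i,j) + y * Y $$ (i,j)"
    and ab: "a < n" "b < n"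
  shows "(V * proj_deriv n V lam Z * mat_adjoint V) $$ (a,b)
    = x * (V * proj_deriv n V lam X * mat_adjoint V) $$ (a,b) + y * (V * proj_deriv n V lam Y * mat_adjoint V) $$ (a,b)"
proof -
  have V': "mat_adjoint V \<in> carrier_mat n n" using V by simp
  have e: "(mat_adjoint V * Z * V) $$ (i,j) = x * (mat_adjoint V * X * V) $$ (i,j) + y * (mat_adjoint V * Y * V) $$ (i,j)"
    if ij: "i < n" "j < n" for i j
    unfolding triple_mult_index[OF V' Z(1) V ij] triple_mult_index[OF V' X V ij] triple_mult_index[OF V' Y V ij]
    by (simp add: Z(2) sum_distrib_left sum.distrib algebra_simps)
  have "proj_deriv n V lam Z $$ (i,j) = x * proj_deriv n V lam X $$ (i,j) + y * proj_deriv n V lam Y $$ (i,j)"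
    if ij: "i < n" "j < n" for i j
    using ij e[OF ij] by (simp add: proj_deriv_def distrib_right mult.assoc del: index_mult_mat(1) of_real_divide of_real_diff)
  thus ?thesis
    unfolding triple_mult_index[OF V proj_deriv_carrier V' ab]
    by (simp add: sum_distrib_left sum.distrib algebra_simps)
qed

text \<open>The gap is assumed at zero wave vector only; elsewhere it follows from
  \<open>Hmat_nonzero_eigenvalues\<close>.\<close>

locale gapped_hamiltonian =
  fixes m :: nat and \<gamma> v :: real
  assumes gamma: "\<gamma> \<noteq> 0"
    and gap0: "\<And>V lam i. spectral_decomp (2*m) (Hmat m \<gamma> v 0) V lam \<Longrightarrow> i < 2*m \<Longrightarrow> lam i \<noteq> 0"
begin

abbreviation "H \<equiv> Hmat m \<gamma> v"
abbreviation "G \<equiv> occupied_moment m \<gamma> v"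

section \<open>A spectral gap growing linearly in the wave vector\<close>

lemma nonzero:
  assumes "spectral_decomp (2*m) (H \<kappa>) V lam" "i < 2*m"
  shows "lam i \<noteq> 0"
  using Hmat_nonzero_eigenvalues[OF gamma _ assms] gap0[of V lam i] assms by (cases "\<kappa> = 0") auto

lemma entry_norm_diff:
  "entry_norm (2*m) (H (complex_of_real r) - H (complex_of_real s)) = \<bar>r - s\<bar> * entry_norm (2*m) (Hdir m 1)"
  unfolding entry_norm_def sum_distrib_left
proof (intro sum.cong refl)
  fix a b assume "a \<in> {..<2*m}" "b \<in> {..<2*m}"
  thus "cmod ((H (complex_of_real r) - H (complex_of_real s)) $$ (a,b)) = \<bar>r - s\<bar> * cmod (Hdir m 1 $$ (a,b))"
    using carrier_matD[OF Hmat_carrier] by (auto simp: Hmat_index Hdir_index simp flip: of_real_diff)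
qed

text \<open>Eigenvalues move by at most \<open>K\<close> times the displacement, so half of the gap
  survives on a radius of \<open>g / (2 * K)\<close>. The summand 1 in \<open>K\<close> keeps it
  positive.\<close>

lemma local_gap:
  "\<exists>d>0. \<exists>e>0. \<forall>s. \<bar>s - r\<bar> < d \<longrightarrow> (\<forall>V lam. spectral_decomp (2*m) (H (complex_of_real s)) V lam \<longrightarrow> (\<forall>i<2*m. e \<le> \<bar>lam i\<bar>))"
proof -
  obtain V lam where S: "spectral_decomp (2*m) (H (complex_of_real r)) V lam" using Hmat_spectral_decomp by blast
  obtain g where g: "g > 0" "\<And>i. i < 2*m \<Longrightarrow> g \<le> \<bar>lam i\<bar>" using finite_gap[of "2*m" lam] nonzero[OF S] by blast
  define K where "K = real (2*m) * entry_norm (2*m) (Hdir m 1) + 1"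
  have K: "K > 0" by (simp add: K_def add_nonneg_pos)
  have "g / 2 \<le> \<bar>mu j\<bar>" if s: "\<bar>s - r\<bar> < g / (2 * K)" and T: "spectral_decomp (2*m) (H (complex_of_real s)) W mu"
    and j: "j < 2*m" for s W mu j
  proof -
    obtain i where i: "i < 2*m" "\<bar>lam i - mu j\<bar> \<le> real (2*m) * (\<bar>r - s\<bar> * entry_norm (2*m) (Hdir m 1))"
      using eigenvalue_perturbation[OF S T j] entry_norm_diff by auto
    have "real (2*m) * (\<bar>r - s\<bar> * entry_norm (2*m) (Hdir m 1)) \<le> \<bar>s - r\<bar> * K"
      by (simp add: K_def algebra_simps abs_minus_commute)
    also have "\<dots> \<le> g / (2 * K) * K" using s K by (intro mult_right_mono) auto
    also have "\<dots> = g / 2" using K by simp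
    finally show ?thesis using i g(2)[OF i(1)] by linarith
  qed
  moreover have "g / (2 * K) > 0" "g / 2 > 0" using g K by auto
  ultimately show ?thesis by blast
qed

text \<open>Two adjacent intervals with gaps share the smaller of them, so the bisection principle
  \<open>Bolzano\<close> extends the local gap to the whole interval.\<close>

lemma compact_gap:
  assumes "0 \<le> R"
  shows "\<exists>e>0. \<forall>s\<in>{0..R}. \<forall>V lam. spectral_decomp (2*m) (H (complex_of_real s)) V lam \<longrightarrow> (\<forall>i<2*m. e \<le> \<bar>lam i\<bar>)"
proof -
  define gap_on where "gap_on a b \<longleftrightarrow> (\<exists>e>0. \<forall>s\<in>{a..b}. \<forall>V lam. spectral_decomp (2*m) (H (complex_of_real s)) V lam \<longrightarrow> (\<forall>i<2*m. e \<le> \<bar>lam i\<bar>))" for a b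
  have "gap_on 0 R" using assms
  proof (induction rule: Bolzano)
    case (trans a b c)
    then obtain e1 e2 where e: "e1 > 0" "e2 > 0"
      "\<forall>s\<in>{a..b}. \<forall>V lam. spectral_decomp (2*m) (H (complex_of_real s)) V lam \<longrightarrow> (\<forall>i<2*m. e1 \<le> \<bar>lam i\<bar>)"
      "\<forall>s\<in>{b..c}. \<forall>V lam. spectral_decomp (2*m) (H (complex_of_real s)) V lam \<longrightarrow> (\<forall>i<2*m. e2 \<le> \<bar>lam i\<bar>)" unfolding gap_on_def by blast
    have "min e1 e2 \<le> \<bar>lam i\<bar>"
      if "s \<in> {a..c}" "spectral_decomp (2*m) (H (complex_of_real s)) V lam" "i < 2*m" for s V lam i
    proof (cases "s \<le> b")
      case True
      hence "s \<in> {a..b}" using that by auto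
      thus ?thesis using e(3) that by (metis min.coboundedI1)
    next
      case False
      hence "s \<in> {b..c}" using that by auto
      thus ?thesis using e(4) that by (metis min.coboundedI2)
    qed
    thus ?case unfolding gap_on_def using e(1,2) by (intro exI[of _ "min e1 e2"]) auto
  next
    case (local x)
    obtain d e where d: "d > 0" "e > 0"
      "\<forall>s. \<bar>s - x\<bar> < d \<longrightarrow> (\<forall>V lam. spectral_decomp (2*m) (H (complex_of_real s)) V lam \<longrightarrow> (\<forall>i<2*m. e \<le> \<bar>lam i\<bar>))"
      using local_gap by blast
    show ?case
    proof (intro exI[of _ d] conjI allI impI)
      fix a b assume ab: "a \<le> x \<and> x \<le> b \<and> b - a < d"
      have "\<forall>s\<in>{a..b}. \<bar>s - x\<bar> < d" using ab by auto
      thus "gap_on a b" unfolding gap_on_def using d by blast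
    qed (use d in auto)
  qed
  thus ?thesis unfolding gap_on_def .
qed

lemma smult_Hdir_spectral:
  "\<exists>V lam. spectral_decomp (2*m) (complex_of_real r \<cdot>\<^sub>m Hdir m 1) V lam \<and> (\<forall>i<2*m. \<bar>lam i\<bar> = \<bar>r\<bar>)"
proof -
  obtain V lam where S: "spectral_decomp (2*m) (Hdir m 1) V lam"
    using hermitian_spectral_decomp[OF Hdir_carrier Hdir_hermitian] by blast
  have "spectral_decomp (2*m) (complex_of_real r \<cdot>\<^sub>m Hdir m 1) (mat (2*m) (2*m) (\<lambda>(a,k). 1 * V $$ (a,k))) (\<lambda>k. r * lam k)"
    by (rule spectral_decomp_diag_conj[OF S, where ph = "\<lambda>_. 1"]) (use carrier_matD[OF Hdir_carrier] in auto)
  moreover have "\<forall>i<2*m. \<bar>r * lam i\<bar> = \<bar>r\<bar>" using Hdir_eigenvalues[OF S] by (simp add: abs_mult)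
  ultimately show ?thesis by blast
qed

text \<open>On a bounded range compactness gives a constant gap. Far out, the in-plane part has
  eigenvalues of modulus \<open>r\<close>, and the rest, \<open>H 0\<close>, moves them by a bounded
  amount.\<close>

lemma uniform_gap:
  obtains c where "c > 0" "\<And>r V lam i. r \<ge> 0 \<Longrightarrow> spectral_decomp (2*m) (H (complex_of_real r)) V lam \<Longrightarrow> i < 2*m \<Longrightarrow>
     c * (1 + r) \<le> \<bar>lam i\<bar>"
proof -
  \<comment> \<open>With this choice the shift caused by \<open>H 0\<close> is at most
    \<open>(R - 1) / 2\<close>, so for \<open>r > R\<close> at least half of \<open>r\<close>
    survives.\<close>
  define R where "R = 2 * (real (2*m) * entry_norm (2*m) (H 0)) + 1"
  have R: "R \<ge> 1" by (simp add: R_def)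
  obtain e where e: "e > 0" "\<forall>s\<in>{0..R}. \<forall>V lam. spectral_decomp (2*m) (H (complex_of_real s)) V lam \<longrightarrow> (\<forall>i<2*m. e \<le> \<bar>lam i\<bar>)"
    using compact_gap[of R] R by auto
  define c where "c = min (e / (1 + R)) (1/4)"
  have c: "c > 0" using e R by (simp add: c_def)
  have "c * (1 + r) \<le> \<bar>mu j\<bar>" if r: "r \<ge> 0" and T: "spectral_decomp (2*m) (H (complex_of_real r)) W mu" and j: "j < 2*m"
    for r W mu j
  proof (cases "r \<le> R")
    case True
    have "c * (1 + r) \<le> e / (1 + R) * (1 + R)"
      using True r R e by (intro mult_mono) (auto simp: c_def)
    also have "\<dots> = e" using R by simp
    also have "\<dots> \<le> \<bar>mu j\<bar>" using e(2) True r T j by auto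
    finally show ?thesis .
  next
    case False
    obtain V lam where S: "spectral_decomp (2*m) (complex_of_real r \<cdot>\<^sub>m Hdir m 1) V lam" "\<forall>i<2*m. \<bar>lam i\<bar> = \<bar>r\<bar>"
      using smult_Hdir_spectral by blast
    have "entry_norm (2*m) (complex_of_real r \<cdot>\<^sub>m Hdir m 1 - H (complex_of_real r)) = entry_norm (2*m) (H 0)"
      unfolding entry_norm_def
    proof (intro sum.cong refl)
      fix a b assume "a \<in> {..<2*m}" "b \<in> {..<2*m}"
      thus "cmod ((complex_of_real r \<cdot>\<^sub>m Hdir m 1 - H (complex_of_real r)) $$ (a,b)) = cmod (H 0 $$ (a,b))"
        using carrier_matD[OF Hmat_carrier] carrier_matD[OF Hdir_carrier] by (auto simp: Hmat_index Hdir_index)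
    qed
    then obtain i where i: "i < 2*m" "\<bar>lam i - mu j\<bar> \<le> real (2*m) * entry_norm (2*m) (H 0)"
      using eigenvalue_perturbation[OF S(1) T j] by auto
    have "\<bar>lam i\<bar> = r" using S(2) i r by simp
    hence "r - (R - 1) / 2 \<le> \<bar>mu j\<bar>" using i by (simp add: R_def)
    moreover have "c * (1 + r) \<le> 1/4 * (1 + r)"
      using r by (intro mult_right_mono) (simp_all only: c_def min.cobounded2)
    moreover have "1/4 * (1 + r) \<le> r - (R - 1) / 2" using False R by (simp add: field_simps)
    ultimately show ?thesis by (meson order_trans)
  qed
  with c show ?thesis using that by blast
qed

section \<open>Derivative, decay and limit of the occupied moment\<close>

lemma neg_proj_H_derivative:
  assumes S: "spectral_decomp (2*m) (H \<kappa>) V lam" and ab: "a < 2*m" "b < 2*m"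
  shows "((\<lambda>t. neg_proj (H (\<kappa> + complex_of_real t * d)) $$ (a,b)) has_vector_derivative
     (V * proj_deriv (2*m) V lam (Hdir m d) * mat_adjoint V) $$ (a,b)) (at 0)"
  unfolding Hmat_add_direction
  by (rule neg_proj_has_derivative[OF S nonzero[OF S] Hdir_carrier Hdir_hermitian ab])

definition moment_deriv :: "complex \<Rightarrow> complex mat \<Rightarrow> (nat \<Rightarrow> real) \<Rightarrow> complex" where
  "moment_deriv d V lam = (\<Sum>a<2*m. complex_of_real (real (winding a)) *
      (V * proj_deriv (2*m) V lam (Hdir m d) * mat_adjoint V) $$ (a,a))"

lemma moment_along_line:
  assumes S: "spectral_decomp (2*m) (H \<kappa>) V lam"
  shows "((\<lambda>t. complex_of_real (G (norm (\<kappa> + complex_of_real t * d)))) has_vector_derivative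
     moment_deriv d V lam) (at 0)"
  unfolding occupied_moment_complex moment_deriv_def
  by (intro has_vector_derivative_sum has_vector_derivative_mult_right neg_proj_H_derivative[OF S]) auto

lemma G_even: "G (- r) = G r"
proof -
  have "complex_of_real (G r) = complex_of_real (G \<bar>r\<bar>)" for r
  proof -
    have "Re (neg_proj (H (complex_of_real r)) $$ (a,a)) = Re (neg_proj (H (complex_of_real \<bar>r\<bar>)) $$ (a,a))"
      if "a < 2*m" for a
      using Hmat_radial_neg_proj_diag[OF that, of \<gamma> v "complex_of_real r"] by simp
    thus ?thesis by (simp add: occupied_moment_def)
  qed
  thus ?thesis by (metis abs_minus_cancel of_real_eq_iff)
qed

lemma G_abs: "G \<bar>r\<bar> = G r"
  using G_even by (simp add: abs_if)

text \<open>Along the real axis the modulus is the absolute value of \<open>r + t\<close>; evenness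
  of \<open>G\<close> removes it, so the formula also holds at \<open>r = 0\<close>.\<close>

lemma G_derivative:
  assumes S: "spectral_decomp (2*m) (H (complex_of_real r)) V lam"
  shows "(G has_real_derivative Re (moment_deriv 1 V lam)) (at r)"
proof -
  have "((\<lambda>t. complex_of_real (G (norm (complex_of_real r + complex_of_real t * 1)))) has_vector_derivative
     moment_deriv 1 V lam) (at 0)" by (rule moment_along_line[OF S])
  moreover have "norm (complex_of_real r + complex_of_real t * 1) = \<bar>r + t\<bar>" for t
    by (metis mult.right_neutral norm_of_real of_real_add)
  ultimately have "((\<lambda>t. complex_of_real (G (r + t))) has_vector_derivative moment_deriv 1 V lam) (at 0)"
    by (simp add: G_abs)
  hence "((\<lambda>t. Re (complex_of_real (G (r + t)))) has_vector_derivative Re (moment_deriv 1 V lam)) (at 0)"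
    by (rule bounded_linear.has_vector_derivative[OF bounded_linear_Re])
  hence "((\<lambda>t. G (r + t)) has_real_derivative Re (moment_deriv 1 V lam)) (at 0)"
    by (simp add: has_real_derivative_iff_has_vector_derivative)
  hence "((\<lambda>t. G (t + r)) has_real_derivative Re (moment_deriv 1 V lam)) (at 0)"
    by (simp add: add.commute)
  thus ?thesis using DERIV_shift[of G _ 0 r] by simp
qed

text \<open>On the ray through \<open>\<kappa>\<close> the modulus is a multiple of
  \<open>1 + t\<close> near \<open>t = 0\<close>, so the chain rule computes the same derivative as
  \<open>moment_along_line\<close>.\<close>

lemma moment_deriv_radial:
  assumes S: "spectral_decomp (2*m) (H \<kappa>) V lam" and nz: "\<kappa> \<noteq> 0"
  shows "moment_deriv \<kappa> V lam = complex_of_real (norm \<kappa> * deriv G (norm \<kappa>))"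
proof -
  obtain W mu where T: "spectral_decomp (2*m) (H (complex_of_real (norm \<kappa>))) W mu" using Hmat_spectral_decomp by blast
  have dG: "(G has_real_derivative deriv G (norm \<kappa>)) (at (norm \<kappa>))"
    using G_derivative[OF T] by (metis DERIV_imp_deriv)
  have "((\<lambda>t. norm \<kappa> * (1 + t)) has_real_derivative norm \<kappa>) (at 0)"
    by (auto intro!: derivative_eq_intros)
  hence "((\<lambda>t. G (norm \<kappa> * (1 + t))) has_real_derivative deriv G (norm \<kappa>) * norm \<kappa>) (at 0)"
    using dG by (intro DERIV_chain2) auto
  hence "((\<lambda>t. complex_of_real (G (norm \<kappa> * (1 + t)))) has_vector_derivative
      complex_of_real (deriv G (norm \<kappa>) * norm \<kappa>)) (at 0)"
    unfolding has_real_derivative_iff_has_vector_derivative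
    by (rule bounded_linear.has_vector_derivative[OF bounded_linear_of_real])
  moreover have "((\<lambda>t. complex_of_real (G (norm \<kappa> * (1 + t)))) has_vector_derivative moment_deriv \<kappa> V lam) (at 0)"
  proof -
    have "norm (\<kappa> + complex_of_real t * \<kappa>) = \<bar>norm \<kappa> * (1 + t)\<bar>" for t
    proof -
      have "\<kappa> + complex_of_real t * \<kappa> = \<kappa> * complex_of_real (1 + t)" by (simp add: algebra_simps)
      thus ?thesis by (simp only: norm_mult norm_of_real abs_mult abs_norm_cancel)
    qed
    thus ?thesis using moment_along_line[OF S, of \<kappa>] by (simp add: G_abs)
  qed
  ultimately show ?thesis by (metis vector_derivative_unique_at mult.commute)
qed

text \<open>The gap gives order \<open>1 / (1 + r)\<close> directly, which is not integrable. The
  radial direction \<open>Hdir m r\<close> is \<open>H r - H 0\<close>, and moving along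
  \<open>H r\<close> itself does not change the projector; so \<open>r * deriv G r\<close> is a
  derivative in the fixed direction \<open>- H 0\<close> and has that same order.\<close>

lemma G_derivative_bound:
  obtains C where "\<And>r. r \<ge> 0 \<Longrightarrow> \<bar>deriv G r\<bar> * (1 + r\<^sup>2) \<le> C"
proof -
  obtain c where c: "c > 0" "\<And>r V lam i. r \<ge> 0 \<Longrightarrow> spectral_decomp (2*m) (H (complex_of_real r)) V lam \<Longrightarrow> i < 2*m \<Longrightarrow>
     c * (1 + r) \<le> \<bar>lam i\<bar>" using uniform_gap by blast
  \<comment> \<open>The factor \<open>m^2\<close> is the sum of the windings; the other square is
    the constant of \<open>proj_deriv_bound\<close>.\<close>
  define K where "K X = (real m)\<^sup>2 * ((real (2*m))\<^sup>2 * entry_norm (2*m) X)" for X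
  have K0: "K X \<ge> 0" for X by (simp add: K_def)
  have bnd: "cmod (moment_deriv d V lam) \<le> K X / (c * (1 + r))"
    if r: "r \<ge> 0" and S: "spectral_decomp (2*m) (H (complex_of_real r)) V lam"
      and X: "X \<in> carrier_mat (2*m) (2*m)"
      and d: "\<And>a. a < 2*m \<Longrightarrow> cmod ((V * proj_deriv (2*m) V lam (Hdir m d) * mat_adjoint V) $$ (a,a))
         = cmod ((V * proj_deriv (2*m) V lam X * mat_adjoint V) $$ (a,a))" for r d V lam X
  proof -
    have pos: "c * (1 + r) > 0" using c r by simp
    have "cmod (moment_deriv d V lam) \<le> (\<Sum>a<2*m. real (winding a) * ((real (2*m))\<^sup>2 * (entry_norm (2*m) X / (c * (1 + r)))))"
      unfolding moment_deriv_def
    proof (rule sum_norm_le)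
      fix a assume "a \<in> {..<2*m}"
      hence a: "a < 2*m" by simp
      have "cmod ((V * proj_deriv (2*m) V lam X * mat_adjoint V) $$ (a,a)) \<le> (real (2*m))\<^sup>2 * (entry_norm (2*m) X / (c * (1 + r)))"
        using c r S pos by (intro proj_deriv_bound[OF S _ _ X a a]) auto
      thus "cmod (complex_of_real (real (winding a)) * (V * proj_deriv (2*m) V lam (Hdir m d) * mat_adjoint V) $$ (a,a))
        \<le> real (winding a) * ((real (2*m))\<^sup>2 * (entry_norm (2*m) X / (c * (1 + r))))"
        unfolding norm_mult d[OF a] norm_of_real by (intro mult_mono) auto
    qed
    also have "\<dots> = (\<Sum>a<2*m. real (winding a)) * ((real (2*m))\<^sup>2 * (entry_norm (2*m) X / (c * (1 + r))))"
      by (rule sum_distrib_right[symmetric])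
    also have "\<dots> = K X / (c * (1 + r))" unfolding sum_winding K_def by simp
    finally show ?thesis .
  qed
  define K1 where "K1 = K (Hdir m 1)"
  define K2 where "K2 = K (H 0)"
  have "\<bar>deriv G r\<bar> * (1 + r\<^sup>2) \<le> (K1 + K2) / c" if r: "r \<ge> 0" for r
  proof -
    obtain V lam where S: "spectral_decomp (2*m) (H (complex_of_real r)) V lam" using Hmat_spectral_decomp by blast
    note D = spectral_decompD[OF S]
    have "deriv G r = Re (moment_deriv 1 V lam)" using G_derivative[OF S] by (rule DERIV_imp_deriv)
    hence "\<bar>deriv G r\<bar> \<le> cmod (moment_deriv 1 V lam)" by (simp add: abs_Re_le_cmod)
    also have "\<dots> \<le> K1 / (c * (1 + r))" unfolding K1_def by (rule bnd[OF r S Hdir_carrier refl])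
    also have "\<dots> \<le> K1 / (c * 1)" using c r K0 by (intro divide_left_mono mult_left_mono) (auto simp: K1_def)
    finally have 1: "\<bar>deriv G r\<bar> \<le> K1 / c" by simp
    have 2: "r * \<bar>deriv G r\<bar> \<le> K2 / (c * (1 + r))"
    proof (cases "r = 0")
      case False
      have "cmod (moment_deriv (complex_of_real r) V lam) \<le> K2 / (c * (1 + r))"
        unfolding K2_def
      proof (rule bnd[OF r S Hmat_carrier])
        fix a assume a: "a < 2*m"
        have "proj_deriv (2*m) V lam (Hdir m (complex_of_real r)) = - proj_deriv (2*m) V lam (H 0)"
          unfolding Hmat_split[symmetric, of m _ \<gamma> v] by (rule proj_deriv_self_diff[OF S Hmat_carrier])
        moreover have "(V * (- Z) * mat_adjoint V) $$ (a,a) = - (V * Z * mat_adjoint V) $$ (a,a)"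
          if "Z \<in> carrier_mat (2*m) (2*m)" for Z
          unfolding triple_mult_index[OF D(2) uminus_carrier_mat[OF that] mat_adjoint_carrier[OF D(2)] a a]
            triple_mult_index[OF D(2) that mat_adjoint_carrier[OF D(2)] a a]
          using that by (auto simp: sum_negf[symmetric] intro!: sum.cong)
        ultimately show "cmod ((V * proj_deriv (2*m) V lam (Hdir m (complex_of_real r)) * mat_adjoint V) $$ (a,a))
          = cmod ((V * proj_deriv (2*m) V lam (H 0) * mat_adjoint V) $$ (a,a))" by (simp del: index_mult_mat(1))
      qed
      moreover have "cmod (moment_deriv (complex_of_real r) V lam) = r * \<bar>deriv G r\<bar>"
        using moment_deriv_radial[OF S] False r by (simp add: norm_mult)
      ultimately show ?thesis by simp
    qed (use K0 c in \<open>simp add: K2_def\<close>)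
    have "r * (r * \<bar>deriv G r\<bar>) \<le> r * (K2 / (c * (1 + r)))" using 2 r by (rule mult_left_mono)
    also have "\<dots> \<le> K2 / c"
    proof -
      have "r * (K2 / (c * (1 + r))) = (r / (1 + r)) * (K2 / c)" by simp
      also have "\<dots> \<le> 1 * (K2 / c)" using r c K0 by (intro mult_right_mono) (auto simp: K2_def)
      finally show ?thesis by simp
    qed
    finally have "r\<^sup>2 * \<bar>deriv G r\<bar> \<le> K2 / c" by (simp add: power2_eq_square mult.assoc)
    thus ?thesis using 1 by (simp add: algebra_simps add_divide_distrib)
  qed
  thus ?thesis using that by blast
qed

text \<open>Dividing the Hamiltonian by \<open>r\<close> keeps the projector and leaves
  \<open>Hdir m 1\<close> plus a term of order 1/r. The Lipschitz estimate uses the gap 1 of the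
  limit.\<close>

lemma G_limit: "(G \<longlongrightarrow> (real m)\<^sup>2 / 2) at_top"
proof -
  obtain V lam where S: "spectral_decomp (2*m) (Hdir m 1) V lam"
    using hermitian_spectral_decomp[OF Hdir_carrier Hdir_hermitian] by blast
  define B where "B r = complex_of_real (inverse r) \<cdot>\<^sub>m H (complex_of_real r)" for r
  have B: "B r \<in> carrier_mat (2*m) (2*m)" for r by (simp add: B_def)
  have bd: "cmod (neg_proj (H (complex_of_real r)) $$ (a,a) - 1/2) \<le> real (2*m) ^ 3 * entry_norm (2*m) (H 0) * inverse r"
    if r: "r > 0" and a: "a < 2*m" for r a
  proof -
    obtain W mu where T: "spectral_decomp (2*m) (H (complex_of_real r)) W mu" using Hmat_spectral_decomp by blast
    have BT: "B r $$ (i,j) = complex_of_real (inverse r) * 1 * cnj 1 * H (complex_of_real r) $$ (i,j)"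
      if "i < 2*m" "j < 2*m" for i j
      using that carrier_matD[OF Hmat_carrier] by (simp add: B_def)
    note T' = spectral_decomp_diag_conj[OF T B, where ph = "\<lambda>_. 1", OF _ BT, simplified]
    have "neg_proj (B r) $$ (a,a) = neg_proj (H (complex_of_real r)) $$ (a,a)"
      by (rule neg_proj_diag_conj[OF T B, where ph = "\<lambda>_. 1", OF _ BT _ a]) (use r in auto)
    hence "cmod (neg_proj (H (complex_of_real r)) $$ (a,a) - 1 / 2) = cmod (neg_proj (B r) $$ (a,a) - neg_proj (Hdir m 1) $$ (a,a))"
      unfolding neg_proj_Hdir_diag[OF a] by simp
    also have "\<dots> \<le> real (2*m) ^ 3 * (entry_norm (2*m) (Hdir m 1 - B r) / 1)"
      by (rule neg_proj_lipschitz[OF S T' _ _ a a]) (use Hdir_eigenvalues[OF S] in auto)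
    also have "entry_norm (2*m) (Hdir m 1 - B r) = entry_norm (2*m) (H 0) * inverse r"
      unfolding entry_norm_def sum_distrib_right
    proof (intro sum.cong refl)
      fix i j assume "i \<in> {..<2*m}" "j \<in> {..<2*m}"
      hence ij: "i < 2*m" "j < 2*m" by auto
      have "(Hdir m 1 - B r) $$ (i,j) = - complex_of_real (inverse r) * H 0 $$ (i,j)"
        using ij r carrier_matD[OF Hmat_carrier] carrier_matD[OF Hdir_carrier]
        by (auto simp: B_def Hmat_index Hdir_index)
      thus "cmod ((Hdir m 1 - B r) $$ (i,j)) = cmod (H 0 $$ (i,j)) * inverse r"
        using r by (simp only: norm_mult norm_minus_cancel norm_of_real) simp
    qed
    finally show ?thesis by (simp add: mult.assoc)
  qed
  have lim: "((\<lambda>r. neg_proj (H (complex_of_real r)) $$ (a,a)) \<longlongrightarrow> 1/2) at_top" if a: "a < 2*m" for a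
  proof -
    have "((\<lambda>r. neg_proj (H (complex_of_real r)) $$ (a,a) - 1/2) \<longlongrightarrow> 0) at_top"
    proof (rule Lim_null_comparison)
      show "\<forall>\<^sub>F r in at_top. cmod (neg_proj (H (complex_of_real r)) $$ (a,a) - 1/2)
          \<le> real (2*m) ^ 3 * entry_norm (2*m) (H 0) * inverse r"
        using eventually_gt_at_top[of 0] by eventually_elim (use bd a in auto)
      show "((\<lambda>r. real (2*m) ^ 3 * entry_norm (2*m) (H 0) * inverse r) \<longlongrightarrow> 0) at_top"
        by (intro tendsto_mult_right_zero tendsto_inverse_0_at_top filterlim_ident)
    qed
    thus ?thesis by (simp add: LIM_zero_iff)
  qed
  have "(G \<longlongrightarrow> (\<Sum>a<2*m. real (winding a) * Re (1/2))) at_top"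
    unfolding occupied_moment_def by (intro tendsto_intros lim) auto
  also have "(\<Sum>a<2*m. real (winding a) * Re (1/2)) = (real m)\<^sup>2 / 2"
    unfolding sum_distrib_right[symmetric] sum_winding by simp
  finally show ?thesis .
qed

text \<open>Away from the origin, a null set, the integrand is \<open>\<i>\<close> times a radial
  function. The two factors \<open>\<i>\<close> give -1, which turns the boundary difference into
  the value at zero minus the value at infinity.\<close>

theorem chern_eq: "chern (2*m) (\<lambda>\<kappa>. neg_proj (H \<kappa>)) = complex_of_real (G 0 - (real m)\<^sup>2 / 2)"
proof -
  define F where "F \<kappa> = mtrace (neg_proj (H \<kappa>) *
      (mat_dderiv (2*m) (\<lambda>\<kappa>. neg_proj (H \<kappa>)) \<kappa> 1 * mat_dderiv (2*m) (\<lambda>\<kappa>. neg_proj (H \<kappa>)) \<kappa> \<i>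
      - mat_dderiv (2*m) (\<lambda>\<kappa>. neg_proj (H \<kappa>)) \<kappa> \<i> * mat_dderiv (2*m) (\<lambda>\<kappa>. neg_proj (H \<kappa>)) \<kappa> 1))" for \<kappa>
  have F: "F \<kappa> = \<i> * complex_of_real (deriv G (norm \<kappa>) / norm \<kappa>)" if nz: "\<kappa> \<noteq> 0" for \<kappa>
  proof -
    obtain V lam where S: "spectral_decomp (2*m) (H \<kappa>) V lam" using Hmat_spectral_decomp by blast
    note D = spectral_decompD[OF S]
    have dd: "mat_dderiv (2*m) (\<lambda>\<kappa>. neg_proj (H \<kappa>)) \<kappa> d = V * proj_deriv (2*m) V lam (Hdir m d) * mat_adjoint V" for d
    proof (rule eq_matI)
      fix i j assume "i < dim_row (V * proj_deriv (2*m) V lam (Hdir m d) * mat_adjoint V)"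
        "j < dim_col (V * proj_deriv (2*m) V lam (Hdir m d) * mat_adjoint V)"
      hence ij: "i < 2*m" "j < 2*m" using D(2) by auto
      show "mat_dderiv (2*m) (\<lambda>\<kappa>. neg_proj (H \<kappa>)) \<kappa> d $$ (i,j) = (V * proj_deriv (2*m) V lam (Hdir m d) * mat_adjoint V) $$ (i,j)"
        using vector_derivative_at[OF neg_proj_H_derivative[OF S ij, of d]] ij by (simp add: mat_dderiv_def)
    qed (use D(2) in \<open>auto simp: mat_dderiv_def\<close>)
    have "complex_of_real ((Re \<kappa>)\<^sup>2 + (Im \<kappa>)\<^sup>2) * F \<kappa> = \<i> * (\<Sum>a<2*m. complex_of_real (real (winding a)) *
       (complex_of_real (Re \<kappa>) * (V * proj_deriv (2*m) V lam (Hdir m 1) * mat_adjoint V) $$ (a,a)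
        + complex_of_real (Im \<kappa>) * (V * proj_deriv (2*m) V lam (Hdir m \<i>) * mat_adjoint V) $$ (a,a)))"
      unfolding F_def dd
      by (rule curvature_trace[OF S Hdir_carrier Hdir_carrier]) (rule Hmat_rotation_generator)
    also have "\<dots> = \<i> * moment_deriv \<kappa> V lam"
      unfolding moment_deriv_def
    proof (intro arg_cong[where f = "(*) \<i>"] sum.cong refl arg_cong2[where f = "(*)"])
      fix a assume "a \<in> {..<2*m}"
      hence a: "a < 2*m" by simp
      show "complex_of_real (Re \<kappa>) * (V * proj_deriv (2*m) V lam (Hdir m 1) * mat_adjoint V) $$ (a,a)
        + complex_of_real (Im \<kappa>) * (V * proj_deriv (2*m) V lam (Hdir m \<i>) * mat_adjoint V) $$ (a,a)
        = (V * proj_deriv (2*m) V lam (Hdir m \<kappa>) * mat_adjoint V) $$ (a,a)"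
        by (rule proj_deriv_linear[OF D(2) Hdir_carrier Hdir_carrier Hdir_carrier _ a a, symmetric])
          (auto simp: Hdir_index complex_eq_iff)
    qed
    also have "\<dots> = \<i> * complex_of_real (norm \<kappa> * deriv G (norm \<kappa>))"
      using moment_deriv_radial[OF S nz] by simp
    finally have e: "complex_of_real ((norm \<kappa>)\<^sup>2) * F \<kappa> = \<i> * complex_of_real (norm \<kappa> * deriv G (norm \<kappa>))"
      by (simp only: cmod_power2)
    have n0: "complex_of_real ((norm \<kappa>)\<^sup>2) \<noteq> 0" using nz by simp
    have "complex_of_real ((norm \<kappa>)\<^sup>2) * (\<i> * complex_of_real (deriv G (norm \<kappa>) / norm \<kappa>))
      = \<i> * complex_of_real ((norm \<kappa>)\<^sup>2 * (deriv G (norm \<kappa>) / norm \<kappa>))" by simp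
    also have "(norm \<kappa>)\<^sup>2 * (deriv G (norm \<kappa>) / norm \<kappa>) = norm \<kappa> * deriv G (norm \<kappa>)"
      using nz by (simp add: power2_eq_square)
    finally show ?thesis using e n0 by (metis mult_left_cancel)
  qed
  obtain C where C: "\<And>r. r \<ge> 0 \<Longrightarrow> \<bar>deriv G r\<bar> * (1 + r\<^sup>2) \<le> C" using G_derivative_bound by blast
  have dG: "(G has_real_derivative deriv G r) (at r)" for r
  proof -
    obtain V lam where "spectral_decomp (2*m) (H (complex_of_real r)) V lam" using Hmat_spectral_decomp by blast
    thus ?thesis using G_derivative by (metis DERIV_imp_deriv)
  qed
  have "((\<lambda>\<kappa>::complex. deriv G (norm \<kappa>) / norm \<kappa>) has_integral 2 * pi * ((real m)\<^sup>2 / 2 - G 0)) UNIV"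
    by (rule radial_derivative_has_integral[OF dG C G_limit])
  hence "((\<lambda>\<kappa>::complex. \<i> * complex_of_real (deriv G (norm \<kappa>) / norm \<kappa>)) has_integral
      \<i> * complex_of_real (2 * pi * ((real m)\<^sup>2 / 2 - G 0))) UNIV"
    by (intro has_integral_mult_right has_integral_of_real)
  hence "(F has_integral \<i> * complex_of_real (2 * pi * ((real m)\<^sup>2 / 2 - G 0))) UNIV"
    by (rule has_integral_spike[OF negligible_sing[of 0], rotated]) (use F in auto)
  hence "integral UNIV F = \<i> * complex_of_real (2 * pi * ((real m)\<^sup>2 / 2 - G 0))" by (rule integral_unique)
  hence "chern (2*m) (\<lambda>\<kappa>. neg_proj (H \<kappa>))
     = \<i> / (2 * complex_of_real pi) * (\<i> * complex_of_real (2 * pi * ((real m)\<^sup>2 / 2 - G 0)))"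
    unfolding chern_def F_def[abs_def] by simp
  also have "\<dots> = complex_of_real (G 0 - (real m)\<^sup>2 / 2)"
    by (simp add: field_simps)
  finally show ?thesis .
qed

end

section \<open>The Hamiltonian at zero wave vector\<close>

lemma sum_two_terms:
  fixes f :: "nat \<Rightarrow> 'a::comm_monoid_add"
  assumes "a < n" "b < n" "a \<noteq> b" "\<And>k. k < n \<Longrightarrow> k \<noteq> a \<Longrightarrow> k \<noteq> b \<Longrightarrow> f k = 0"
  shows "(\<Sum>k<n. f k) = f a + f b"
proof -
  have "(\<Sum>k<n. f k) = (\<Sum>k\<in>{a,b}. f k)" using assms by (intro sum.mono_neutral_right) auto
  thus ?thesis using assms by simp
qed

lemma sum_one_term:
  fixes f :: "nat \<Rightarrow> 'a::comm_monoid_add"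
  assumes "a < n" "\<And>k. k < n \<Longrightarrow> k \<noteq> a \<Longrightarrow> f k = 0"
  shows "(\<Sum>k<n. f k) = f a"
proof -
  have "(\<Sum>k<n. f k) = (\<Sum>k\<in>{a}. f k)" using assms by (intro sum.mono_neutral_right) auto
  thus ?thesis by simp
qed

text \<open>At \<open>\<kappa> = 0\<close> the Hamiltonian splits into two one-dimensional blocks and, for \<open>0 < p < m\<close>, the block
  on the indices \<open>2*p - 1\<close> and \<open>2*p\<close>, which is \<open>\<Delta> * (p - m/2)\<close> plus a matrix that does not
  depend on \<open>p\<close>; so one rotation diagonalises all of them.\<close>

definition block_eigenvalue :: "nat \<Rightarrow> real \<Rightarrow> real \<Rightarrow> nat \<Rightarrow> real" where
  "block_eigenvalue m \<gamma> v k = (let \<Delta> = v / (real m - 1); \<rho> = sqrt (\<Delta>\<^sup>2 / 4 + \<gamma>\<^sup>2) in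
     if k = 0 then layer_energy m v 0 else if k = 2*m - 1 then layer_energy m v (m - 1)
     else \<Delta> * (real (winding k) - real m / 2) + (if odd k then - \<rho> else \<rho>))"

definition block_rotation :: "nat \<Rightarrow> real \<Rightarrow> real \<Rightarrow> complex mat" where
  "block_rotation m c s = mat (2*m) (2*m) (\<lambda>(i,j).
     if i = j then (if i = 0 \<or> i = 2*m - 1 then 1 else complex_of_real c)
     else if j = i + 1 \<and> odd i then complex_of_real s
     else if i = j + 1 \<and> odd j then - complex_of_real s else 0)"

lemma block_rotation_index:
  "i < 2*m \<Longrightarrow> j < 2*m \<Longrightarrow> block_rotation m c s $$ (i,j) =
    (if i = j then (if i = 0 \<or> i = 2*m - 1 then 1 else complex_of_real c)
     else if j = i + 1 \<and> odd i then complex_of_real s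
     else if i = j + 1 \<and> odd j then - complex_of_real s else 0)"
  by (simp add: block_rotation_def)

text \<open>Here \<open>p\<close> counts from zero: the indices \<open>2*p+1\<close> and
  \<open>2*p+2\<close> form the block of winding \<open>p + 1\<close>.\<close>

lemma block_index_cases:
  fixes i m :: nat
  assumes "i < 2*m"
  obtains "i = 0" | "i = 2*m - 1" "i \<noteq> 0" | p where "i = 2*p + 1" "p + 1 < m" | p where "i = 2*p + 2" "p + 1 < m"
proof (cases "even i")
  case True
  then obtain q where q: "i = 2 * q" by blast
  show ?thesis using q assms that by (cases q) auto
next
  case False
  then obtain q where q: "i = 2 * q + 1" by (blast elim: oddE)
  show ?thesis using q assms that by (cases "q + 1 = m") auto
qed

lemma block_rotation_block:
  assumes p: "p + 1 < m" and j: "j < 2*m"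
  shows "block_rotation m c s $$ (2*p+1,j) = (if j = 2*p+1 then complex_of_real c else if j = 2*p+2 then complex_of_real s else 0)"
    and "block_rotation m c s $$ (2*p+2,j) = (if j = 2*p+1 then - complex_of_real s else if j = 2*p+2 then complex_of_real c else 0)"
    and "block_rotation m c s $$ (j,2*p+1) = (if j = 2*p+1 then complex_of_real c else if j = 2*p+2 then - complex_of_real s else 0)"
    and "block_rotation m c s $$ (j,2*p+2) = (if j = 2*p+1 then complex_of_real s else if j = 2*p+2 then complex_of_real c else 0)"
proof -
  have l: "2*p+1 < 2*m" "2*p+2 < 2*m" using p by auto
  have n: "2*p+1 \<noteq> 2*m - 1" "2*p+2 \<noteq> 2*m - 1" using p by linarith presburger
  have e: "2*p+2 = j+1 \<longleftrightarrow> j = 2*p+1" "j = 2*p+2+1 \<longleftrightarrow> j = 2*p+3" "2*p+1 = j+1 \<longleftrightarrow> j = 2*p" "j = 2*p+1+1 \<longleftrightarrow> j = 2*p+2"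
    by auto
  have o: "odd (2*p+1)" "even (2*p+2)" "even (2*p)" "odd (2*p+3)" "2*p+1 \<noteq> 0" "2*p+2 \<noteq> 0" by auto
  show "block_rotation m c s $$ (2*p+1,j) = (if j = 2*p+1 then complex_of_real c else if j = 2*p+2 then complex_of_real s else 0)"
    unfolding block_rotation_index[OF l(1) j] e using n o by (cases "j = 2*p+1"; cases "j = 2*p"; cases "j = 2*p+2") simp_all
  show "block_rotation m c s $$ (2*p+2,j) = (if j = 2*p+1 then - complex_of_real s else if j = 2*p+2 then complex_of_real c else 0)"
    unfolding block_rotation_index[OF l(2) j] e using n o by (cases "j = 2*p+1"; cases "j = 2*p+3"; cases "j = 2*p+2") simp_all
  show "block_rotation m c s $$ (j,2*p+1) = (if j = 2*p+1 then complex_of_real c else if j = 2*p+2 then - complex_of_real s else 0)"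
    unfolding block_rotation_index[OF j l(1)] e using n o by (cases "j = 2*p+1"; cases "j = 2*p"; cases "j = 2*p+2") simp_all
  show "block_rotation m c s $$ (j,2*p+2) = (if j = 2*p+1 then complex_of_real s else if j = 2*p+2 then complex_of_real c else 0)"
    unfolding block_rotation_index[OF j l(2)] e using n o by (cases "j = 2*p+1"; cases "j = 2*p+3"; cases "j = 2*p+2") simp_all
qed

lemma block_rotation_last:
  assumes k: "k < 2*m"
  shows "block_rotation m c s $$ (k,2*m-1) = (if k = 2*m-1 then 1 else 0)"
    and "block_rotation m c s $$ (2*m-1,k) = (if k = 2*m-1 then 1 else 0)"
proof -
  define i where "i = 2*m - 1"
  have i: "i < 2*m" "odd i" using k by (auto simp: i_def)
  have "\<not> (i = k + 1 \<and> odd k)" using i by auto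
  moreover have "k \<noteq> i + 1" using k by (auto simp: i_def)
  ultimately show "block_rotation m c s $$ (k,2*m-1) = (if k = 2*m-1 then 1 else 0)"
      "block_rotation m c s $$ (2*m-1,k) = (if k = 2*m-1 then 1 else 0)"
    unfolding i_def[symmetric] block_rotation_index[OF k i(1)] block_rotation_index[OF i(1) k] by auto
qed

lemma Hmat_zero_block:
  assumes p: "p + 1 < m" and j: "j < 2*m"
  shows "Hmat m \<gamma> v 0 $$ (2*p+1,j) = (if j = 2*p+1 then complex_of_real (layer_energy m v p) else if j = 2*p+2 then complex_of_real \<gamma> else 0)"
    and "Hmat m \<gamma> v 0 $$ (2*p+2,j) = (if j = 2*p+1 then complex_of_real \<gamma> else if j = 2*p+2 then complex_of_real (layer_energy m v (p+1)) else 0)"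
proof -
  have l: "2*p+1 < 2*m" "2*p+2 < 2*m" using p by auto
  have e: "2*p+2 = j+1 \<longleftrightarrow> j = 2*p+1" "j = 2*p+2+1 \<longleftrightarrow> j = 2*p+3" "2*p+1 = j+1 \<longleftrightarrow> j = 2*p" "j = 2*p+1+1 \<longleftrightarrow> j = 2*p+2"
    "(2*p+1) div 2 = p" "(2*p+2) div 2 = p+1"
    by auto
  have o: "odd (2*p+1)" "even (2*p+2)" "even (2*p)" "odd (2*p+3)" by auto
  show "Hmat m \<gamma> v 0 $$ (2*p+1,j) = (if j = 2*p+1 then complex_of_real (layer_energy m v p) else if j = 2*p+2 then complex_of_real \<gamma> else 0)"
    unfolding Hmat_index[OF l(1) j] e using o by (cases "j = 2*p+1"; cases "j = 2*p"; cases "j = 2*p+2") simp_all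
  show "Hmat m \<gamma> v 0 $$ (2*p+2,j) = (if j = 2*p+1 then complex_of_real \<gamma> else if j = 2*p+2 then complex_of_real (layer_energy m v (p+1)) else 0)"
    unfolding Hmat_index[OF l(2) j] e using o by (cases "j = 2*p+1"; cases "j = 2*p+3"; cases "j = 2*p+2") simp_all
qed

text \<open>Apart from its mean, each block is the matrix with diagonal \<open>-\<Delta>/2\<close>,
  \<open>\<Delta>/2\<close> and off-diagonal \<open>\<gamma>\<close>, whose eigenvalues are plus and
  minus \<open>\<rho>\<close>.\<close>

lemma block_rotation_diagonalises:
  assumes m: "m \<ge> 2" and \<gamma>: "\<gamma> \<noteq> 0"
  shows "\<exists>c s. spectral_decomp (2*m) (Hmat m \<gamma> v 0) (block_rotation m c s) (block_eigenvalue m \<gamma> v)"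
proof -
  define \<Delta> where "\<Delta> = v / (real m - 1)"
  define \<rho> where "\<rho> = sqrt (\<Delta>\<^sup>2 / 4 + \<gamma>\<^sup>2)"
  \<comment> \<open>The vector \<open>(\<rho> - \<Delta>/2, \<gamma>)\<close> belongs to the
    eigenvalue \<open>\<rho>\<close>; \<open>N\<close> is its length and \<open>(s, c)\<close> its
    normalisation. \<open>E1\<close> and \<open>E2\<close> are the two rows of that eigenvalue
    equation.\<close>
  define N where "N = sqrt (\<gamma>\<^sup>2 + (\<rho> - \<Delta> / 2)\<^sup>2)"
  define c where "c = \<gamma> / N"
  define s where "s = (\<rho> - \<Delta> / 2) / N"
  have N: "N > 0" using \<gamma> by (simp add: N_def add_pos_nonneg)
  have N2: "N\<^sup>2 = \<gamma>\<^sup>2 + (\<rho> - \<Delta> / 2)\<^sup>2" by (simp add: N_def)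
  have rho2: "\<rho>\<^sup>2 = \<Delta>\<^sup>2 / 4 + \<gamma>\<^sup>2" by (simp add: \<rho>_def)
  have cs: "c * c + s * s = 1"
  proof -
    have "c * c + s * s = (\<gamma>\<^sup>2 + (\<rho> - \<Delta> / 2)\<^sup>2) / N\<^sup>2"
      by (simp add: c_def s_def power2_eq_square add_divide_distrib)
    thus ?thesis unfolding N2[symmetric] using N by simp
  qed
  have E1: "\<Delta> / 2 * c + \<gamma> * s = \<rho> * c" using N by (simp add: c_def s_def field_simps)
  have E2: "\<gamma> * c - \<Delta> / 2 * s = \<rho> * s"
  proof -
    have "\<gamma> * \<gamma> - \<Delta> / 2 * (\<rho> - \<Delta> / 2) = \<rho> * (\<rho> - \<Delta> / 2)"
      using rho2 by (simp add: power2_eq_square algebra_simps)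
    moreover have "\<gamma> * c - \<Delta> / 2 * s = (\<gamma> * \<gamma> - \<Delta> / 2 * (\<rho> - \<Delta> / 2)) / N"
      by (simp add: c_def s_def diff_divide_distrib[of "\<gamma> * \<gamma>"])
    ultimately show ?thesis by (simp add: s_def)
  qed
  let ?V = "block_rotation m c s" and ?H = "Hmat m \<gamma> v 0" and ?l = "block_eigenvalue m \<gamma> v"
  have V: "?V \<in> carrier_mat (2*m) (2*m)" and V': "mat_adjoint ?V \<in> carrier_mat (2*m) (2*m)"
    by (simp_all add: block_rotation_def)
  have m0: "2*m - 1 \<noteq> 0" "odd (2*m - 1)" "2*m - 1 < 2*m" using m by auto
  have csc: "complex_of_real c * complex_of_real c + complex_of_real s * complex_of_real s = 1"
    using cs by (metis of_real_1 of_real_add of_real_mult)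
  have U: "mat_adjoint ?V * ?V = 1\<^sub>m (2*m)"
  proof (rule eq_matI)
    fix i j assume "i < dim_row (1\<^sub>m (2*m))" "j < dim_col (1\<^sub>m (2*m))"
    hence ij: "i < 2*m" "j < 2*m" by auto
    have "(mat_adjoint ?V * ?V) $$ (i,j) = (\<Sum>k<2*m. cnj (?V $$ (k,i)) * ?V $$ (k,j))"
      unfolding mult_mat_index[OF V' V ij] using ij by (intro sum.cong) (auto simp: mat_adjoint_index[OF V])
    also have "\<dots> = (if i = j then 1 else 0)"
      using ij(1)
    proof (cases i rule: block_index_cases)
      case 1
      have "(\<Sum>k<2*m. cnj (?V $$ (k,i)) * ?V $$ (k,j)) = cnj (?V $$ (0,i)) * ?V $$ (0,j)"
        using ij 1 m by (intro sum_one_term) (auto simp: block_rotation_index)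
      thus ?thesis using 1 ij m by (auto simp: block_rotation_index)
    next
      case 2
      have ck: "?V $$ (k,i) = (if k = i then 1 else 0)" "?V $$ (i,k) = (if k = i then 1 else 0)" if "k < 2*m" for k
        unfolding 2(1) by (rule block_rotation_last[OF that])+
      have "(\<Sum>k<2*m. cnj (?V $$ (k,i)) * ?V $$ (k,j)) = cnj (?V $$ (i,i)) * ?V $$ (i,j)"
        using ij ck(1) by (intro sum_one_term) auto
      thus ?thesis using ck(2)[OF ij(2)] ck(1)[OF ij(1)] by simp
    next
      case (3 p)
      have l: "2*p+1 < 2*m" "2*p+2 < 2*m" "2*p+1 \<noteq> 2*p+2" using 3 by auto
      have "(\<Sum>k<2*m. cnj (?V $$ (k,i)) * ?V $$ (k,j))
          = cnj (?V $$ (2*p+1,i)) * ?V $$ (2*p+1,j) + cnj (?V $$ (2*p+2,i)) * ?V $$ (2*p+2,j)"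
        unfolding 3(1) using block_rotation_block(3)[OF 3(2)] by (intro sum_two_terms l) simp
      thus ?thesis unfolding 3(1) using block_rotation_block[OF 3(2)] ij(2) l csc by auto
    next
      case (4 p)
      have l: "2*p+1 < 2*m" "2*p+2 < 2*m" "2*p+1 \<noteq> 2*p+2" using 4 by auto
      have "(\<Sum>k<2*m. cnj (?V $$ (k,i)) * ?V $$ (k,j))
          = cnj (?V $$ (2*p+1,i)) * ?V $$ (2*p+1,j) + cnj (?V $$ (2*p+2,i)) * ?V $$ (2*p+2,j)"
        unfolding 4(1) using block_rotation_block(4)[OF 4(2)] by (intro sum_two_terms l) simp
      thus ?thesis unfolding 4(1) using block_rotation_block[OF 4(2)] ij(2) l csc by (auto simp: add.commute)
    qed
    finally show "(mat_adjoint ?V * ?V) $$ (i,j) = (1\<^sub>m (2*m)) $$ (i,j)" using ij by simp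
  qed (use V in auto)
  \<comment> \<open>Read at layers \<open>p\<close> and \<open>p + 1\<close> respectively, the two
    forms show the same mean with offsets \<open>-\<Delta>/2\<close> and
    \<open>\<Delta>/2\<close>.\<close>
  have en1: "layer_energy m v p = \<Delta> * (real (p + 1) - real m / 2) - \<Delta> / 2" for p
    unfolding layer_energy_def \<Delta>_def[symmetric] by (simp add: field_simps)
  have en2: "layer_energy m v p = \<Delta> * (real p - real m / 2) + \<Delta> / 2" for p
    unfolding layer_energy_def \<Delta>_def[symmetric] by (simp add: field_simps)
  have lodd: "?l (2*p+1) = \<Delta> * (real (p+1) - real m / 2) - \<rho>" if "p + 1 < m" for p
  proof -
    have "2*p + 1 \<noteq> 2*m - 1" using that by linarith
    thus ?thesis by (simp add: block_eigenvalue_def Let_def \<Delta>_def[symmetric] \<rho>_def[symmetric] winding_def)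
  qed
  have leven: "?l (2*p+2) = \<Delta> * (real (p+1) - real m / 2) + \<rho>" if "p + 1 < m" for p
  proof -
    have "2*p + 2 \<noteq> 2*m - 1" by presburger
    thus ?thesis by (simp add: block_eigenvalue_def Let_def \<Delta>_def[symmetric] \<rho>_def[symmetric] winding_def)
  qed
  have HV: "?H * ?V = ?V * real_diag (2*m) ?l"
  proof (rule eq_matI)
    fix i j assume "i < dim_row (?V * real_diag (2*m) ?l)" "j < dim_col (?V * real_diag (2*m) ?l)"
    hence ij: "i < 2*m" "j < 2*m" using V by (auto simp: real_diag_def)
    have "(\<Sum>k<2*m. ?H $$ (i,k) * ?V $$ (k,j)) = ?V $$ (i,j) * complex_of_real (?l j)"
      using ij(1)
    proof (cases i rule: block_index_cases)
      case 1
      have "(\<Sum>k<2*m. ?H $$ (i,k) * ?V $$ (k,j)) = ?H $$ (i,0) * ?V $$ (0,j)"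
        using ij 1 m by (intro sum_one_term) (auto simp: Hmat_index)
      thus ?thesis using 1 ij m by (auto simp: block_rotation_index Hmat_index block_eigenvalue_def)
    next
      case 2
      have oi: "odd i" using 2(1) m0(2) by simp
      have "(\<Sum>k<2*m. ?H $$ (i,k) * ?V $$ (k,j)) = ?H $$ (i,i) * ?V $$ (i,j)"
      proof (intro sum_one_term ij)
        fix k assume k: "k < 2*m" "k \<noteq> i"
        have "\<not> (i = k + 1 \<and> odd k)" using oi by auto
        moreover have "k \<noteq> i + 1" using k 2(1) by auto
        ultimately have "?H $$ (i,k) = 0" unfolding Hmat_index[OF ij(1) k(1)] using k(2) by auto
        thus "?H $$ (i,k) * ?V $$ (k,j) = 0" by simp
      qed
      moreover have "?H $$ (i,i) = complex_of_real (layer_energy m v (m - 1))"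
      proof -
        have "i div 2 = m - 1" using 2 m by auto
        thus ?thesis unfolding Hmat_index[OF ij(1) ij(1)] by simp
      qed
      moreover have "?V $$ (i,j) = (if j = i then 1 else 0)"
        unfolding 2(1) by (rule block_rotation_last[OF ij(2)])
      moreover have "?l i = layer_energy m v (m - 1)"
        using 2(2) unfolding 2(1) by (simp add: block_eigenvalue_def)
      ultimately show ?thesis by simp
    next
      case (3 p)
      have l: "2*p+1 < 2*m" "2*p+2 < 2*m" "2*p+1 \<noteq> 2*p+2" using 3 by auto
      have e: "(\<Sum>k<2*m. ?H $$ (i,k) * ?V $$ (k,j))
          = ?H $$ (i,2*p+1) * ?V $$ (2*p+1,j) + ?H $$ (i,2*p+2) * ?V $$ (2*p+2,j)"
        unfolding 3(1) using Hmat_zero_block(1)[OF 3(2)] by (intro sum_two_terms l) simp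
      have "layer_energy m v p * c - \<gamma> * s = c * ?l (2*p+1)" "layer_energy m v p * s + \<gamma> * c = s * ?l (2*p+2)"
        unfolding lodd[OF 3(2)] leven[OF 3(2)] en1 using E1 E2 by (simp_all add: algebra_simps)
      hence "complex_of_real (layer_energy m v p) * complex_of_real c - complex_of_real \<gamma> * complex_of_real s
            = complex_of_real c * complex_of_real (?l (2*p+1))"
          "complex_of_real (layer_energy m v p) * complex_of_real s + complex_of_real \<gamma> * complex_of_real c
            = complex_of_real s * complex_of_real (?l (2*p+2))"
        by (simp_all flip: of_real_mult of_real_diff of_real_add)
      thus ?thesis unfolding e unfolding 3(1)
        using block_rotation_block[OF 3(2) ij(2)] Hmat_zero_block[OF 3(2)] l by simp
    next
      case (4 p)
      have l: "2*p+1 < 2*m" "2*p+2 < 2*m" "2*p+1 \<noteq> 2*p+2" using 4 by auto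
      have e: "(\<Sum>k<2*m. ?H $$ (i,k) * ?V $$ (k,j))
          = ?H $$ (i,2*p+1) * ?V $$ (2*p+1,j) + ?H $$ (i,2*p+2) * ?V $$ (2*p+2,j)"
        unfolding 4(1) using Hmat_zero_block(2)[OF 4(2)] by (intro sum_two_terms l) simp
      have "layer_energy m v (p+1) * c + \<gamma> * s = c * ?l (2*p+2)" "\<gamma> * c - layer_energy m v (p+1) * s = - s * ?l (2*p+1)"
        unfolding lodd[OF 4(2)] leven[OF 4(2)] en2 using E1 E2 by (simp_all add: algebra_simps)
      hence "complex_of_real (layer_energy m v (p+1)) * complex_of_real c + complex_of_real \<gamma> * complex_of_real s
            = complex_of_real c * complex_of_real (?l (2*p+2))"
          "complex_of_real \<gamma> * complex_of_real c - complex_of_real (layer_energy m v (p+1)) * complex_of_real s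
            = - complex_of_real s * complex_of_real (?l (2*p+1))"
        by (simp_all flip: of_real_mult of_real_diff of_real_add of_real_minus)
      thus ?thesis unfolding e unfolding 4(1)
        using block_rotation_block[OF 4(2) ij(2)] Hmat_zero_block[OF 4(2)] l by (simp add: add.commute)
    qed
    thus "(?H * ?V) $$ (i,j) = (?V * real_diag (2*m) ?l) $$ (i,j)"
      unfolding mult_mat_index[OF Hmat_carrier V ij] real_diag_mult_right_index[OF V ij] .
  qed (use V in \<open>auto simp: real_diag_def Hmat_def\<close>)
  have "spectral_decomp (2*m) ?H ?V ?l" using U HV V by (simp add: spectral_decomp_def)
  thus ?thesis by blast
qed

text \<open>The rotation mixes only indices of equal winding, so a weight can be moved from the row
  to the column, and the columns have length one.\<close>

lemma occupied_moment_zero: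
  assumes m: "m \<ge> 2" and \<gamma>: "\<gamma> \<noteq> 0"
  shows "occupied_moment m \<gamma> v 0 = (\<Sum>k<2*m. real (winding k) * neg_ind (block_eigenvalue m \<gamma> v) k)"
proof -
  obtain c s where S: "spectral_decomp (2*m) (Hmat m \<gamma> v 0) (block_rotation m c s) (block_eigenvalue m \<gamma> v)"
    using block_rotation_diagonalises[OF assms] by blast
  let ?V = "block_rotation m c s" and ?p = "neg_ind (block_eigenvalue m \<gamma> v)"
  note D = spectral_decompD[OF S]
  have col: "(\<Sum>a<2*m. (cmod (?V $$ (a,k)))\<^sup>2) = 1" if k: "k < 2*m" for k
  proof -
    have V': "mat_adjoint ?V \<in> carrier_mat (2*m) (2*m)" using D(2) by simp
    have "complex_of_real (\<Sum>a<2*m. (cmod (?V $$ (a,k)))\<^sup>2) = (mat_adjoint ?V * ?V) $$ (k,k)"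
      unfolding mult_mat_index[OF V' D(2) k k] using k
      by (auto simp: mat_adjoint_index[OF D(2)] mult.commute simp flip: complex_norm_square intro!: sum.cong)
    also have "\<dots> = complex_of_real 1" using D(3) k by simp
    finally show ?thesis unfolding of_real_eq_iff .
  qed
  have w: "real (winding a) * (cmod (?V $$ (a,k)))\<^sup>2 = real (winding k) * (cmod (?V $$ (a,k)))\<^sup>2"
    if "a < 2*m" "k < 2*m" for a k
  proof -
    have "winding a = winding k" if "?V $$ (a,k) \<noteq> 0"
      using that \<open>a < 2*m\<close> \<open>k < 2*m\<close>
      by (auto simp: block_rotation_index winding_def split: if_splits elim!: oddE)
    thus ?thesis by (cases "?V $$ (a,k) = 0") auto
  qed
  have "occupied_moment m \<gamma> v 0 = (\<Sum>a<2*m. real (winding a) * (\<Sum>k<2*m. ?p k * (cmod (?V $$ (a,k)))\<^sup>2))"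
    unfolding occupied_moment_def of_real_0 using neg_proj_diag[OF S]
    by (intro sum.cong refl) (simp del: of_real_sum)
  also have "\<dots> = (\<Sum>a<2*m. \<Sum>k<2*m. ?p k * (real (winding a) * (cmod (?V $$ (a,k)))\<^sup>2))"
    by (simp add: sum_distrib_left mult_ac)
  also have "\<dots> = (\<Sum>a<2*m. \<Sum>k<2*m. ?p k * (real (winding k) * (cmod (?V $$ (a,k)))\<^sup>2))"
    using w by (intro sum.cong refl) simp
  also have "\<dots> = (\<Sum>k<2*m. \<Sum>a<2*m. ?p k * (real (winding k) * (cmod (?V $$ (a,k)))\<^sup>2))"
    by (rule sum.swap)
  also have "\<dots> = (\<Sum>k<2*m. ?p k * (real (winding k) * (\<Sum>a<2*m. (cmod (?V $$ (a,k)))\<^sup>2)))"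
    by (simp add: sum_distrib_left)
  also have "\<dots> = (\<Sum>k<2*m. real (winding k) * ?p k)" using col by (intro sum.cong refl) simp
  finally show ?thesis .
qed

section \<open>Counting phases\<close>

text \<open>The thresholds are thus the nonnegative centred positions \<open>p - m/2\<close> of the
  blocks, at \<open>p = j + (m + 1) div 2\<close>.\<close>

lemma delta_k_eq: "delta_k m j = real (j + (m + 1) div 2) - real m / 2"
proof -
  have "\<lceil>real m / 2\<rceil> = int ((m + 1) div 2)"
  proof (cases "even m")
    case True
    then obtain q where "m = 2 * q" by blast
    thus ?thesis by simp
  next
    case False
    then obtain q where "m = 2 * q + 1" by (blast elim: oddE)
    thus ?thesis by (intro ceiling_unique) auto
  qed
  thus ?thesis by (simp add: delta_k_def)
qed

lemma delta_gt_half: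
  assumes "m \<ge> 2" "\<gamma> > 0" "u > 0"
  shows "delta m \<gamma> u > 1/2"
proof -
  have "sqrt ((1/2)\<^sup>2) < delta m \<gamma> u"
    unfolding delta_def using assms by (intro real_sqrt_less_mono) (simp add: power2_eq_square)
  thus ?thesis by simp
qed

text \<open>This is where \<open>delta\<close> comes from: it is the half-splitting of a block in
  units of the absolute energy step between neighbouring layers.\<close>

lemma sqrt_block_radius:
  assumes "m \<ge> 2" "v \<noteq> 0"
  shows "sqrt ((v / (real m - 1))\<^sup>2 / 4 + \<gamma>\<^sup>2) = \<bar>v / (real m - 1)\<bar> * delta m \<gamma> v"
proof -
  have "(v / (real m - 1))\<^sup>2 / 4 + \<gamma>\<^sup>2 = (v / (real m - 1))\<^sup>2 * (\<gamma>\<^sup>2 * (real m - 1)\<^sup>2 / v\<^sup>2 + 1/4)"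
    using assms by (simp add: power_divide distrib_left)
  thus ?thesis by (simp add: delta_def real_sqrt_mult)
qed

lemma block_eigenvalue_inner:
  assumes "m \<ge> 2" "v \<noteq> 0" "k \<noteq> 0" "k \<noteq> 2*m - 1"
  shows "block_eigenvalue m \<gamma> v k = v / (real m - 1) * (real (winding k) - real m / 2)
     + (if odd k then - 1 else 1) * (\<bar>v / (real m - 1)\<bar> * delta m \<gamma> v)"
  using assms by (simp add: block_eigenvalue_def sqrt_block_radius Let_def)

lemma block_eigenvalue_outer:
  assumes "m \<ge> 2"
  shows "block_eigenvalue m \<gamma> v 0 = - v / 2" "block_eigenvalue m \<gamma> v (2*m - 1) = v / 2"
  using assms by (auto simp: block_eigenvalue_def layer_energy_def Let_def field_simps of_nat_diff)

lemma winding_bounds: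
  assumes "k < 2*m" "k \<noteq> 0" "k \<noteq> 2*m - 1"
  shows "0 < winding k" "winding k < m"
  using assms unfolding winding_def by linarith+

text \<open>The outer eigenvalues are \<open>-v/2\<close> and \<open>v/2\<close>; an inner one
  vanishes only if the centred position of its block has modulus
  \<open>delta m \<gamma> v\<close>.\<close>

lemma block_eigenvalue_nonzero:
  assumes m: "m \<ge> 2" and v: "v \<noteq> 0" and k: "k < 2*m"
    and gap: "\<And>p. 0 < p \<Longrightarrow> p < m \<Longrightarrow> \<bar>real p - real m / 2\<bar> \<noteq> delta m \<gamma> v"
  shows "block_eigenvalue m \<gamma> v k \<noteq> 0"
proof (cases "k = 0 \<or> k = 2*m - 1")
  case True
  thus ?thesis using block_eigenvalue_outer[OF m, of \<gamma> v] v by (elim disjE) simp_all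
next
  case False
  define \<Delta> where "\<Delta> = v / (real m - 1)"
  have \<Delta>: "\<Delta> \<noteq> 0" using v m by (simp add: \<Delta>_def)
  have d: "delta m \<gamma> v \<ge> 0" by (simp add: delta_def)
  show ?thesis
  proof
    assume "block_eigenvalue m \<gamma> v k = 0"
    hence "\<Delta> * (real (winding k) - real m / 2) = \<bar>\<Delta>\<bar> * delta m \<gamma> v
        \<or> \<Delta> * (real (winding k) - real m / 2) = - (\<bar>\<Delta>\<bar> * delta m \<gamma> v)"
      using block_eigenvalue_inner[OF m v, of k \<gamma>] False
      unfolding \<Delta>_def[symmetric] by (cases "odd k") auto
    moreover have "\<bar>\<Delta>\<bar> * delta m \<gamma> v \<ge> 0" using d by simp
    ultimately have "\<bar>\<Delta> * (real (winding k) - real m / 2)\<bar> = \<bar>\<Delta>\<bar> * delta m \<gamma> v"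
      by (elim disjE) (simp_all only: abs_minus_cancel abs_of_nonneg)
    hence "\<bar>real (winding k) - real m / 2\<bar> = delta m \<gamma> v" using \<Delta> by (simp add: abs_mult)
    moreover have k': "k \<noteq> 0" "k \<noteq> 2*m - 1" using False by auto
    ultimately show False using gap[OF winding_bounds[OF k k']] by metis
  qed
qed

lemma gapped_hamiltonianI:
  assumes m: "m \<ge> 2" and \<gamma>: "\<gamma> \<noteq> 0" and v: "v \<noteq> 0"
    and gap: "\<And>p. 0 < p \<Longrightarrow> p < m \<Longrightarrow> \<bar>real p - real m / 2\<bar> \<noteq> delta m \<gamma> v"
  shows "gapped_hamiltonian m \<gamma> v"
proof
  obtain c s where S: "spectral_decomp (2*m) (Hmat m \<gamma> v 0) (block_rotation m c s) (block_eigenvalue m \<gamma> v)"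
    using block_rotation_diagonalises[OF m \<gamma>] by blast
  fix V lam i assume "spectral_decomp (2*m) (Hmat m \<gamma> v 0) V lam" "i < 2*m"
  thus "lam i \<noteq> 0"
    using spectral_decomp_nonzero_unique[OF S] block_eigenvalue_nonzero[OF m v _ gap] by blast
qed (rule \<gamma>)

section \<open>Occupations and the invariant in each phase\<close>

lemma sum_pairs: "(\<Sum>k<2*m. f k) = (\<Sum>b<m. f (2*b) + f (2*b+1))" for f :: "nat \<Rightarrow> real"
  by (induction m) (auto simp: add_ac)

lemma sum_Suc_upto: "P \<le> M \<Longrightarrow> (\<Sum>b<M. if b + 1 \<le> P then real (b + 1) else 0) = real P * (real P + 1) / 2"
proof (induction P)
  case (Suc P)
  have "(\<Sum>b<M. if b + 1 \<le> Suc P then real (b + 1) else 0)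
      = (\<Sum>b<M. (if b + 1 \<le> P then real (b + 1) else 0) + (if b = P then real (b + 1) else 0))"
    by (intro sum.cong) auto
  also have "\<dots> = real P * (real P + 1) / 2 + real (P + 1)"
    using Suc by (simp add: sum.distrib)
  finally show ?case by (simp add: field_simps)
qed simp

lemma sum_upto: "Q < M \<Longrightarrow> (\<Sum>b<M. if b \<le> Q then real b else 0) = real Q * (real Q + 1) / 2"
proof (induction Q)
  case 0
  have "(\<Sum>b<M. if b \<le> 0 then real b else 0) = 0" by (intro sum.neutral) auto
  thus ?case by simp
next
  case (Suc Q)
  have "(\<Sum>b<M. if b \<le> Suc Q then real b else 0)
      = (\<Sum>b<M. (if b \<le> Q then real b else 0) + (if b = Suc Q then real b else 0))"
    by (intro sum.cong) auto
  also have "\<dots> = real Q * (real Q + 1) / 2 + real (Suc Q)"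
    using Suc by (simp add: sum.distrib)
  finally show ?case by (simp add: field_simps)
qed

text \<open>In units of the energy step, the lower eigenvalue of block \<open>p\<close> is
  \<open>p - m/2 - delta\<close>, negative for \<open>p \<le> P\<close>; the upper one is the
  negative of the lower eigenvalue of block \<open>m - p\<close>, hence negative for
  \<open>p < m - P\<close>. The two triangular sums count these blocks with weight
  \<open>p\<close>.\<close>

lemma occupied_moment_phase:
  assumes m: "m \<ge> 2" and \<gamma>: "\<gamma> > 0" and u: "u > 0" and P: "P < m"
    and below: "\<And>p. 0 < p \<Longrightarrow> p < m \<Longrightarrow> p \<le> P \<Longrightarrow> real p - real m / 2 < delta m \<gamma> u"
    and above: "\<And>p. 0 < p \<Longrightarrow> p < m \<Longrightarrow> p > P \<Longrightarrow> real p - real m / 2 > delta m \<gamma> u"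
  shows "occupied_moment m \<gamma> u 0
    = real P * (real P + 1) / 2 + (real m - real P - 1) * (real m - real P) / 2"
proof -
  define \<Delta> where "\<Delta> = u / (real m - 1)"
  have \<Delta>: "\<Delta> > 0" using u m by (simp add: \<Delta>_def)
  let ?l = "block_eigenvalue m \<gamma> u"
  have e: "real (winding (2*b)) * neg_ind ?l (2*b) = (if b \<le> m - P - 1 then real b else 0)" if b: "b < m" for b
  \<comment> \<open>Index 0 carries the negative eigenvalue \<open>-u/2\<close>, but its winding is
    0.\<close>
  proof (cases "b = 0")
    case False
    have ne: "2*b \<noteq> 2*m - 1" using m by presburger
    have "?l (2*b) = \<Delta> * (real b - real m / 2) + \<Delta> * delta m \<gamma> u"
      using block_eigenvalue_inner[OF m _ _ ne, of u \<gamma>] False u \<Delta> unfolding \<Delta>_def[symmetric]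
      by (simp add: winding_def)
    also have "\<dots> = \<Delta> * (delta m \<gamma> u - (real (m - b) - real m / 2))"
      using b by (simp add: algebra_simps of_nat_diff)
    finally have l: "?l (2*b) < 0 \<longleftrightarrow> delta m \<gamma> u < real (m - b) - real m / 2"
      using \<Delta> by (simp add: mult_less_0_iff)
    have "?l (2*b) < 0 \<longleftrightarrow> m - b > P"
      unfolding l using below[of "m - b"] above[of "m - b"] b False by (cases "m - b \<le> P") auto
    moreover have "m - b > P \<longleftrightarrow> b \<le> m - P - 1" using b P by auto
    ultimately show ?thesis by (simp add: neg_ind_def winding_def)
  qed (simp add: winding_def)
  have o: "real (winding (2*b+1)) * neg_ind ?l (2*b+1) = (if b + 1 \<le> P then real (b + 1) else 0)" if b: "b < m" for b
  \<comment> \<open>The last index carries \<open>u/2\<close>, which is positive; accordingly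
    \<open>b + 1 = m\<close> exceeds \<open>P\<close>.\<close>
  proof (cases "b + 1 = m")
    case True
    hence "2*b+1 = 2*m - 1" by auto
    thus ?thesis using block_eigenvalue_outer(2)[OF m, of \<gamma> u] u P True by (simp add: neg_ind_def)
  next
    case False
    have ne: "2*b+1 \<noteq> 2*m - 1" using False b by linarith
    have "?l (2*b+1) = \<Delta> * (real (b+1) - real m / 2) - \<Delta> * delta m \<gamma> u"
      using block_eigenvalue_inner[OF m _ _ ne, of u \<gamma>] u \<Delta> unfolding \<Delta>_def[symmetric]
      by (simp add: winding_def)
    also have "\<dots> = \<Delta> * (real (b+1) - real m / 2 - delta m \<gamma> u)" by (simp add: algebra_simps)
    finally have l: "?l (2*b+1) < 0 \<longleftrightarrow> real (b+1) - real m / 2 < delta m \<gamma> u"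
      using \<Delta> by (simp add: mult_less_0_iff)
    have "?l (2*b+1) < 0 \<longleftrightarrow> b + 1 \<le> P"
      unfolding l using below[of "b+1"] above[of "b+1"] b False by (cases "b + 1 \<le> P") auto
    thus ?thesis by (simp add: neg_ind_def winding_def)
  qed
  have "occupied_moment m \<gamma> u 0
      = (\<Sum>b<m. (if b \<le> m - P - 1 then real b else 0) + (if b + 1 \<le> P then real (b + 1) else 0))"
    unfolding occupied_moment_zero[OF m less_imp_neq[OF \<gamma>, symmetric]] sum_pairs using e o by (intro sum.cong refl) simp
  also have "\<dots> = real (m - P - 1) * (real (m - P - 1) + 1) / 2 + real P * (real P + 1) / 2"
    unfolding sum.distrib using P by (subst sum_upto, simp, subst sum_Suc_upto) auto
  finally show ?thesis using P by (simp add: of_nat_diff)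
qed

text \<open>Alternating signs followed by negation keep the coupling entries and negate the layer
  energies, which is the passage from \<open>u\<close> to \<open>-u\<close>; occupations turn into
  their complements, and the windings add up to \<open>m^2\<close>.\<close>

lemma occupied_moment_flip:
  assumes "gapped_hamiltonian m \<gamma> u"
  shows "occupied_moment m \<gamma> (-u) 0 = (real m)\<^sup>2 - occupied_moment m \<gamma> u 0"
proof -
  interpret gapped_hamiltonian m \<gamma> u by fact
  obtain V lam where S: "spectral_decomp (2*m) (Hmat m \<gamma> u 0) V lam" using Hmat_spectral_decomp by blast
  have "neg_proj (Hmat m \<gamma> (-u) 0) $$ (a,a) = 1 - neg_proj (Hmat m \<gamma> u 0) $$ (a,a)" if a: "a < 2*m" for a
  proof (rule neg_proj_diag_flip[OF S Hmat_carrier, where sg = "\<lambda>a. (-1) ^ a"])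
    fix i j assume "i < 2*m" "j < 2*m"
    moreover have "layer_energy m (-u) b = - layer_energy m u b" for b by (simp add: layer_energy_def)
    ultimately show "Hmat m \<gamma> (-u) 0 $$ (i,j) = - ((-1) ^ i) * cnj ((-1) ^ j) * Hmat m \<gamma> u 0 $$ (i,j)"
      by (auto simp: Hmat_index simp flip: power_add)
  qed (use a gap0[OF S] in \<open>auto simp: norm_power\<close>)
  hence "occupied_moment m \<gamma> (-u) 0 = (\<Sum>a<2*m. real (winding a) - real (winding a) * Re (neg_proj (Hmat m \<gamma> u 0) $$ (a,a)))"
    unfolding occupied_moment_def by (intro sum.cong refl) (simp add: right_diff_distrib)
  thus ?thesis by (simp add: sum_subtractf sum_winding occupied_moment_def)
qed

lemma BDI_phase:
  assumes m: "m \<ge> 2" and \<gamma>: "\<gamma> > 0" and u: "u > 0" and j: "j < m div 2"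
    and lo: "delta_k m j < delta m \<gamma> u" and hi: "j + 1 < m div 2 \<Longrightarrow> delta m \<gamma> u < delta_k m (j + 1)"
  shows "BDI m \<gamma> u = complex_of_real (BDI_val m j)"
proof -
  \<comment> \<open>The last block whose centred position is below
    \<open>delta m \<gamma> u\<close>. For the last \<open>j\<close> it equals \<open>m - 1\<close>,
    and \<open>above\<close> is then vacuous.\<close>
  define P where "P = j + (m + 1) div 2"
  have P: "P < m" using j unfolding P_def by linarith
  have dk: "delta_k m j = real P - real m / 2" by (simp add: delta_k_eq P_def)
  have below: "real p - real m / 2 < delta m \<gamma> u" if "p \<le> P" for p
    using that lo dk by linarith
  have above: "real p - real m / 2 > delta m \<gamma> u" if "p < m" "p > P" for p
  proof -
    have "j + 1 < m div 2" using that unfolding P_def by linarith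
    hence "delta m \<gamma> u < real (P + 1) - real m / 2" using hi by (simp add: delta_k_eq P_def)
    thus ?thesis using that by linarith
  qed
  \<comment> \<open>Blocks \<open>p\<close> and \<open>m - p\<close> sit at opposite centred
    positions, so only the nonnegative side must be compared.\<close>
  have gap: "\<bar>real p - real m / 2\<bar> \<noteq> delta m \<gamma> u" if p: "0 < p" "p < m" for p
  proof (cases "real p \<ge> real m / 2")
    case True
    thus ?thesis using below[of p] above[of p] p by (cases "p \<le> P") auto
  next
    case False
    hence "\<bar>real p - real m / 2\<bar> = real (m - p) - real m / 2" using p by (simp add: of_nat_diff)
    thus ?thesis using below[of "m - p"] above[of "m - p"] p by (cases "m - p \<le> P") auto
  qed
  have dm: "delta m \<gamma> (-u) = delta m \<gamma> u" by (simp add: delta_def)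
  interpret N: gapped_hamiltonian m \<gamma> u
    using m \<gamma> u gap by (intro gapped_hamiltonianI) auto
  interpret S: gapped_hamiltonian m \<gamma> "-u"
    using m \<gamma> u gap dm by (intro gapped_hamiltonianI) auto
  have "BDI m \<gamma> u = complex_of_real (occupied_moment m \<gamma> (-u) 0 - occupied_moment m \<gamma> u 0)"
    unfolding BDI_def N.chern_eq S.chern_eq by simp
  also have "occupied_moment m \<gamma> (-u) 0 - occupied_moment m \<gamma> u 0 = (real m)\<^sup>2 - 2 * occupied_moment m \<gamma> u 0"
    using occupied_moment_flip[OF N.gapped_hamiltonian_axioms] by simp
  also have "\<dots> = (real m)\<^sup>2 - 2 * (real P * (real P + 1) / 2 + (real m - real P - 1) * (real m - real P) / 2)"
    using occupied_moment_phase[OF m \<gamma> u P below above] by simp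
  \<comment> \<open>With d = P - m/2 the two triangular terms add up to d^2 + d + m^2/4.\<close>
  also have "\<dots> = BDI_val m j"
    unfolding BDI_val_def dk by (simp add: power2_eq_square field_simps)
  finally show ?thesis .
qed

text \<open>The function \<open>t * (t + 1)\<close> increases for nonnegative t, where the
  thresholds lie.\<close>

lemma BDI_val_strict_antimono:
  assumes "i < j"
  shows "BDI_val m j < BDI_val m i"
proof -
  have "real m / 2 \<le> real ((m + 1) div 2)" by linarith
  hence nn: "delta_k m i \<ge> 0" "delta_k m i < delta_k m j" using assms by (simp_all add: delta_k_eq)
  hence "delta_k m i * (delta_k m i + 1) < delta_k m j * (delta_k m j + 1)"
    by (intro mult_strict_mono) auto
  thus ?thesis by (simp add: BDI_val_def)
qed

text \<open>The guard \<open>j + 1 < m div 2\<close> drops the upper bound for the last phase, whose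
  next threshold is infinite. The cardinality holds because every admissible pair falls into one
  phase, no phase is empty and the values decrease strictly in \<open>j\<close>.\<close>

theorem theorem2p3:
  fixes m :: nat
  assumes "m \<ge> 2"
  shows "(\<forall>\<gamma> u j. \<gamma> > 0 \<longrightarrow> u > 0 \<longrightarrow> j < m div 2 \<longrightarrow>
            delta_k m j < delta m \<gamma> u \<longrightarrow>
            (j + 1 < m div 2 \<longrightarrow> delta m \<gamma> u < delta_k m (j + 1)) \<longrightarrow>
            BDI m \<gamma> u = complex_of_real (BDI_val m j))
       \<and> card {BDI m \<gamma> u | \<gamma> u. \<gamma> > 0 \<and> u > 0 \<and> (\<forall>k < m div 2. delta m \<gamma> u \<noteq> delta_k m k)}
           = m div 2"
proof
  show "\<forall>\<gamma> u j. \<gamma> > 0 \<longrightarrow> u > 0 \<longrightarrow> j < m div 2 \<longrightarrow>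
            delta_k m j < delta m \<gamma> u \<longrightarrow>
            (j + 1 < m div 2 \<longrightarrow> delta m \<gamma> u < delta_k m (j + 1)) \<longrightarrow>
            BDI m \<gamma> u = complex_of_real (BDI_val m j)"
    using BDI_phase[OF assms] by blast
  have "{BDI m \<gamma> u | \<gamma> u. \<gamma> > 0 \<and> u > 0 \<and> (\<forall>k < m div 2. delta m \<gamma> u \<noteq> delta_k m k)}
      = (\<lambda>j. complex_of_real (BDI_val m j)) ` {..<m div 2}" (is "?A = ?B")
  proof
    show "?A \<subseteq> ?B"
    proof
      fix z assume "z \<in> ?A"
      then obtain \<gamma> u where z: "z = BDI m \<gamma> u" and gu: "\<gamma> > 0" "u > 0"
        and ne: "\<forall>k < m div 2. delta m \<gamma> u \<noteq> delta_k m k" by blast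
      \<comment> \<open>The phase of the pair is given by the largest threshold below its
        \<open>delta\<close>; one exists since the lowest threshold is at most 1/2 and
        \<open>delta\<close> exceeds 1/2.\<close>
      define K where "K = {k. k < m div 2 \<and> delta_k m k < delta m \<gamma> u}"
      have "delta_k m 0 \<le> 1/2"
      proof -
        have "2 * ((m + 1) div 2) \<le> m + 1" by simp
        hence "2 * real ((m + 1) div 2) \<le> real m + 1" by linarith
        thus ?thesis unfolding delta_k_eq by (simp add: field_simps)
      qed
      hence "0 \<in> K" using delta_gt_half[OF assms gu] assms by (simp add: K_def)
      hence M: "Max K \<in> K" by (intro Max_in) (auto simp: K_def)
      have "z = complex_of_real (BDI_val m (Max K))"
        unfolding z
      proof (rule BDI_phase[OF assms gu])
        assume a: "Max K + 1 < m div 2"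
        have "Max K + 1 \<notin> K"
        proof
          assume "Max K + 1 \<in> K"
          hence "Max K + 1 \<le> Max K" by (intro Max_ge) (auto simp: K_def)
          thus False by simp
        qed
        hence "\<not> delta_k m (Max K + 1) < delta m \<gamma> u" using a by (simp add: K_def)
        moreover have "delta m \<gamma> u \<noteq> delta_k m (Max K + 1)" using ne a by blast
        ultimately show "delta m \<gamma> u < delta_k m (Max K + 1)" by linarith
      qed (use M in \<open>auto simp: K_def\<close>)
      thus "z \<in> ?B" using M by (auto simp: K_def)
    qed
    show "?B \<subseteq> ?A"
    proof
      fix z assume "z \<in> ?B"
      then obtain j where j: "j < m div 2" and z: "z = complex_of_real (BDI_val m j)" by auto
      \<comment> \<open>Thresholds are spaced by one, so an offset of 3/4 lies strictly inside the
        phase; unlike 1/2 it keeps \<open>d\<close> above 1/2 even when the threshold is 0, so that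
        the \<open>\<gamma>\<close> solving \<open>delta m \<gamma> 1 = d\<close> is
        positive.\<close>
      define d where "d = delta_k m j + 3/4"
      define \<gamma> where "\<gamma> = sqrt (d\<^sup>2 - 1/4) / (real m - 1)"
      have "real m / 2 \<le> real ((m + 1) div 2)" by linarith
      hence "d \<ge> 3/4" by (simp add: d_def delta_k_eq)
      hence d2: "d\<^sup>2 > 1/4" using power_mono[of "3/4" d 2] by (simp add: power2_eq_square)
      have \<gamma>: "\<gamma> > 0" using d2 assms by (simp add: \<gamma>_def)
      have del: "delta m \<gamma> 1 = d"
      proof -
        have "\<gamma>\<^sup>2 * (real m - 1)\<^sup>2 = d\<^sup>2 - 1/4" using d2 assms by (simp add: \<gamma>_def power_divide)
        thus ?thesis using \<open>d \<ge> 3/4\<close> by (simp add: delta_def)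
      qed
      have ne: "delta m \<gamma> 1 \<noteq> delta_k m k" for k
      proof
        assume "delta m \<gamma> 1 = delta_k m k"
        hence "4 * real j + 3 = 4 * real k" unfolding del d_def delta_k_eq by simp
        hence "4 * j + 3 = 4 * k" by linarith
        thus False by presburger
      qed
      have "BDI m \<gamma> 1 = z"
        unfolding z by (rule BDI_phase[OF assms \<gamma> _ j]) (auto simp: del d_def delta_k_eq)
      thus "z \<in> ?A" using \<gamma> ne by (intro CollectI exI[of _ \<gamma>] exI[of _ 1]) auto
    qed
  qed
  moreover have "inj_on (\<lambda>j. complex_of_real (BDI_val m j)) {..<m div 2}"
  proof (rule inj_onI)
    fix i j assume "complex_of_real (BDI_val m i) = complex_of_real (BDI_val m j)"
    thus "i = j" using BDI_val_strict_antimono[of i j m] BDI_val_strict_antimono[of j i m]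
      by (cases i j rule: linorder_cases) auto
  qed
  ultimately show "card {BDI m \<gamma> u | \<gamma> u. \<gamma> > 0 \<and> u > 0 \<and> (\<forall>k < m div 2. delta m \<gamma> u \<noteq> delta_k m k)}
           = m div 2"
    by (simp add: card_image)
qed

end
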